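(* Let $\Gamma=\langle S\mid R\rangle$ be a finitely presented group such that $H^2(\Gamma,\mathcal H_\pi)=\{0\}$ for every unitary representation $\pi\colon\Gamma\to\mathrm U(\mathcal H_\pi)$ on a complex Hilbert space $\mathcal H_\pi$. Then $\Gamma$ is Frobenius-stable: for every sequence of natural numbers $(k_n)$ and every sequence of maps $\varphi_n\colon S\to\mathrm U(k_n)$ with $\lim_{n\to\mathcal U}\mathrm{def}(\varphi_n)=0$, one has $\lim_{n\to\mathcal U}\mathrm{homdist}(\varphi_n)=0$.
   Context: Fix a non-principal ultrafilter $\mathcal U$ on $\mathbb N$; $\lim_{n\to\mathcal U}$ denotes the limit along $\mathcal U$. $\langle S\mid R\rangle=\mathbb F_S/\langle\langle R\rangle\rangle$ with $S,R$ finite, $\mathbb F_S$ the free group on $S$. The Frobenius norm is $\|T\|_{\mathrm{Frob}}=\sqrt{\sum_{i,j}|T_{ij}|^2}$. A map $\varphi\colon S\to\mathrm U(k)$ is extended to the homomorphism $\mathbb F_S\to \mathrm U(k)$; $\mathrm{def}(\varphi)=\max_{r\in R}\|\varphi(r)-1_k\|_{\mathrm{Frob}}$ and $\mathrm{homdist}(\varphi)=\inf_{\rho\in\mathrm{Hom}(\Gamma,\mathrm U(k))}\max_{s\in S}\|\varphi(s)-\rho(s)\|_{\mathrm{Frob}}$. Group cohomology: for a $\Gamma$-module $V$ with action $\pi$, $C^n(\Gamma,V)$ is the set of all functions $\Gamma^n\to V$ (with $C^0=V$), with coboundary $d^n f(g_1,\dots,g_{n+1})=\pi(g_1)f(g_2,\dots,g_{n+1})+\sum_{j=1}^n(-1)^jf(g_1,\dots,g_jg_{j+1},\dots,g_{n+1})+(-1)^{n+1}f(g_1,\dots,g_n)$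 and $d^0v(g)=\pi(g)v-v$; $H^n(\Gamma,V)=\ker d^n/\mathrm{Im}\, d^{n-1}$. *)

theory Defs
  imports "HOL-Analysis.Analysis" "HOL-Algebra.Group" "HOL-Library.Function_Algebras"
begin

text \<open>Words in the free group on S: lists of letters (s, True) = s and (s, False) = s^-1.\<close>

definition word_on :: "'s set \<Rightarrow> ('s \<times> bool) list \<Rightarrow> bool" where
  "word_on S w \<longleftrightarrow> set w \<subseteq> S \<times> UNIV"

text \<open>Equality in the group given by the presentation: the congruence on words over S
  generated by free cancellation and by deleting a relator anywhere (i.e. equality
  modulo the normal closure of R in the free group on S).\<close>

inductive pres_eq :: "'s set \<Rightarrow> ('s \<times> bool) list set \<Rightarrow> ('s \<times> bool) list \<Rightarrow> ('s \<times> bool) list \<Rightarrow> bool"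
  for S R where
  refl: "word_on S w \<Longrightarrow> pres_eq S R w w"
| sym: "pres_eq S R u v \<Longrightarrow> pres_eq S R v u"
| trans: "pres_eq S R u v \<Longrightarrow> pres_eq S R v w \<Longrightarrow> pres_eq S R u w"
| cancel: "word_on S u \<Longrightarrow> word_on S v \<Longrightarrow> s \<in> S \<Longrightarrow>
      pres_eq S R (u @ [(s, b), (s, \<not> b)] @ v) (u @ v)"
| relator: "word_on S u \<Longrightarrow> word_on S v \<Longrightarrow> r \<in> R \<Longrightarrow>
      pres_eq S R (u @ r @ v) (u @ v)"

definition pclass :: "'s set \<Rightarrow> ('s \<times> bool) list set \<Rightarrow> ('s \<times> bool) list \<Rightarrow> ('s \<times> bool) list set" where
  "pclass S R w = {v. pres_eq S R w v}"

definition pgroup :: "'s set \<Rightarrow> ('s \<times> bool) list set \<Rightarrow> ('s \<times> bool) list set monoid" where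
  "pgroup S R = \<lparr> carrier = pclass S R ` {w. word_on S w},
                  mult = (\<lambda>A B. \<Union>a\<in>A. \<Union>b\<in>B. pclass S R (a @ b)),
                  one = pclass S R [] \<rparr>"

definition tuples :: "('g, 'b) monoid_scheme \<Rightarrow> nat \<Rightarrow> 'g list set" where
  "tuples G n = {gs. length gs = n \<and> set gs \<subseteq> carrier G}"

definition cochains :: "('g, 'b) monoid_scheme \<Rightarrow> 'v set \<Rightarrow> nat \<Rightarrow> ('g list \<Rightarrow> 'v) set" where
  "cochains G V n = {f. \<forall>gs \<in> tuples G n. f gs \<in> V}"

definition coboundary :: "('g, 'b) monoid_scheme \<Rightarrow> ('g \<Rightarrow> 'v \<Rightarrow> 'v) \<Rightarrow> nat
    \<Rightarrow> ('g list \<Rightarrow> 'v::ab_group_add) \<Rightarrow> 'g list \<Rightarrow> 'v" where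
  "coboundary G \<pi> n f gs =
     \<pi> (gs ! 0) (f (drop 1 gs))
     + (\<Sum>j = 1..n. (if even j then id else uminus)
          (f (take (j - 1) gs @ [gs ! (j - 1) \<otimes>\<^bsub>G\<^esub> gs ! j] @ drop (j + 1) gs)))
     + (if even (n + 1) then id else uminus) (f (take n gs))"

definition cocycles :: "('g, 'b) monoid_scheme \<Rightarrow> 'v set \<Rightarrow> ('g \<Rightarrow> 'v \<Rightarrow> 'v) \<Rightarrow> nat
    \<Rightarrow> ('g list \<Rightarrow> 'v::ab_group_add) set" where
  "cocycles G V \<pi> n = {f \<in> cochains G V n. \<forall>gs \<in> tuples G (n + 1). coboundary G \<pi> n f gs = 0}"

definition cohom_vanishes :: "('g, 'b) monoid_scheme \<Rightarrow> ('v::ab_group_add) set \<Rightarrow> ('g \<Rightarrow> 'v \<Rightarrow> 'v) \<Rightarrow> nat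
    \<Rightarrow> bool" where
  "cohom_vanishes G V \<pi> n \<longleftrightarrow>
     (\<forall>f \<in> cocycles G V \<pi> n.
        if n = 0 then (\<forall>gs \<in> tuples G 0. f gs = 0)
        else (\<exists>c \<in> cochains G V (n - 1). \<forall>gs \<in> tuples G n. f gs = coboundary G \<pi> (n - 1) c gs))"

definition ell2 :: "'i set \<Rightarrow> ('i \<Rightarrow> complex) set" where
  "ell2 I = {x. (\<forall>i. i \<notin> I \<longrightarrow> x i = 0) \<and> (\<lambda>i. (cmod (x i))\<^sup>2) summable_on I}"

definition ell2_inner :: "'i set \<Rightarrow> ('i \<Rightarrow> complex) \<Rightarrow> ('i \<Rightarrow> complex) \<Rightarrow> complex" where
  "ell2_inner I x y = (\<Sum>\<^sub>\<infinity>i\<in>I. x i * cnj (y i))"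

definition unitary_op :: "'i set \<Rightarrow> (('i \<Rightarrow> complex) \<Rightarrow> ('i \<Rightarrow> complex)) \<Rightarrow> bool" where
  "unitary_op I T \<longleftrightarrow>
     bij_betw T (ell2 I) (ell2 I)
     \<and> (\<forall>x \<in> ell2 I. \<forall>y \<in> ell2 I. \<forall>a b. T (\<lambda>i. a * x i + b * y i) = (\<lambda>i. a * T x i + b * T y i))
     \<and> (\<forall>x \<in> ell2 I. \<forall>y \<in> ell2 I. ell2_inner I (T x) (T y) = ell2_inner I x y)"

definition unitary_rep :: "('g, 'b) monoid_scheme \<Rightarrow> 'i set \<Rightarrow> ('g \<Rightarrow> ('i \<Rightarrow> complex) \<Rightarrow> ('i \<Rightarrow> complex)) \<Rightarrow> bool" where
  "unitary_rep G I \<pi> \<longleftrightarrow>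
     (\<forall>g \<in> carrier G. unitary_op I (\<pi> g))
     \<and> (\<forall>g \<in> carrier G. \<forall>h \<in> carrier G. \<forall>x \<in> ell2 I. \<pi> (g \<otimes>\<^bsub>G\<^esub> h) x = \<pi> g (\<pi> h x))
     \<and> (\<forall>x \<in> ell2 I. \<pi> \<one>\<^bsub>G\<^esub> x = x)"

text \<open>A k x k complex matrix is represented as a function nat => nat => complex
  that vanishes outside {..<k} x {..<k}.\<close>

type_synonym cmat = "nat \<Rightarrow> nat \<Rightarrow> complex"

definition mid :: "nat \<Rightarrow> cmat" where
  "mid k = (\<lambda>i j. if i < k \<and> i = j then 1 else 0)"

definition mmult :: "nat \<Rightarrow> cmat \<Rightarrow> cmat \<Rightarrow> cmat" where
  "mmult k A B = (\<lambda>i j. if i < k \<and> j < k then (\<Sum>l<k. A i l * B l j) else 0)"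

definition madj :: "cmat \<Rightarrow> cmat" where
  "madj A = (\<lambda>i j. cnj (A j i))"

definition unitary_mat :: "nat \<Rightarrow> cmat \<Rightarrow> bool" where
  "unitary_mat k A \<longleftrightarrow> (\<forall>i j. \<not> (i < k \<and> j < k) \<longrightarrow> A i j = 0)
      \<and> mmult k (madj A) A = mid k \<and> mmult k A (madj A) = mid k"

definition Ugroup :: "nat \<Rightarrow> cmat monoid" where
  "Ugroup k = \<lparr> carrier = {A. unitary_mat k A}, mult = mmult k, one = mid k \<rparr>"

definition frob :: "nat \<Rightarrow> cmat \<Rightarrow> real" where
  "frob k A = sqrt (\<Sum>i<k. \<Sum>j<k. (cmod (A i j))\<^sup>2)"

definition eval_word :: "nat \<Rightarrow> ('s \<Rightarrow> cmat) \<Rightarrow> ('s \<times> bool) list \<Rightarrow> cmat" where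
  "eval_word k \<phi> w = foldr (\<lambda>(s, b) M. mmult k (if b then \<phi> s else madj (\<phi> s)) M) w (mid k)"

text \<open>Maxima over S or R are taken with 0 inserted (harmless since all terms are \<ge> 0,
  and gives 0 for an empty index set).\<close>

definition pdef :: "('s \<times> bool) list set \<Rightarrow> nat \<Rightarrow> ('s \<Rightarrow> cmat) \<Rightarrow> real" where
  "pdef R k \<phi> = Max (insert 0 ((\<lambda>r. frob k (\<lambda>i j. eval_word k \<phi> r i j - mid k i j)) ` R))"

definition homdist :: "'s set \<Rightarrow> ('s \<times> bool) list set \<Rightarrow> nat \<Rightarrow> ('s \<Rightarrow> cmat) \<Rightarrow> real" where
  "homdist S R k \<phi> =
     Inf ((\<lambda>\<rho>. Max (insert 0 ((\<lambda>s. frob k (\<lambda>i j. \<phi> s i j - \<rho> (pclass S R [(s, True)]) i j)) ` S)))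
          ` hom (pgroup S R) (Ugroup k))"

definition nonprincipal_ultrafilter :: "nat filter \<Rightarrow> bool" where
  "nonprincipal_ultrafilter F \<longleftrightarrow> F \<noteq> bot
     \<and> (\<forall>A. eventually (\<lambda>n. n \<in> A) F \<or> eventually (\<lambda>n. n \<notin> A) F)
     \<and> (\<forall>m. eventually (\<lambda>n. n \<noteq> m) F)"

end

theory Submission
  imports Defs
begin

text \<open>Let \<open>\<phi>\<^sub>n\<close> be almost multiplicative with defect \<open>d\<^sub>n \<rightarrow> 0\<close> and extend it to maps \<open>\<sigma>\<^sub>n\<close> on \<open>\<Gamma>\<close> by
  choosing words. The rescaled errors \<open>\<alpha>\<^sub>n(g,h) = (\<sigma>\<^sub>n(g) \<sigma>\<^sub>n(h) \<sigma>\<^sub>n(gh)\<^sup>* - 1) / d\<^sub>n\<close> stay bounded, and along the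
  ultrafilter they form a 2-cocycle for the unitary representation obtained from conjugation by \<open>\<sigma>\<^sub>n\<close>.
  The orbit of \<open>\<alpha>\<close> is countable, so instead of the full ultraproduct it suffices to apply
  Gram-Schmidt to it; in the resulting orthonormal family each \<open>\<pi>(g)\<close> has a row- and column-finite
  matrix, which acts on \<open>\<ell>\<^sup>2(I)\<close> by finite sums. Vanishing of \<open>H\<^sup>2\<close> gives a primitive \<open>\<beta>\<close>, and a
  truncation of \<open>\<beta>\<close> lifts to matrices \<open>b\<^sub>n(g)\<close>, which may be taken skew-adjoint. Multiplying \<open>\<sigma>\<^sub>n(g)\<close> by
  a unitary close to \<open>1 - d\<^sub>n b\<^sub>n(g)\<close> (a Cayley transform) cancels the error to first order.
  Hence, with a constant uniform in the dimension, any \<open>\<phi>\<close> of small defect has a neighbour at distance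
  \<open>O(def \<phi>)\<close> with at most half the defect; iterating, one converges to a genuine representation at
  distance \<open>O(def \<phi>)\<close>.\<close>

section \<open>Finitely supported matrices\<close>

text \<open>Two features of the Frobenius norm make every estimate dimension-free: it is
  submultiplicative with constant 1, and it is unitarily invariant. Hence a product of two errors of
  size O(d) is O(d^2) in every dimension, and cancelling first-order terms is already a gain. Only a
  factor 1/2 is sought, not exact cancellation: the primitive \<open>\<beta>\<close> lives in a
  completion, and only finite combinations of the chosen vectors are turned into bounded sequences
  of matrices. A small error \<open>\<delta>\<close> therefore remains; it is fixed in advance from
  the longest relator, so that evaluating any relator at the corrected generators costs at most half
  of the old defect. Null sequences are never factored out: vectors are compared only through their
  inner products with all others, and genuine equality returns at the level of coordinates in
  \<open>ell2\<close>. Matrices of all sizes share one type, so that a sequence of varying size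
  \<open>k n\<close> is an ordinary function; the price is that \<open>idm k\<close> is a unit only
  on the block \<open>corner k\<close>, and that inverses are replaced by quasi-inverses.\<close>

typedef fmat = "{A :: nat \<Rightarrow> nat \<Rightarrow> complex. \<exists>k. \<forall>i j. A i j \<noteq> 0 \<longrightarrow> i < k \<and> j < k}"
  morphisms entry Mat
  by (rule exI[of _ "\<lambda>i j. 0"]) simp

setup_lifting type_definition_fmat

definition corner :: "nat \<Rightarrow> fmat \<Rightarrow> bool" where
  "corner k A \<longleftrightarrow> (\<forall>i j. entry A i j \<noteq> 0 \<longrightarrow> i < k \<and> j < k)"

lemma fmat_eqI: "(\<And>i j. entry A i j = entry B i j) \<Longrightarrow> A = B"
  by (metis entry_inject ext)

lemma ex_corner: "\<exists>k. corner k A"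
  using entry[of A] by (auto simp: corner_def)

lemma corner_mono: "corner k A \<Longrightarrow> k \<le> l \<Longrightarrow> corner l A"
  unfolding corner_def by fastforce

lemma ex_corner2: "\<exists>k. corner k A \<and> corner k B"
  by (metis ex_corner corner_mono le_cases)

lemma ex_corner3: "\<exists>k. corner k A \<and> corner k B \<and> corner k C"
  by (metis ex_corner2 ex_corner corner_mono le_cases)

section \<open>The algebra of finitely supported matrices with adjoint and Frobenius norm\<close>

instantiation fmat :: real_vector
begin

lift_definition zero_fmat :: fmat is "\<lambda>i j. 0" by simp

lift_definition plus_fmat :: "fmat \<Rightarrow> fmat \<Rightarrow> fmat" is "\<lambda>A B i j. A i j + B i j"
proof -
  fix A B :: "nat \<Rightarrow> nat \<Rightarrow> complex"
  assume "\<exists>k. \<forall>i j. A i j \<noteq> 0 \<longrightarrow> i < k \<and> j < k" "\<exists>k. \<forall>i j. B i j \<noteq> 0 \<longrightarrow> i < k \<and> j < k"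
  then obtain k l where "\<forall>i j. A i j \<noteq> 0 \<longrightarrow> i < k \<and> j < k" "\<forall>i j. B i j \<noteq> 0 \<longrightarrow> i < l \<and> j < l"
    by blast
  then have "\<forall>i j. A i j + B i j \<noteq> 0 \<longrightarrow> i < max k l \<and> j < max k l"
    by (metis add_0 less_max_iff_disj)
  then show "\<exists>k. \<forall>i j. A i j + B i j \<noteq> 0 \<longrightarrow> i < k \<and> j < k" by blast
qed

lift_definition uminus_fmat :: "fmat \<Rightarrow> fmat" is "\<lambda>A i j. - A i j" by simp

definition minus_fmat :: "fmat \<Rightarrow> fmat \<Rightarrow> fmat" where "minus_fmat A B = A + - B"

lift_definition scaleR_fmat :: "real \<Rightarrow> fmat \<Rightarrow> fmat" is "\<lambda>r A i j. of_real r * A i j" by auto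

lemma entry_simps [simp]:
  "entry 0 i j = 0" "entry (A + B) i j = entry A i j + entry B i j"
  "entry (- A) i j = - entry A i j" "entry (A - B) i j = entry A i j - entry B i j"
  "entry (r *\<^sub>R A) i j = of_real r * entry A i j"
  by (simp_all add: minus_fmat_def zero_fmat.rep_eq plus_fmat.rep_eq uminus_fmat.rep_eq scaleR_fmat.rep_eq)

instance
  by standard (rule fmat_eqI, simp add: algebra_simps)+

end

lift_definition scaleC :: "complex \<Rightarrow> fmat \<Rightarrow> fmat" (infixr "\<cdot>\<^sub>C" 75) is "\<lambda>a A i j. a * A i j" by auto

lift_definition adj :: "fmat \<Rightarrow> fmat" is madj
  by (metis complex_cnj_zero_iff madj_def)

lift_definition idm :: "nat \<Rightarrow> fmat" is mid by (auto simp: mid_def)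

lemma entry_simps' [simp]:
  "entry (a \<cdot>\<^sub>C A) i j = a * entry A i j" "entry (adj A) i j = cnj (entry A j i)"
  "entry (idm k) i j = (if i < k \<and> i = j then 1 else 0)"
  by (simp_all add: scaleC.rep_eq adj.rep_eq idm.rep_eq madj_def mid_def)

text \<open>Summing over the support of \<open>A\<close> keeps the sum finite without naming a size;
  the other terms vanish, so \<open>cinner_corner\<close> may use any block that contains
  \<open>A\<close>.\<close>

definition cinner :: "fmat \<Rightarrow> fmat \<Rightarrow> complex" where
  "cinner A B = (\<Sum>(i, j) | entry A i j \<noteq> 0. entry A i j * cnj (entry B i j))"

lemma cinner_corner:
  assumes "corner k A" shows "cinner A B = (\<Sum>i<k. \<Sum>j<k. entry A i j * cnj (entry B i j))"
proof -
  have "cinner A B = (\<Sum>(i, j)\<in>{..<k} \<times> {..<k}. entry A i j * cnj (entry B i j))"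
    unfolding cinner_def
    by (rule sum.mono_neutral_left) (use assms in \<open>auto simp: corner_def\<close>)
  then show ?thesis by (simp add: sum.cartesian_product)
qed

lemma cinner_add: "cinner (A + B) C = cinner A C + cinner B C"
proof -
  obtain k where "corner k A" "corner k B" "corner k (A + B)" using ex_corner3 by blast
  then show ?thesis by (simp add: cinner_corner sum.distrib distrib_right)
qed

lemma cinner_scaleC: "cinner (a \<cdot>\<^sub>C A) B = a * cinner A B"
proof -
  obtain k where "corner k A" "corner k (a \<cdot>\<^sub>C A)" using ex_corner2 by blast
  then show ?thesis by (simp add: cinner_corner sum_distrib_left mult.assoc)
qed

lemma scaleC_of_real: "of_real r \<cdot>\<^sub>C A = r *\<^sub>R A"
  by (rule fmat_eqI) simp

lemma cinner_commute: "cinner B A = cnj (cinner A B)"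
proof -
  obtain k where "corner k A" "corner k B" using ex_corner2 by blast
  then show ?thesis by (simp add: cinner_corner mult.commute)
qed

lemma cinner_self:
  assumes "corner k A" shows "cinner A A = of_real (\<Sum>i<k. \<Sum>j<k. (cmod (entry A i j))\<^sup>2)"
  unfolding cinner_corner[OF assms] of_real_sum by (simp only: complex_norm_square)

lemma cinner_eq_0: "cinner A A = 0 \<Longrightarrow> A = 0"
proof -
  assume 0: "cinner A A = 0"
  obtain k where k: "corner k A" using ex_corner by blast
  have "(\<Sum>i<k. \<Sum>j<k. (cmod (entry A i j))\<^sup>2) = 0"
    using 0 unfolding cinner_self[OF k] by (simp only: of_real_eq_0_iff)
  then have "\<forall>i<k. (\<Sum>j<k. (cmod (entry A i j))\<^sup>2) = 0"
    by (subst (asm) sum_nonneg_eq_0_iff) (auto intro: sum_nonneg)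
  then have "\<forall>i<k. \<forall>j<k. entry A i j = 0"
    by (simp add: sum_nonneg_eq_0_iff)
  then have "entry A i j = 0" for i j using k unfolding corner_def by blast
  then show "A = 0" by (intro fmat_eqI) simp
qed

instantiation fmat :: real_inner
begin

definition inner_fmat :: "fmat \<Rightarrow> fmat \<Rightarrow> real" where "inner_fmat A B = Re (cinner A B)"
definition norm_fmat :: "fmat \<Rightarrow> real" where "norm_fmat A = sqrt (Re (cinner A A))"
definition sgn_fmat :: "fmat \<Rightarrow> fmat" where "sgn_fmat A = A /\<^sub>R norm A"
definition dist_fmat :: "fmat \<Rightarrow> fmat \<Rightarrow> real" where "dist_fmat A B = norm (A - B)"
definition uniformity_fmat :: "(fmat \<times> fmat) filter" where
  "uniformity_fmat = (INF e\<in>{0<..}. principal {(x, y). dist x y < e})"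
definition open_fmat :: "fmat set \<Rightarrow> bool" where
  "open_fmat U = (\<forall>x\<in>U. eventually (\<lambda>(x', y). x' = x \<longrightarrow> y \<in> U) uniformity)"

instance
proof
  fix A B C :: fmat and r :: real
  show "dist A B = norm (A - B)" by (simp add: dist_fmat_def)
  show "sgn A = A /\<^sub>R norm A" by (simp add: sgn_fmat_def)
  show "(uniformity :: (fmat \<times> fmat) filter) = (INF e\<in>{0<..}. principal {(x, y). dist x y < e})"
    by (rule uniformity_fmat_def)
  show "open U \<longleftrightarrow> (\<forall>x\<in>U. \<forall>\<^sub>F (x', y) in uniformity. x' = x \<longrightarrow> y \<in> U)" for U :: "fmat set"
    by (rule open_fmat_def)
  show "A \<bullet> B = B \<bullet> A" unfolding inner_fmat_def by (subst cinner_commute) simp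
  show "(A + B) \<bullet> C = A \<bullet> C + B \<bullet> C" by (simp add: inner_fmat_def cinner_add)
  show "(r *\<^sub>R A) \<bullet> B = r * (A \<bullet> B)"
    by (simp add: inner_fmat_def cinner_scaleC flip: scaleC_of_real)
  obtain k where k: "corner k A" using ex_corner by blast
  show "0 \<le> A \<bullet> A" by (simp add: inner_fmat_def cinner_self[OF k] sum_nonneg del: of_real_sum of_real_power)
  have "A \<bullet> A = 0 \<Longrightarrow> cinner A A = 0"
    by (simp add: inner_fmat_def cinner_self[OF k] del: of_real_sum of_real_power)
  moreover have "cinner 0 0 = 0" by (simp add: cinner_def)
  ultimately show "A \<bullet> A = 0 \<longleftrightarrow> A = 0" using cinner_eq_0 by (auto simp: inner_fmat_def)
  show "norm A = sqrt (A \<bullet> A)" by (simp add: norm_fmat_def inner_fmat_def)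
qed

end

lemma norm_corner:
  assumes "corner k A" shows "norm A = sqrt (\<Sum>i<k. \<Sum>j<k. (cmod (entry A i j))\<^sup>2)"
  by (simp add: norm_fmat_def cinner_self[OF assms] del: of_real_sum of_real_power)

lemma cinner_self_norm: "cinner A A = of_real ((norm A)\<^sup>2)"
proof -
  obtain k where k: "corner k A" using ex_corner by blast
  show ?thesis unfolding norm_corner[OF k] cinner_self[OF k] by (simp add: sum_nonneg)
qed

lemma norm_entry_le: "cmod (entry A i j) \<le> norm A"
proof (cases "entry A i j = 0")
  case False
  obtain k where k: "corner k A" using ex_corner by blast
  then have ij: "i < k" "j < k" using False by (auto simp: corner_def)
  have "(cmod (entry A i j))\<^sup>2 \<le> (\<Sum>j<k. (cmod (entry A i j))\<^sup>2)"
    using ij by (intro member_le_sum) auto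
  also have "\<dots> \<le> (\<Sum>i<k. \<Sum>j<k. (cmod (entry A i j))\<^sup>2)"
    using ij by (intro member_le_sum[of i _ "\<lambda>i. \<Sum>j<k. (cmod (entry A i j))\<^sup>2"]) (auto intro: sum_nonneg)
  finally show ?thesis unfolding norm_corner[OF k] by (rule real_le_rsqrt)
qed simp

text \<open>Cauchy-Schwarz for each entry of the product, summed over all entries, gives
  submultiplicativity with constant 1. The class is the one without a unit: no finitely supported
  matrix is a unit for all sizes at once.\<close>

instantiation fmat :: real_normed_algebra
begin

lift_definition times_fmat :: "fmat \<Rightarrow> fmat \<Rightarrow> fmat" is
  "\<lambda>A B i j. \<Sum>l | A i l \<noteq> 0. A i l * B l j"
proof -
  fix A B :: "nat \<Rightarrow> nat \<Rightarrow> complex"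
  assume "\<exists>k. \<forall>i j. A i j \<noteq> 0 \<longrightarrow> i < k \<and> j < k" "\<exists>k. \<forall>i j. B i j \<noteq> 0 \<longrightarrow> i < k \<and> j < k"
  then obtain k l where k: "\<forall>i j. A i j \<noteq> 0 \<longrightarrow> i < k \<and> j < k" and l: "\<forall>i j. B i j \<noteq> 0 \<longrightarrow> i < l \<and> j < l"
    by blast
  have "i < max k l \<and> j < max k l" if "(\<Sum>l | A i l \<noteq> 0. A i l * B l j) \<noteq> 0" for i j
  proof -
    from that obtain m where "m \<in> {l. A i l \<noteq> 0}" "A i m * B m j \<noteq> 0"
      by (rule sum.not_neutral_contains_not_neutral)
    then have "A i m \<noteq> 0" "B m j \<noteq> 0" by auto
    then show ?thesis using k l by (meson less_max_iff_disj)
  qed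
  then show "\<exists>k. \<forall>i j. (\<Sum>l | A i l \<noteq> 0. A i l * B l j) \<noteq> 0 \<longrightarrow> i < k \<and> j < k" by blast
qed

lemma entry_mult:
  assumes "corner k A" shows "entry (A * B) i j = (\<Sum>l<k. entry A i l * entry B l j)"
  unfolding times_fmat.rep_eq
  by (rule sum.mono_neutral_left) (use assms in \<open>auto simp: corner_def\<close>)

lemma corner_mult: "corner k A \<Longrightarrow> corner k B \<Longrightarrow> corner k (A * B)"
  unfolding corner_def[of _ "A * B"] 
  by (auto simp: entry_mult elim!: sum.not_neutral_contains_not_neutral) (auto simp: corner_def)

instance
proof
  fix A B C :: fmat and r :: real
  obtain k where k: "corner k A" "corner k B" "corner k C" using ex_corner3 by blast
  obtain l where l: "corner l A" "corner l B" "corner l (A + B)" using ex_corner3 by blast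
  show "(A * B) * C = A * (B * C)"
    by (rule fmat_eqI)
      (use k in \<open>simp add: entry_mult[of k] corner_mult sum_distrib_left sum_distrib_right mult.assoc,
        subst sum.swap, simp\<close>)
  show "(A + B) * C = A * C + B * C"
    by (rule fmat_eqI) (use l in \<open>simp add: entry_mult[of l] sum.distrib distrib_right\<close>)
  show "A * (B + C) = A * B + A * C"
    by (rule fmat_eqI) (use k in \<open>simp add: entry_mult[of k] sum.distrib distrib_left\<close>)
  obtain m where m: "corner m A" "corner m (r *\<^sub>R A)" using ex_corner2 by blast
  show "r *\<^sub>R A * B = r *\<^sub>R (A * B)"
    by (rule fmat_eqI) (use m in \<open>simp add: entry_mult[of m] sum_distrib_left mult.assoc\<close>)
  show "A * r *\<^sub>R B = r *\<^sub>R (A * B)"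
    by (rule fmat_eqI) (use k in \<open>simp add: entry_mult[of k] sum_distrib_left mult.left_commute\<close>)
  define a b where "a i l = cmod (entry A i l)" and "b l j = cmod (entry B l j)" for i l j
  have "(cmod (entry (A * B) i j))\<^sup>2 \<le> (\<Sum>l<k. (a i l)\<^sup>2) * (\<Sum>l<k. (b l j)\<^sup>2)" for i j
  proof -
    have "cmod (entry (A * B) i j) \<le> (\<Sum>l<k. a i l * b l j)"
      unfolding entry_mult[OF k(1)] a_def b_def by (rule order_trans[OF norm_sum]) (simp add: norm_mult)
    then have "(cmod (entry (A * B) i j))\<^sup>2 \<le> (\<Sum>l<k. a i l * b l j)\<^sup>2" by (rule power_mono) simp
    also have "\<dots> \<le> (\<Sum>l<k. (a i l)\<^sup>2) * (\<Sum>l<k. (b l j)\<^sup>2)" by (rule Cauchy_Schwarz_ineq_sum)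
    finally show ?thesis .
  qed
  then have "(\<Sum>i<k. \<Sum>j<k. (cmod (entry (A * B) i j))\<^sup>2) \<le>
      (\<Sum>i<k. \<Sum>j<k. (\<Sum>l<k. (a i l)\<^sup>2) * (\<Sum>l<k. (b l j)\<^sup>2))"
    by (intro sum_mono)
  also have "\<dots> = (\<Sum>i<k. \<Sum>l<k. (a i l)\<^sup>2) * (\<Sum>j<k. \<Sum>l<k. (b l j)\<^sup>2)"
    by (simp add: sum_product)
  also have "(\<Sum>j<k. \<Sum>l<k. (b l j)\<^sup>2) = (\<Sum>l<k. \<Sum>j<k. (b l j)\<^sup>2)" by (rule sum.swap)
  finally show "norm (A * B) \<le> norm A * norm B"
    unfolding norm_corner[OF corner_mult[OF k(1,2)]] norm_corner[OF k(1)] norm_corner[OF k(2)]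
    by (simp add: a_def b_def flip: real_sqrt_mult)
qed

end

lemma corner_simps [simp]:
  "corner k 0" "corner k (idm k)" "corner k A \<Longrightarrow> corner k (- A)" "corner k A \<Longrightarrow> corner k (adj A)"
  "corner k A \<Longrightarrow> corner k (r *\<^sub>R A)" "corner k A \<Longrightarrow> corner k (a \<cdot>\<^sub>C A)"
  by (auto simp: corner_def)

lemma corner_zero: "corner k A \<Longrightarrow> \<not> (i < k \<and> j < k) \<Longrightarrow> entry A i j = 0"
  unfolding corner_def by blast

lemma corner_simps2 [simp]:
  assumes "corner k A" "corner k B"
  shows "corner k (A + B)" "corner k (A - B)" "corner k (A * B)"
  using assms corner_mult by (auto simp: corner_def[of _ "A + B"] corner_def[of _ "A - B"] corner_zero)
    (metis add_0 corner_zero, metis add_0 corner_zero, metis diff_0_right corner_zero, metis diff_0_right corner_zero)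

lemma idm_mult [simp]:
  assumes "corner k A" shows "idm k * A = A" "A * idm k = A"
proof -
  show "idm k * A = A"
  proof (rule fmat_eqI)
    fix i j
    have "entry (idm k * A) i j = (\<Sum>l<k. if l = i then entry A l j else 0)"
      unfolding entry_mult[OF corner_simps(2)] by (rule sum.cong) auto
    then show "entry (idm k * A) i j = entry A i j" using corner_zero[OF assms] by (auto simp: sum.delta)
  qed
  show "A * idm k = A"
  proof (rule fmat_eqI)
    fix i j
    have "entry (A * idm k) i j = (\<Sum>l<k. if l = j then entry A i l else 0)"
      unfolding entry_mult[OF assms] by (rule sum.cong) auto
    then show "entry (A * idm k) i j = entry A i j" using corner_zero[OF assms] by (auto simp: sum.delta)
  qed
qed

lemma adj_simps [simp]:
  "adj (adj A) = A" "adj (A + B) = adj A + adj B" "adj (A - B) = adj A - adj B" "adj (- A) = - adj A"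
  "adj (r *\<^sub>R A) = r *\<^sub>R adj A" "adj (idm k) = idm k" "adj 0 = 0"
  by (rule fmat_eqI, simp)+

lemma adj_mult [simp]: "adj (A * B) = adj B * adj A"
proof -
  obtain k where k: "corner k A" "corner k B" using ex_corner2 by blast
  show ?thesis
    by (rule fmat_eqI) (use k in \<open>simp add: entry_mult[of k] mult.commute\<close>)
qed

lemma cinner_mult_left: "cinner (A * B) C = cinner B (adj A * C)"
proof -
  obtain k where k: "corner k A" "corner k B" "corner k C" using ex_corner3 by blast
  have "cinner (A * B) C = (\<Sum>i<k. \<Sum>j<k. \<Sum>l<k. entry A i l * entry B l j * cnj (entry C i j))"
    using k by (simp add: cinner_corner[of k] entry_mult[of k] sum_distrib_right)
  also have "\<dots> = (\<Sum>i<k. \<Sum>l<k. \<Sum>j<k. entry A i l * entry B l j * cnj (entry C i j))"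
    by (rule sum.cong[OF HOL.refl], rule sum.swap)
  also have "\<dots> = (\<Sum>l<k. \<Sum>i<k. \<Sum>j<k. entry A i l * entry B l j * cnj (entry C i j))"
    by (rule sum.swap)
  also have "\<dots> = (\<Sum>l<k. \<Sum>j<k. \<Sum>i<k. entry A i l * entry B l j * cnj (entry C i j))"
    by (rule sum.cong[OF HOL.refl], rule sum.swap)
  also have "\<dots> = cinner B (adj A * C)"
    using k by (simp add: cinner_corner[of k] entry_mult[of k] sum_distrib_left algebra_simps)
  finally show ?thesis .
qed

lemma cinner_adj: "cinner (adj A) (adj B) = cnj (cinner A B)"
proof -
  obtain k where k: "corner k A" "corner k B" using ex_corner2 by blast
  show ?thesis using k by (simp add: cinner_corner[of k], subst sum.swap, simp add: mult.commute)
qed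

lemma norm_adj [simp]: "norm (adj A) = norm A"
  by (simp add: norm_fmat_def cinner_adj)

lemma bounded_linear_adj: "bounded_linear adj"
  by (rule bounded_linear_intro[of _ 1]) auto

lemmas tendsto_adj = bounded_linear.tendsto[OF bounded_linear_adj]

lemma cinner_scaleC_right: "cinner A (a \<cdot>\<^sub>C B) = cnj a * cinner A B"
  by (metis cinner_commute cinner_scaleC complex_cnj_mult)

lemma norm_scaleC: "norm (a \<cdot>\<^sub>C A) = cmod a * norm A"
proof -
  have "cinner (a \<cdot>\<^sub>C A) (a \<cdot>\<^sub>C A) = (a * cnj a) * cinner A A"
    by (simp add: cinner_scaleC cinner_scaleC_right)
  also have "\<dots> = of_real ((cmod a)\<^sup>2 * (norm A)\<^sup>2)"
    by (simp add: cinner_self_norm flip: complex_norm_square)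
  finally show ?thesis by (simp add: norm_fmat_def[of "a \<cdot>\<^sub>C A"] real_sqrt_mult del: of_real_mult of_real_power)
qed

lemma cmod_cinner_le: "cmod (cinner A B) \<le> norm A * norm B"
proof (cases "cinner A B = 0")
  case False
  \<comment> \<open>\<open>c\<close> is the unimodular phase that turns \<open>cinner A B\<close>
    into its modulus, which reduces the claim to the real Cauchy-Schwarz inequality.\<close>
  define c where "c = cnj (cinner A B) / cmod (cinner A B)"
  have "c * cinner A B = cmod (cinner A B)"
    using False complex_norm_square[of "cinner A B"]
    by (simp add: c_def power2_eq_square field_simps)
  then have "cmod (cinner A B) = Re (c * cinner A B)" by simp
  also have "\<dots> = (c \<cdot>\<^sub>C A) \<bullet> B" by (simp add: inner_fmat_def cinner_scaleC)
  also have "\<dots> \<le> norm (c \<cdot>\<^sub>C A) * norm B" by (rule norm_cauchy_schwarz)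
  also have "norm (c \<cdot>\<^sub>C A) = norm A" using False by (simp add: norm_scaleC c_def norm_divide)
  finally show ?thesis .
qed simp

section \<open>Unitaries, completeness of a block, and the Cayley transform\<close>

definition unitaries :: "nat \<Rightarrow> fmat set" where
  "unitaries k = {A. corner k A \<and> adj A * A = idm k \<and> A * adj A = idm k}"

lemma unitariesD:
  assumes "u \<in> unitaries k"
  shows "corner k u" "adj u * u = idm k" "u * adj u = idm k" "adj u \<in> unitaries k"
    "corner k A \<Longrightarrow> u * (adj u * A) = A" "corner k A \<Longrightarrow> adj u * (u * A) = A"
  using assms by (auto simp: unitaries_def simp flip: mult.assoc)

lemma idm_unitary [simp]: "idm k \<in> unitaries k"
  by (simp add: unitaries_def)

lemma unitary_mult: "u \<in> unitaries k \<Longrightarrow> v \<in> unitaries k \<Longrightarrow> u * v \<in> unitaries k"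
  by (auto simp: unitaries_def mult.assoc) (metis corner_simps(4) idm_mult(1) mult.assoc)+

text \<open>For left multiplication the unitary is moved across \<open>cinner\<close> and cancels;
  right multiplication reduces to this by \<open>adj\<close>.\<close>

lemma norm_unitary_mult:
  assumes "u \<in> unitaries k" "corner k A"
  shows "norm (u * A) = norm A" "norm (A * u) = norm A"
proof -
  have *: "norm (v * B) = norm B" if "v \<in> unitaries k" "corner k B" for v B
    using that by (simp add: norm_fmat_def cinner_mult_left unitariesD)
  show "norm (u * A) = norm A" using * assms .
  have "norm (A * u) = norm (adj u * adj A)" by (metis adj_mult norm_adj)
  also have "\<dots> = norm A" using * assms by (simp add: unitariesD)
  finally show "norm (A * u) = norm A" .
qed

text \<open>Completeness has to be stated for a fixed block: matrices of growing size can form a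
  Cauchy sequence without a finitely supported limit. Inside one block, entrywise limits are limits
  in norm.\<close>

lemma complete_corner: "complete {A. corner k A}"
proof (rule completeI)
  fix X :: "nat \<Rightarrow> fmat" assume X: "\<forall>n. X n \<in> {A. corner k A}" and C: "Cauchy X"
  have cauchy: "Cauchy (\<lambda>n. entry (X n) i j)" for i j
    unfolding Cauchy_iff
  proof (intro allI impI)
    fix e :: real assume "e > 0"
    then obtain M where M: "\<forall>m\<ge>M. \<forall>n\<ge>M. norm (X m - X n) < e" using C unfolding Cauchy_iff by blast
    have "norm (entry (X m) i j - entry (X n) i j) \<le> norm (X m - X n)" for m n
      using norm_entry_le[of "X m - X n" i j] by simp
    then show "\<exists>M. \<forall>m\<ge>M. \<forall>n\<ge>M. norm (entry (X m) i j - entry (X n) i j) < e"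
      using M by (meson le_less_trans)
  qed
  define L where "L = (\<lambda>i j. lim (\<lambda>n. entry (X n) i j))"
  have lim: "(\<lambda>n. entry (X n) i j) \<longlonglongrightarrow> L i j" for i j
    unfolding L_def using cauchy convergent_LIMSEQ_iff Cauchy_convergent_iff by blast
  have L0: "\<not> (i < k \<and> j < k) \<Longrightarrow> L i j = 0" for i j
    unfolding L_def using X by (intro limI tendsto_eventually eventuallyI corner_zero) auto
  then have L: "entry (Mat L) = L" by (intro Mat_inverse) blast
  then have cL: "corner k (Mat L)" using L0 by (auto simp: corner_def)
  have "(\<lambda>n. norm (X n - Mat L)) \<longlonglongrightarrow> sqrt (\<Sum>i<k. \<Sum>j<k. (cmod (L i j - L i j))\<^sup>2)"
  proof -
    have "norm (X n - Mat L) = sqrt (\<Sum>i<k. \<Sum>j<k. (cmod (entry (X n) i j - L i j))\<^sup>2)" for n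
      using X cL by (subst norm_corner[of k]) (auto simp: L)
    then show ?thesis by (simp only:) (intro tendsto_intros lim)
  qed
  then have "(\<lambda>n. norm (X n - Mat L)) \<longlonglongrightarrow> 0" by simp
  then have "X \<longlonglongrightarrow> Mat L" by (metis Lim_null tendsto_norm_zero_iff)
  then show "\<exists>l\<in>{A. corner k A}. X \<longlonglongrightarrow> l" using cL by blast
qed

lemma closed_unitaries:
  assumes "\<And>n. X n \<in> unitaries k" "X \<longlonglongrightarrow> L" shows "L \<in> unitaries k"
proof -
  have "closed {A. corner k A}" by (rule complete_imp_closed[OF complete_corner])
  then have "corner k L" using assms unfolding closed_sequential_limits by (auto simp: unitaries_def)
  have 1: "(\<lambda>n. X n * adj (X n)) \<longlonglongrightarrow> L * adj L" "(\<lambda>n. adj (X n) * X n) \<longlonglongrightarrow> adj L * L"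
    by (intro tendsto_mult tendsto_adj assms)+
  have 2: "X n * adj (X n) = idm k" "adj (X n) * X n = idm k" for n
    using assms(1) by (auto simp: unitaries_def)
  have "L * adj L = idm k" "adj L * L = idm k"
    using LIMSEQ_unique[OF 1(1)] LIMSEQ_unique[OF 1(2)] unfolding 2 by (metis tendsto_const)+
  with \<open>corner k L\<close> show ?thesis by (simp add: unitaries_def)
qed

text \<open>The map sending \<open>y\<close> to \<open>x - x * y\<close> contracts by 1/2 on the
  complete block. Its fixed point is x (1 + x)^-1, written without a unit.\<close>

lemma quasi_inverse_right:
  assumes "corner k x" "norm x \<le> 1/2"
  shows "\<exists>y. corner k y \<and> y = x - x * y"
proof -
  have "\<exists>!y\<in>{A. corner k A}. x - x * y = y"
  proof (rule Banach_fix[OF complete_corner, where c = "1/2"])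
    show "{A. corner k A} \<noteq> {}" by (metis corner_simps(1) empty_iff mem_Collect_eq)
    fix y z assume "y \<in> {A. corner k A}" "z \<in> {A. corner k A}"
    have "dist (x - x * y) (x - x * z) = norm (x * (z - y))" by (simp add: dist_norm right_diff_distrib)
    also have "\<dots> \<le> norm x * norm (z - y)" by (rule norm_mult_ineq)
    also have "\<dots> \<le> (1/2) * norm (z - y)" using assms by (intro mult_right_mono) auto
    finally show "dist (x - x * y) (x - x * z) \<le> (1/2) * dist y z" by (simp add: dist_norm norm_minus_commute)
  qed (use assms in auto)
  then show ?thesis by (metis mem_Collect_eq)
qed

text \<open>The unitary is the Cayley transform \<open>(1 - x)(1 + x)\<^sup>-\<^sup>1 = 1 - 2 y\<close> with \<open>y = x (1 + x)\<^sup>-\<^sup>1\<close>.\<close>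

lemma cayley:
  assumes x: "corner k x" and skew: "adj x = - x" and n: "norm x \<le> 1/2"
  shows "\<exists>u\<in>unitaries k. norm (u - (idm k - 2 *\<^sub>R x)) \<le> 4 * (norm x)\<^sup>2"
proof -
  obtain y where y: "corner k y" "y = x - x * y" using quasi_inverse_right[OF x n] by blast
  have n': "norm (- x) \<le> 1/2" "corner k (- x)" using n x by auto
  \<comment> \<open>Since \<open>adj x = - x\<close>, the adjoint \<open>z\<close> of a right
    quasi-inverse of \<open>- x\<close> is a left quasi-inverse of \<open>x\<close>. Associativity
    forces \<open>z = y\<close>, so that \<open>y\<close> commutes with \<open>x\<close>.\<close>
  obtain z' where z': "corner k z'" "z' = - x - (- x) * z'" using quasi_inverse_right[OF n'(2) n'(1)] by blast
  define z where "z = adj z'"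
  have E: "adj (- x - (- x) * A) = x - adj A * x" for A by (simp add: skew)
  have z: "z = x - z * x" using arg_cong[OF z'(2), of adj] unfolding E z_def .
  have zx: "z * x = x - z" using z by (metis add_diff_cancel_left' diff_add_cancel)
  have yxy: "x * y = x - y" using y(2) by (metis add_diff_cancel_left' diff_add_cancel)
  have "z * (x * y) = z * x - z * y" unfolding yxy by (rule right_diff_distrib)
  moreover have "(z * x) * y = x * y - z * y" unfolding zx by (rule left_diff_distrib)
  ultimately have "z * x = x * y" by (simp add: mult.assoc)
  then have "x - z = x - y" unfolding zx yxy .
  then have "z = y" by simp
  then have yx: "y = x - y * x" using zx by (metis add_diff_cancel_left' diff_add_cancel)
  define w where "w = adj y"
  have "w = adj (x - x * y)" "w = adj (x - y * x)" unfolding w_def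
    by (rule arg_cong[OF y(2)], rule arg_cong[OF yx])
  then have w: "w = - x + w * x" "w = - x + x * w" 
    by (simp_all only: w_def adj_simps adj_mult skew mult_minus_left mult_minus_right diff_minus_eq_add)
  \<comment> \<open>Left multiplication by 1 + x is injective because
    \<open>norm x \<le> 1/2\<close>; the identities below are verified after multiplying by 1 +
    x.\<close>
  have zero: "q = 0" if "q + x * q = 0" for q
  proof -
    have "norm q = norm (x * q)" using that by (metis add_eq_0_iff norm_minus_cancel)
    also have "\<dots> \<le> (1/2) * norm q" using n norm_mult_ineq[of x q] by (meson mult_right_mono norm_ge_zero order_trans)
    finally show ?thesis by simp
  qed
  have xw: "x * w = w * x" using w by (metis add_left_cancel)
  have commyw: "y * w = w * y"
  proof -
    have "x * (y * w) = x * w - y * w" by (simp only: mult.assoc[symmetric] yxy left_diff_distrib)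
    then have 1: "y * w + x * (y * w) = x * w" by simp
    have "w * y + x * (w * y) = x * w"
    proof -
      have "x * (w * y) = w * x * y" by (simp only: mult.assoc[symmetric] xw)
      also have "\<dots> = w * (x - y)" by (simp only: mult.assoc yxy)
      finally show ?thesis by (simp add: right_diff_distrib xw)
    qed
    with 1 have "(y * w + x * (y * w)) - (w * y + x * (w * y)) = 0" by simp
    then have "(y * w - w * y) + x * (y * w - w * y) = 0" by (simp only: right_diff_distrib add_diff_add)
    then have "y * w - w * y = 0" by (rule zero)
    then show ?thesis by simp
  qed
  \<comment> \<open>The vanishing of \<open>q\<close> is the unitarity of u = 1 - 2 y: with
    \<open>w = adj y\<close>, the product of \<open>u\<close> and \<open>adj u\<close> is 1 - 2 y -
    2 w + 4 y w.\<close>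
  define q where "q = 2 *\<^sub>R (y * w) - y - w"
  have "y + x * y = x" by (simp add: yxy)
  moreover have "w - x * w = - x" using w(2) by (metis add_diff_cancel_right')
  moreover have "y * w + x * (y * w) = x * w"
    by (simp add: yxy left_diff_distrib flip: mult.assoc)
  moreover have "q + x * q = 2 *\<^sub>R (y * w + x * (y * w)) - (y + x * y) - (w + x * w)"
    by (simp add: q_def algebra_simps)
  moreover have "2 *\<^sub>R (x * w) - x - (w + x * w) = - (w - x * w) - x"
    by (simp add: scaleR_2)
  ultimately have "q + x * q = 0" by simp
  then have q: "2 *\<^sub>R (y * w) = y + w" using zero[of q] by (simp only: q_def) (simp add: algebra_simps)
  define u where "u = idm k - 2 *\<^sub>R y"
  have cw: "corner k w" using y by (simp add: w_def)
  have aju: "adj u = idm k - 2 *\<^sub>R w" by (simp add: u_def w_def)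
  have "u * adj u = idm k - 2 *\<^sub>R y - 2 *\<^sub>R w + 2 *\<^sub>R (2 *\<^sub>R (y * w))"
    unfolding aju using y cw by (simp add: u_def algebra_simps)
  then have 1: "u * adj u = idm k" unfolding q by (simp add: algebra_simps)
  have "adj u * u = idm k - 2 *\<^sub>R y - 2 *\<^sub>R w + 2 *\<^sub>R (2 *\<^sub>R (y * w))"
    unfolding aju using y cw by (simp add: u_def algebra_simps commyw)
  then have 2: "adj u * u = idm k" unfolding q by (simp add: algebra_simps)
  have u: "u \<in> unitaries k" using 1 2 y by (simp add: unitaries_def u_def)
  have "norm y \<le> norm x + norm (x * y)" using norm_triangle_ineq4[of x "x * y"] y(2) by simp
  also have "norm (x * y) \<le> (1/2) * norm y" using n norm_mult_ineq[of x y] by (meson mult_right_mono norm_ge_zero order_trans)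
  finally have ny: "norm y \<le> 2 * norm x" by simp
  have "u - (idm k - 2 *\<^sub>R x) = 2 *\<^sub>R (x - y)" by (simp add: u_def algebra_simps)
  also have "x - y = x * y" using \<open>y + x * y = x\<close> by (metis add_diff_cancel_left')
  finally have "norm (u - (idm k - 2 *\<^sub>R x)) = 2 * norm (x * y)" by simp
  also have "\<dots> \<le> 2 * (norm x * (2 * norm x))" using ny norm_mult_ineq[of x y]
    by (smt (verit, ccfv_SIG) mult_left_mono norm_ge_zero)
  finally show ?thesis using u by (intro bexI[of _ u]) (simp_all add: power2_eq_square)
qed

section \<open>Gram-Schmidt families and row-finite unitary representations\<close>

text \<open>The intended elements of \<open>W\<close> are bounded sequences of matrices. The form is
  degenerate and no quotient is taken; \<open>ip_null\<close> says that null vectors are invisible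
  to \<open>ip\<close>, so all later identities between vectors are tested against every
  \<open>z\<close> in \<open>W\<close>.\<close>

locale semi_inner =
  fixes W :: "'w::ab_group_add set" and sc :: "complex \<Rightarrow> 'w \<Rightarrow> 'w" and ip :: "'w \<Rightarrow> 'w \<Rightarrow> complex"
  assumes W_0 [simp]: "0 \<in> W"
    and W_add [simp]: "x \<in> W \<Longrightarrow> y \<in> W \<Longrightarrow> x + y \<in> W"
    and W_sc [simp]: "x \<in> W \<Longrightarrow> sc a x \<in> W"
    and ip_add: "x \<in> W \<Longrightarrow> y \<in> W \<Longrightarrow> z \<in> W \<Longrightarrow> ip (x + y) z = ip x z + ip y z"
    and ip_sc: "x \<in> W \<Longrightarrow> z \<in> W \<Longrightarrow> ip (sc a x) z = a * ip x z"
    and ip_cnj: "x \<in> W \<Longrightarrow> y \<in> W \<Longrightarrow> ip y x = cnj (ip x y)"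
    and ip_nonneg: "x \<in> W \<Longrightarrow> 0 \<le> Re (ip x x)"
    and ip_null: "x \<in> W \<Longrightarrow> z \<in> W \<Longrightarrow> ip x x = 0 \<Longrightarrow> ip x z = 0"
begin

lemma ip_0 [simp]: "z \<in> W \<Longrightarrow> ip 0 z = 0"
  using ip_add[of 0 0 z] by simp

lemma W_sum [simp]: "(\<And>i. i \<in> J \<Longrightarrow> f i \<in> W) \<Longrightarrow> sum f J \<in> W"
  by (induction J rule: infinite_finite_induct) auto

lemma ip_sum: "(\<And>i. i \<in> J \<Longrightarrow> f i \<in> W) \<Longrightarrow> z \<in> W \<Longrightarrow> ip (sum f J) z = (\<Sum>i\<in>J. ip (f i) z)"
  by (induction J rule: infinite_finite_induct) (auto simp: ip_add)

lemma ip_real: "x \<in> W \<Longrightarrow> ip x x = of_real (Re (ip x x))"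
  by (metis Reals_cnj_iff ip_cnj of_real_Re)

end

locale semi_inner_seq = semi_inner +
  fixes w :: "nat \<Rightarrow> 'a::ab_group_add"
  assumes w_W [simp]: "w n \<in> W"
begin

text \<open>A null residue is scaled by 1 / 0 = 0, so \<open>gs n\<close> is then a null vector and
  the numbering need not skip any index. The set \<open>I\<close> below collects the indices of the
  unit vectors.\<close>

function gs :: "nat \<Rightarrow> 'a" where
  "gs n = (let r = w n + (\<Sum>i\<in>{..<n}. sc (- ip (w n) (gs i)) (gs i))
           in sc (of_real (1 / sqrt (Re (ip r r)))) r)"
  by auto
termination by lexicographic_order

declare gs.simps [simp del]

definition res :: "nat \<Rightarrow> 'a" where
  "res n = w n + (\<Sum>i<n. sc (- ip (w n) (gs i)) (gs i))"

lemma gs_res: "gs n = sc (of_real (1 / sqrt (Re (ip (res n) (res n))))) (res n)"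
  by (subst gs.simps) (simp add: Let_def res_def)

lemma gs_W [simp]: "gs n \<in> W"
proof (induction n rule: less_induct)
  case (less n)
  then have "res n \<in> W" unfolding res_def by (intro W_add W_sum W_sc) auto
  then show ?case by (simp add: gs_res)
qed

lemma res_W [simp]: "res n \<in> W"
  by (simp add: res_def)

definition I :: "nat set" where "I = {i. ip (gs i) (gs i) \<noteq> 0}"

lemma ip_gs_self: "ip (gs n) (gs n) = (if n \<in> I then 1 else 0)"
proof (cases "n \<in> I")
  case True
  define c where "c = Re (ip (res n) (res n))"
  have c: "ip (res n) (res n) = of_real c" "0 \<le> c" using ip_real ip_nonneg by (auto simp: c_def)
  have e: "gs n = sc (of_real (1 / sqrt c)) (res n)" by (simp add: gs_res c_def)
  have "ip (gs n) (gs n) = of_real (1 / sqrt c) * cnj (of_real (1 / sqrt c) * ip (res n) (res n))"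
    unfolding e by (simp add: ip_sc ip_cnj[of "sc _ _" "res n"])
  also have "\<dots> = of_real ((1 / sqrt c) * (1 / sqrt c) * c)"
    unfolding c by (simp only: complex_cnj_mult complex_cnj_complex_of_real of_real_mult mult.assoc)
  also have "(1 / sqrt c) * (1 / sqrt c) * c = (if c = 0 then 0 else 1)" using c(2) by auto
  finally show ?thesis using True by (auto simp: I_def split: if_splits)
qed (simp add: I_def)

lemma ip_gs_notin: "n \<notin> I \<Longrightarrow> z \<in> W \<Longrightarrow> ip (gs n) z = 0" "n \<notin> I \<Longrightarrow> z \<in> W \<Longrightarrow> ip z (gs n) = 0"
  using ip_gs_self[of n] ip_null[of "gs n" z] ip_cnj[of "gs n" z] by auto

lemma gs_orth_less: "i < n \<Longrightarrow> ip (gs n) (gs i) = 0"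
proof (induction n arbitrary: i rule: less_induct)
  case (less n)
  have *: "ip (gs j) (gs i) = (if j = i \<and> i \<in> I then 1 else 0)" if "j < n" for j
  proof (cases j i rule: linorder_cases)
    case less
    then have "ip (gs i) (gs j) = 0" using less.IH[OF \<open>i < n\<close>] by blast
    then show ?thesis using less ip_cnj[of "gs i" "gs j"] by simp
  next
    case greater
    then show ?thesis using less.IH[OF that] by auto
  qed (simp add: ip_gs_self)
  have "ip (res n) (gs i) = ip (w n) (gs i) - (\<Sum>j<n. ip (w n) (gs j) * ip (gs j) (gs i))"
    by (simp add: res_def ip_add ip_sum ip_sc sum_negf)
  also have "(\<Sum>j<n. ip (w n) (gs j) * ip (gs j) (gs i)) =
      (\<Sum>j<n. if j = i then (if i \<in> I then ip (w n) (gs i) else 0) else 0)"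
    by (intro sum.cong HOL.refl) (auto simp: *)
  also have "\<dots> = ip (w n) (gs i)" using less.prems by (simp add: ip_gs_notin)
  finally show ?case by (simp add: gs_res ip_sc)
qed

lemma gs_orth: "ip (gs i) (gs j) = (if i = j \<and> i \<in> I then 1 else 0)"
  by (cases i j rule: linorder_cases) (simp_all add: gs_orth_less ip_gs_self ip_cnj[of "gs j" "gs i"])

text \<open>Parseval in weak form: modulo null vectors, \<open>x\<close> is a combination of the
  \<open>gs i\<close> with \<open>i < N\<close>. Asking for every \<open>M \<ge> N\<close> lets
  expansions of different lengths be merged.\<close>

definition expands :: "'a \<Rightarrow> nat \<Rightarrow> bool" where
  "expands x N \<longleftrightarrow> x \<in> W \<and> (\<forall>M\<ge>N. \<forall>z\<in>W. ip x z = (\<Sum>i<M. ip x (gs i) * ip (gs i) z))"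

lemma expandsD: "expands x N \<Longrightarrow> N \<le> M \<Longrightarrow> z \<in> W \<Longrightarrow> ip x z = (\<Sum>i<M. ip x (gs i) * ip (gs i) z)"
  "expands x N \<Longrightarrow> x \<in> W"
  unfolding expands_def by blast+

lemma expands_zero:
  assumes "expands x N" "N \<le> j" shows "ip x (gs j) = 0"
proof -
  have "ip x (gs j) = (\<Sum>i<N. ip x (gs i) * ip (gs i) (gs j))" by (rule expandsD(1)[OF assms(1)]) auto
  then show ?thesis using assms(2) by (simp add: gs_orth)
qed

lemma expands_mono: "expands x N \<Longrightarrow> N \<le> M \<Longrightarrow> expands x M"
  unfolding expands_def by (meson order_trans)

lemma ip_gs_dot: "x \<in> W \<Longrightarrow> ip (gs i) x = cnj (ip x (gs i))"
  by (rule ip_cnj) auto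

lemma expands_norm:
  assumes "expands x N" shows "Re (ip x x) = (\<Sum>i<N. (cmod (ip x (gs i)))\<^sup>2)"
proof -
  have "x \<in> W" using assms by (rule expandsD(2))
  then have "ip x x = (\<Sum>i<N. ip x (gs i) * ip (gs i) x)" by (intro expandsD(1)[OF assms]) auto
  also have "\<dots> = (\<Sum>i<N. ip x (gs i) * cnj (ip x (gs i)))" using \<open>x \<in> W\<close> by (simp add: ip_gs_dot)
  also have "\<dots> = of_real (\<Sum>i<N. (cmod (ip x (gs i)))\<^sup>2)"
    by (simp only: complex_norm_square of_real_sum)
  finally show ?thesis by (simp only: Re_complex_of_real)
qed

text \<open>\<open>w n\<close> is its residue plus components along the earlier \<open>gs i\<close>,
  and the residue is either null or a multiple of \<open>gs n\<close>; hence the length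
  \<open>Suc n\<close>.\<close>

lemma expands_w: "expands (w n) (Suc n)"
proof -
  have 1: "ip (w n) z = ip (res n) z + (\<Sum>j<n. ip (w n) (gs j) * ip (gs j) z)" if "z \<in> W" for z
    using that by (simp add: res_def ip_add ip_sum ip_sc sum_negf)
  define c where "c = Re (ip (res n) (res n))"
  have c: "ip (res n) (res n) = of_real c" "0 \<le> c" using ip_real ip_nonneg by (auto simp: c_def)
  have e: "gs n = sc (of_real (1 / sqrt c)) (res n)" by (simp add: gs_res c_def)
  have rn: "ip (res n) z = ip (res n) (gs n) * ip (gs n) z" if z: "z \<in> W" for z
  proof (cases "c = 0")
    case True
    then show ?thesis using c ip_null[of "res n"] z by simp
  next
    case False
    have "ip (res n) (gs n) = of_real (1 / sqrt c) * of_real c"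
      by (subst ip_cnj[of "gs n" "res n"]) (auto simp: e ip_sc c)
    moreover have "ip (gs n) z = of_real (1 / sqrt c) * ip (res n) z" using z by (simp add: e ip_sc)
    moreover have "of_real (1 / sqrt c) * of_real c * of_real (1 / sqrt c) = (1::complex)"
      unfolding of_real_mult[symmetric] using False c(2) by simp
    ultimately show ?thesis by (metis mult.assoc mult_1)
  qed
  have "ip (w n) (gs n) = ip (res n) (gs n)" using 1[of "gs n"] by (simp add: gs_orth)
  then have 2: "ip (w n) z = (\<Sum>j<Suc n. ip (w n) (gs j) * ip (gs j) z)" if "z \<in> W" for z
    using 1[OF that] rn[OF that] by simp
  have 3: "ip (w n) (gs j) = 0" if "j \<ge> Suc n" for j
    using 2[of "gs j"] that by (simp add: gs_orth)
  have 4: "(\<Sum>j<Suc n. ip (w n) (gs j) * ip (gs j) z) = (\<Sum>j<M. ip (w n) (gs j) * ip (gs j) z)"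
    if "M \<ge> Suc n" for z M
    by (rule sum.mono_neutral_left) (use that 3 in auto)
  show ?thesis unfolding expands_def
    by (intro conjI allI impI ballI w_W) (rule HOL.trans[OF 2 4])
qed

lemma expands_gs: "expands (gs n) (Suc n)"
  unfolding expands_def
proof (intro conjI allI impI ballI)
  fix M z assume M: "Suc n \<le> M" "z \<in> W"
  have "(\<Sum>i<M. ip (gs n) (gs i) * ip (gs i) z) = (\<Sum>i<M. if i = n then ip (gs n) z else 0)"
    by (intro sum.cong HOL.refl) (use M in \<open>auto simp: gs_orth ip_gs_notin\<close>)
  then show "ip (gs n) z = (\<Sum>i<M. ip (gs n) (gs i) * ip (gs i) z)" using M by simp
qed simp

lemma expandsI:
  "x \<in> W \<Longrightarrow> (\<And>M z. N \<le> M \<Longrightarrow> z \<in> W \<Longrightarrow> ip x z = (\<Sum>i<M. ip x (gs i) * ip (gs i) z)) \<Longrightarrow> expands x N"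
  unfolding expands_def by blast

lemma expands_add:
  assumes x: "expands x N" and y: "expands y N" shows "expands (x + y) N"
proof -
  have W: "x \<in> W" "y \<in> W" using x y expandsD(2) by auto
  show ?thesis
  proof (rule expandsI)
    fix M z assume z: "N \<le> M" "z \<in> W"
    have "ip (x + y) z = ip x z + ip y z" using W z by (simp add: ip_add)
    also have "\<dots> = (\<Sum>i<M. ip x (gs i) * ip (gs i) z) + (\<Sum>i<M. ip y (gs i) * ip (gs i) z)"
      by (rule arg_cong2[OF expandsD(1)[OF x z] expandsD(1)[OF y z]])
    also have "\<dots> = (\<Sum>i<M. ip (x + y) (gs i) * ip (gs i) z)"
      using W by (simp add: ip_add distrib_right sum.distrib)
    finally show "ip (x + y) z = (\<Sum>i<M. ip (x + y) (gs i) * ip (gs i) z)" .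
  qed (use W in simp)
qed

lemma expands_sc:
  assumes x: "expands x N" shows "expands (sc a x) N"
proof -
  have W: "x \<in> W" using x expandsD(2) by auto
  show ?thesis
  proof (rule expandsI)
    fix M z assume z: "N \<le> M" "z \<in> W"
    have "ip (sc a x) z = a * ip x z" using W z by (simp add: ip_sc)
    also have "\<dots> = a * (\<Sum>i<M. ip x (gs i) * ip (gs i) z)"
      by (rule arg_cong[OF expandsD(1)[OF x z]])
    also have "\<dots> = (\<Sum>i<M. ip (sc a x) (gs i) * ip (gs i) z)"
      using W by (simp add: ip_sc sum_distrib_left mult.assoc)
    finally show "ip (sc a x) z = (\<Sum>i<M. ip (sc a x) (gs i) * ip (gs i) z)" .
  qed (use W in simp)
qed

text \<open>Needed because the group acts linearly and multiplicatively only modulo null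
  vectors.\<close>

lemma expands_cong:
  assumes x: "expands x N" and y: "y \<in> W" and eq: "\<And>z. z \<in> W \<Longrightarrow> ip y z = ip x z"
  shows "expands y N"
proof (rule expandsI[OF y])
  fix M z assume z: "N \<le> M" "z \<in> W"
  have "ip y z = ip x z" by (rule eq[OF z(2)])
  also have "\<dots> = (\<Sum>i<M. ip x (gs i) * ip (gs i) z)" by (rule expandsD(1)[OF x z])
  also have "\<dots> = (\<Sum>i<M. ip y (gs i) * ip (gs i) z)" by (simp add: eq)
  finally show "ip y z = (\<Sum>i<M. ip y (gs i) * ip (gs i) z)" .
qed

text \<open>Positivity of \<open>ip\<close> at \<open>x + p\<close>, where \<open>p\<close> is minus
  the projection of \<open>x\<close> to the first \<open>M\<close> vectors.\<close>

lemma bessel: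
  assumes "x \<in> W" shows "(\<Sum>i<M. (cmod (ip x (gs i)))\<^sup>2) \<le> Re (ip x x)"
proof -
  define p where "p = (\<Sum>i<M. sc (- ip x (gs i)) (gs i))"
  have p: "p \<in> W" using assms by (auto simp: p_def)
  have px: "ip p z = - (\<Sum>i<M. ip x (gs i) * ip (gs i) z)" if "z \<in> W" for z
    using that by (simp add: p_def ip_sum ip_sc sum_negf)
  define s where "s = (\<Sum>i<M. (cmod (ip x (gs i)))\<^sup>2)"
  have s: "(\<Sum>i<M. ip x (gs i) * ip (gs i) x) = of_real s"
    using assms by (simp only: s_def ip_gs_dot of_real_sum complex_norm_square)
  have pgs: "ip p (gs j) = - ip x (gs j)" if "j < M" for j
  proof -
    have "(\<Sum>i<M. ip x (gs i) * ip (gs i) (gs j)) = (\<Sum>i<M. if i = j then ip x (gs j) else 0)"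
      by (intro sum.cong HOL.refl) (use assms in \<open>auto simp: gs_orth ip_gs_notin\<close>)
    then show ?thesis using px[of "gs j"] that by simp
  qed
  have "ip p p = - (\<Sum>i<M. ip x (gs i) * cnj (ip p (gs i)))"
    using px[OF p] p by (simp add: ip_gs_dot)
  also have "\<dots> = (\<Sum>i<M. ip x (gs i) * ip (gs i) x)"
    using assms by (simp add: pgs ip_gs_dot sum_negf)
  finally have pp: "ip p p = of_real s" using s by simp
  have xp: "ip x p = - of_real s" using ip_cnj[OF p assms] px[OF assms] s by simp
  have a1: "ip (x + p) (x + p) = ip x (x + p) + ip p (x + p)" using assms p by (simp add: ip_add)
  have a2: "ip y (x + p) = ip y x + ip y p" if "y \<in> W" for y
    using ip_cnj[of "x + p" y] ip_cnj[of x y] ip_cnj[of p y] assms p that by (simp add: ip_add)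
  have "ip (x + p) (x + p) = ip x x - of_real s"
    using px[OF assms] s by (simp add: a1 a2 assms p pp xp)
  then show ?thesis using ip_nonneg[of "x + p"] assms p by (simp add: s_def[symmetric])
qed

text \<open>The algebraic span, without closure: each element has a finite expansion, which is what
  makes the matrices of the action finite in rows and columns.\<close>

inductive_set lspan :: "'a set" where
  w: "w n \<in> lspan"
| zero: "0 \<in> lspan"
| add: "x \<in> lspan \<Longrightarrow> y \<in> lspan \<Longrightarrow> x + y \<in> lspan"
| sc: "x \<in> lspan \<Longrightarrow> sc a x \<in> lspan"

lemma lspan_W: "x \<in> lspan \<Longrightarrow> x \<in> W"
  by (induction rule: lspan.induct) auto

lemma lspan_sum: "(\<And>i. i \<in> J \<Longrightarrow> f i \<in> lspan) \<Longrightarrow> sum f J \<in> lspan"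
  by (induction J rule: infinite_finite_induct) (auto intro: lspan.intros)

lemma gs_lspan: "gs n \<in> lspan"
proof (induction n rule: less_induct)
  case (less n)
  then have "res n \<in> lspan" unfolding res_def by (auto intro!: lspan.add lspan.sc lspan.w lspan_sum)
  then show ?case by (subst gs_res) (rule lspan.sc)
qed

lemma lspan_expands: "x \<in> lspan \<Longrightarrow> \<exists>N. expands x N"
proof (induction rule: lspan.induct)
  case (add x y)
  then obtain M N where "expands x M" "expands y N" by auto
  then have "expands (x + y) (max M N)" by (intro expands_add) (auto elim: expands_mono)
  then show ?case ..
next
  case zero
  have "expands 0 0" by (simp add: expands_def)
  then show ?case ..
qed (auto intro: expands_w expands_sc)

end

section \<open>Square-summable families and polarization\<close>

lemma ell2_bdd:
  fixes x :: "nat \<Rightarrow> complex"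
  assumes "\<And>i. i \<notin> I \<Longrightarrow> x i = 0" "\<And>M. (\<Sum>i<M. (cmod (x i))\<^sup>2) \<le> B"
  shows "x \<in> ell2 I" "(\<Sum>\<^sub>\<infinity>i\<in>I. (cmod (x i))\<^sup>2) \<le> B"
proof -
  have *: "(\<Sum>i\<in>F. (cmod (x i))\<^sup>2) \<le> B" if "finite F" for F
  proof -
    obtain M where "F \<subseteq> {..<M}" using \<open>finite F\<close> by (meson finite_nat_bounded)
    then have "(\<Sum>i\<in>F. (cmod (x i))\<^sup>2) \<le> (\<Sum>i<M. (cmod (x i))\<^sup>2)" by (intro sum_mono2) auto
    then show ?thesis using assms(2) order_trans by blast
  qed
  then have "(\<lambda>i. (cmod (x i))\<^sup>2) summable_on I"
    by (intro nonneg_bdd_above_summable_on bdd_aboveI[of _ B]) auto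
  then show "x \<in> ell2 I" "(\<Sum>\<^sub>\<infinity>i\<in>I. (cmod (x i))\<^sup>2) \<le> B"
    using assms(1) * by (auto simp: ell2_def intro!: infsum_le_finite_sums)
qed

lemma ell2_sum_le:
  fixes x :: "nat \<Rightarrow> complex"
  assumes "x \<in> ell2 I"
  shows "(\<Sum>i<M. (cmod (x i))\<^sup>2) \<le> (\<Sum>\<^sub>\<infinity>i\<in>I. (cmod (x i))\<^sup>2)"
proof -
  have "(\<Sum>i<M. (cmod (x i))\<^sup>2) = (\<Sum>i\<in>{..<M} \<inter> I. (cmod (x i))\<^sup>2)"
    using assms by (intro sum.mono_neutral_right) (auto simp: ell2_def)
  also have "\<dots> \<le> (\<Sum>\<^sub>\<infinity>i\<in>I. (cmod (x i))\<^sup>2)"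
    using assms by (intro finite_sum_le_infsum) (auto simp: ell2_def)
  finally show ?thesis .
qed

lemma ell2_tail:
  fixes x :: "nat \<Rightarrow> complex"
  assumes "x \<in> ell2 I" "\<delta> > 0"
  shows "\<exists>N. \<forall>M. (\<Sum>i<M. (cmod (if i < N then 0 else x i))\<^sup>2) \<le> \<delta>"
proof -
  have "summable (\<lambda>i. (cmod (x i))\<^sup>2)"
    using ell2_sum_le[OF assms(1)] by (intro summableI_nonneg_bounded) auto
  then obtain N where N: "\<And>m n. m \<ge> N \<Longrightarrow> norm (sum (\<lambda>i. (cmod (x i))\<^sup>2) {m..<n}) < \<delta>"
    using assms(2) unfolding summable_Cauchy by blast
  have "(\<Sum>i<M. (cmod (if i < N then 0 else x i))\<^sup>2) \<le> \<delta>" for M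
  proof -
    have "(\<Sum>i<M. (cmod (if i < N then 0 else x i))\<^sup>2) = (\<Sum>i\<in>{N..<M}. (cmod (x i))\<^sup>2)"
      by (rule sum.mono_neutral_cong_right) auto
    then show ?thesis using N[of N M] by simp
  qed
  then show ?thesis by blast
qed

lemma ell2_lincomb:
  assumes "x \<in> ell2 I" "y \<in> ell2 I" shows "(\<lambda>i. a * x i + b * y i) \<in> ell2 I"
proof -
  have "(cmod (a * x i + b * y i))\<^sup>2 \<le> 2 * (cmod a)\<^sup>2 * (cmod (x i))\<^sup>2 + 2 * (cmod b)\<^sup>2 * (cmod (y i))\<^sup>2" for i
  proof -
    have "(cmod (a * x i + b * y i))\<^sup>2 \<le> (cmod (a * x i) + cmod (b * y i))\<^sup>2"
      by (intro power_mono norm_triangle_ineq) auto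
    also have "\<dots> \<le> 2 * (cmod (a * x i))\<^sup>2 + 2 * (cmod (b * y i))\<^sup>2"
      using sum_squares_bound[of "cmod (a * x i)" "cmod (b * y i)"] by (simp add: power2_sum)
    finally show ?thesis by (simp add: norm_mult power_mult_distrib)
  qed
  moreover have *: "(\<lambda>i. 2 * (cmod a)\<^sup>2 * (cmod (x i))\<^sup>2 + 2 * (cmod b)\<^sup>2 * (cmod (y i))\<^sup>2) summable_on I"
    using assms by (intro summable_on_add summable_on_cmult_right) (auto simp: ell2_def)
  ultimately have "(\<lambda>i. (cmod (a * x i + b * y i))\<^sup>2) summable_on I"
    by (intro summable_on_comparison_test[OF *]) auto
  then show ?thesis using assms by (auto simp: ell2_def)
qed

lemma polarization: "4 * (a * cnj b) = of_real ((cmod (a + b))\<^sup>2) - of_real ((cmod (a - b))\<^sup>2)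
    + \<i> * of_real ((cmod (a + \<i> * b))\<^sup>2) - \<i> * of_real ((cmod (a - \<i> * b))\<^sup>2)"
  by (simp add: complex_eq_iff cmod_power2) (simp add: power2_eq_square algebra_simps)

text \<open>Reduces preservation of \<open>ell2_inner\<close> to preservation of norms. The
  combinations are written with explicit coefficients \<open>1\<close> and \<open>b\<close> so that
  they are instances of \<open>ell2_lincomb\<close> and later of \<open>T_lincomb\<close>.\<close>

lemma ell2_polarization:
  assumes x: "x \<in> ell2 I" and y: "y \<in> ell2 I"
  defines "N \<equiv> \<lambda>x. of_real (\<Sum>\<^sub>\<infinity>i\<in>I. (cmod (x i))\<^sup>2) :: complex"
  shows "4 * ell2_inner I x y = N (\<lambda>i. 1 * x i + 1 * y i) - N (\<lambda>i. 1 * x i + (-1) * y i)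
    + \<i> * N (\<lambda>i. 1 * x i + \<i> * y i) - \<i> * N (\<lambda>i. 1 * x i + (-\<i>) * y i)"
proof -
  have h: "((\<lambda>i. of_real ((cmod (1 * x i + b * y i))\<^sup>2)) has_sum N (\<lambda>i. 1 * x i + b * y i)) I" for b
    unfolding N_def using ell2_lincomb[OF x y, of 1 b] 
    by (intro has_sum_of_real has_sum_infsum) (simp add: ell2_def)
  have hh: "((\<lambda>i. of_real ((cmod (1 * x i + 1 * y i))\<^sup>2) + (-1) * of_real ((cmod (1 * x i + (-1) * y i))\<^sup>2)
      + \<i> * of_real ((cmod (1 * x i + \<i> * y i))\<^sup>2) + (-\<i>) * of_real ((cmod (1 * x i + (-\<i>) * y i))\<^sup>2))
    has_sum (N (\<lambda>i. 1 * x i + 1 * y i) + (-1) * N (\<lambda>i. 1 * x i + (-1) * y i)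
      + \<i> * N (\<lambda>i. 1 * x i + \<i> * y i) + (-\<i>) * N (\<lambda>i. 1 * x i + (-\<i>) * y i))) I"
    by (intro has_sum_add has_sum_cmult_right h)
  have "((\<lambda>i. 4 * (x i * cnj (y i))) has_sum (N (\<lambda>i. 1 * x i + 1 * y i) + (-1) * N (\<lambda>i. 1 * x i + (-1) * y i)
      + \<i> * N (\<lambda>i. 1 * x i + \<i> * y i) + (-\<i>) * N (\<lambda>i. 1 * x i + (-\<i>) * y i))) I"
    by (rule has_sum_cong[THEN iffD1, OF _ hh]) (subst polarization, simp)
  from infsumI[OF this] show ?thesis by (simp add: ell2_inner_def infsum_cmult_right')
qed

text \<open>The laws of an action are required only modulo null vectors, and linearity of
  \<open>act g\<close> is not among them: it comes out of \<open>ip_act_adjoint\<close>, again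
  modulo null vectors. \<open>act_w\<close> makes the sequence \<open>w\<close>, and hence its span,
  invariant up to null vectors.\<close>

locale semi_inner_rep = semi_inner_seq W sc ip w + group G
  for W :: "'w::ab_group_add set" and sc ip w and G :: "('g, 'b) monoid_scheme" (structure) +
  fixes act :: "'g \<Rightarrow> 'w \<Rightarrow> 'w"
  assumes act_W [simp]: "g \<in> carrier G \<Longrightarrow> x \<in> W \<Longrightarrow> act g x \<in> W"
    and ip_act: "g \<in> carrier G \<Longrightarrow> x \<in> W \<Longrightarrow> y \<in> W \<Longrightarrow> ip (act g x) (act g y) = ip x y"
    and ip_act_mult: "g \<in> carrier G \<Longrightarrow> h \<in> carrier G \<Longrightarrow> x \<in> W \<Longrightarrow> z \<in> W \<Longrightarrow>
      ip (act (g \<otimes> h) x) z = ip (act g (act h x)) z"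
    and ip_act_one: "x \<in> W \<Longrightarrow> z \<in> W \<Longrightarrow> ip (act \<one> x) z = ip x z"
    and act_w: "g \<in> carrier G \<Longrightarrow> \<exists>m. \<forall>z\<in>W. ip (act g (w n)) z = ip (w m) z"
begin

text \<open>An isometric action has \<open>act (inv g)\<close> as adjoint of \<open>act g\<close>:
  insert \<open>act \<one> z\<close> for \<open>z\<close> and split the identity as g times its
  inverse. The left argument is thereby freed from \<open>act\<close>, which yields
  linearity.\<close>

lemma ip_act_adjoint:
  assumes g: "g \<in> carrier G" and W: "x \<in> W" "z \<in> W"
  shows "ip (act g x) z = ip x (act (inv g) z)"
proof -
  have "ip (act g x) z = cnj (ip z (act g x))" by (rule ip_cnj) (use W g in auto)
  also have "ip z (act g x) = ip (act \<one> z) (act g x)" by (rule ip_act_one[symmetric]) (use W g in auto)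
  also have "act \<one> z = act (g \<otimes> inv g) z" using g by simp
  also have "ip (act (g \<otimes> inv g) z) (act g x) = ip (act g (act (inv g) z)) (act g x)"
    by (rule ip_act_mult) (use W g in auto)
  also have "\<dots> = ip (act (inv g) z) x" by (rule ip_act) (use W g in auto)
  also have "cnj \<dots> = ip x (act (inv g) z)" by (rule ip_cnj[symmetric]) (use W g in auto)
  finally show ?thesis .
qed

lemma act_expands: "x \<in> lspan \<Longrightarrow> g \<in> carrier G \<Longrightarrow> \<exists>N. expands (act g x) N"
proof (induction rule: lspan.induct)
  case (w n)
  obtain m where m: "\<forall>z\<in>W. ip (act g (w n)) z = ip (w m) z" using act_w[OF w] by blast
  then have "expands (act g (w n)) (Suc m)" using w by (intro expands_cong[OF expands_w]) auto
  then show ?case ..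
next
  case zero
  have "ip (act g 0) z = 0" if "z \<in> W" for z using that zero by (simp add: ip_act_adjoint)
  then have "expands (act g 0) 0" using zero by (auto simp: expands_def)
  then show ?case ..
next
  case (add x y)
  then obtain M N where "expands (act g x) M" "expands (act g y) N" by auto
  then have "expands (act g x + act g y) (max M N)" by (intro expands_add) (auto elim: expands_mono)
  then have "expands (act g (x + y)) (max M N)"
    using add lspan_W by (elim expands_cong) (auto simp: ip_act_adjoint ip_add)
  then show ?case ..
next
  case (sc x a)
  then obtain M where "expands (act g x) M" by auto
  then have "expands (sc a (act g x)) M" by (rule expands_sc)
  then have "expands (act g (sc a x)) M"
    using sc lspan_W by (elim expands_cong) (auto simp: ip_act_adjoint ip_sc)
  then show ?case ..
qed

definition u :: "'g \<Rightarrow> nat \<Rightarrow> nat \<Rightarrow> complex" where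
  "u g j i = ip (act g (gs i)) (gs j)"

lemma u_column: "g \<in> carrier G \<Longrightarrow> \<exists>N. \<forall>j\<ge>N. u g j i = 0"
  using act_expands[OF gs_lspan, of g i] expands_zero[of "act g (gs i)"] unfolding u_def by metis

lemma u_inv: "g \<in> carrier G \<Longrightarrow> u (inv g) i j = cnj (u g j i)"
  unfolding u_def by (subst ip_cnj[of "gs i"]) (simp_all add: ip_act_adjoint[of g])

text \<open>Row \<open>j\<close> of \<open>g\<close> is the conjugate of column \<open>j\<close> of
  \<open>inv g\<close>, and columns are finite because \<open>act\<close> sends span elements to
  vectors with finite expansions.\<close>

lemma u_row: "g \<in> carrier G \<Longrightarrow> \<exists>N. \<forall>i\<ge>N. u g j i = 0"
  using u_column[of "inv g" j] by (simp add: u_inv)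

definition B :: "'g \<Rightarrow> nat \<Rightarrow> nat" where "B g j = (SOME N. \<forall>i\<ge>N. u g j i = 0)"

lemma B: "g \<in> carrier G \<Longrightarrow> B g j \<le> i \<Longrightarrow> u g j i = 0"
  using someI_ex[OF u_row[of g j]] unfolding B_def by blast

text \<open>Finite rows make this a finite sum for every function \<open>x\<close>, so that
  \<open>T\<close> is linear and multiplicative by pure algebra; convergence enters only when norms
  are compared.\<close>

definition T :: "'g \<Rightarrow> (nat \<Rightarrow> complex) \<Rightarrow> nat \<Rightarrow> complex" where
  "T g x j = (\<Sum>i<B g j. u g j i * x i)"

lemma T_eq: "g \<in> carrier G \<Longrightarrow> B g j \<le> M \<Longrightarrow> T g x j = (\<Sum>i<M. u g j i * x i)"
  unfolding T_def by (rule sum.mono_neutral_left) (auto simp: B)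

lemma ex_bound: "\<exists>M. \<forall>j<n. f j \<le> M" for f :: "nat \<Rightarrow> nat"
  by (rule exI[of _ "Max (f ` {..<n})"]) simp

lemma ip_act_gs: "g \<in> carrier G \<Longrightarrow> ip (gs l) (act (inv g) (gs j)) = u g j l"
  by (simp add: u_def ip_act_adjoint)

lemma u_mult:
  assumes "g \<in> carrier G" "h \<in> carrier G"
  shows "u (g \<otimes> h) j i = (\<Sum>l<B g j. u g j l * u h l i)"
proof -
  obtain N where N: "expands (act h (gs i)) N" using act_expands[OF gs_lspan assms(2)] by blast
  define M where "M = max N (B g j)"
  have "u (g \<otimes> h) j i = ip (act g (act h (gs i))) (gs j)" using assms by (simp add: u_def ip_act_mult)
  also have "\<dots> = ip (act h (gs i)) (act (inv g) (gs j))" using assms by (intro ip_act_adjoint) auto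
  also have "\<dots> = (\<Sum>l<M. ip (act h (gs i)) (gs l) * ip (gs l) (act (inv g) (gs j)))"
    using assms by (intro expandsD(1)[OF N]) (auto simp: M_def)
  also have "\<dots> = (\<Sum>l<M. u g j l * u h l i)" using assms by (simp add: ip_act_gs u_def[of h] mult.commute)
  also have "\<dots> = (\<Sum>l<B g j. u g j l * u h l i)"
    by (rule sum.mono_neutral_right) (use assms B in \<open>auto simp: M_def\<close>)
  finally show ?thesis .
qed

lemma T_mult:
  assumes "g \<in> carrier G" "h \<in> carrier G" shows "T (g \<otimes> h) x = T g (T h x)"
proof
  fix j
  obtain M0 where M0: "\<forall>l<B g j. B h l \<le> M0" using ex_bound by blast
  \<comment> \<open>A common bound for all rows of \<open>h\<close> that occur and for row
    \<open>j\<close> of the product, so that the double sum runs over a rectangle and can be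
    exchanged.\<close>
  define M where "M = max M0 (B (g \<otimes> h) j)"
  have "T (g \<otimes> h) x j = (\<Sum>i<M. (\<Sum>l<B g j. u g j l * u h l i) * x i)"
    using assms by (subst T_eq[of _ _ M]) (auto simp: M_def u_mult)
  also have "\<dots> = (\<Sum>i<M. \<Sum>l<B g j. u g j l * (u h l i * x i))"
    by (simp add: sum_distrib_right mult.assoc)
  also have "\<dots> = (\<Sum>l<B g j. u g j l * (\<Sum>i<M. u h l i * x i))"
    by (subst sum.swap) (simp add: sum_distrib_left)
  also have "\<dots> = (\<Sum>l<B g j. u g j l * T h x l)"
  proof (intro sum.cong HOL.refl)
    fix l assume "l \<in> {..<B g j}"
    then have "B h l \<le> M" using M0 by (auto simp: M_def le_max_iff_disj)
    then show "u g j l * (\<Sum>i<M. u h l i * x i) = u g j l * T h x l" using assms(2) by (simp add: T_eq)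
  qed
  finally show "T (g \<otimes> h) x j = T g (T h x) j" by (simp add: T_def[of g])
qed

text \<open>The matrix of the identity is the projection to the coordinates in \<open>I\<close>,
  since \<open>gs i\<close> is null for the other indices.\<close>

lemma T_one:
  assumes "\<And>i. i \<notin> I \<Longrightarrow> x i = 0" shows "T \<one> x = x"
proof
  fix j
  have u: "u \<one> j i = (if i = j \<and> i \<in> I then 1 else 0)" for i by (simp add: u_def ip_act_one gs_orth)
  define M where "M = max (B \<one> j) (Suc j)"
  have "T \<one> x j = (\<Sum>i<M. u \<one> j i * x i)" by (rule T_eq) (auto simp: M_def)
  also have "\<dots> = (\<Sum>i<M. if i = j then (if j \<in> I then x j else 0) else 0)"
    by (rule sum.cong) (auto simp: u)
  also have "\<dots> = (if j \<in> I then x j else 0)" by (simp add: M_def less_max_iff_disj)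
  finally have "T \<one> x j = (if j \<in> I then x j else 0)" .
  then show "T \<one> x j = x j" using assms by auto
qed

lemma T_notin: "g \<in> carrier G \<Longrightarrow> j \<notin> I \<Longrightarrow> T g x j = 0"
  unfolding T_def u_def by (rule sum.neutral) (simp add: ip_gs_notin)

text \<open>The first \<open>K\<close> coordinates of \<open>T g x\<close> involve only finitely
  many coordinates of \<open>x\<close>, so they are those of \<open>act g z\<close> for a finite
  combination \<open>z\<close> in \<open>W\<close>. Bessel for \<open>act g z\<close>, isometry of
  \<open>act\<close> and Parseval for \<open>z\<close> give the bound.\<close>

lemma T_contract:
  assumes g: "g \<in> carrier G" and x: "\<And>M. (\<Sum>i<M. (cmod (x i))\<^sup>2) \<le> b"
  shows "(\<Sum>j<K. (cmod (T g x j))\<^sup>2) \<le> b"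
proof -
  obtain M where M: "\<forall>j<K. B g j \<le> M" using ex_bound by blast
  define z where "z = (\<Sum>i<M. sc (x i) (gs i))"
  have z: "z \<in> W" by (auto simp: z_def)
  have T: "T g x j = ip (act g z) (gs j)" if "j < K" for j
  proof -
    have "ip (act g z) (gs j) = (\<Sum>i<M. x i * ip (gs i) (act (inv g) (gs j)))"
      using g z by (simp add: ip_act_adjoint) (simp add: z_def ip_sum ip_sc)
    then show ?thesis using that M g by (simp add: T_eq[of g j M] ip_act_gs mult.commute)
  qed
  have zgs: "ip z (gs j) = (if j < M \<and> j \<in> I then x j else 0)" for j
  proof -
    have "ip z (gs j) = (\<Sum>i<M. x i * ip (gs i) (gs j))" by (simp add: z_def ip_sum ip_sc)
    also have "\<dots> = (\<Sum>i<M. if i = j then (if j \<in> I then x j else 0) else 0)"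
      by (rule sum.cong) (auto simp: gs_orth)
    finally have "ip z (gs j) = (\<Sum>i<M. if i = j then (if j \<in> I then x j else 0) else 0)" .
    then show ?thesis by simp
  qed
  have "expands z M" unfolding z_def
  proof -
    have "expands (\<Sum>i\<in>J. sc (x i) (gs i)) M" if "finite J" "J \<subseteq> {..<M}" for J
      using that
    proof (induction J)
      case empty
      then show ?case by (simp add: expands_def)
    next
      case (insert i J)
      then show ?case by (auto intro!: expands_add expands_sc expands_mono[OF expands_gs])
    qed
    then show "expands (\<Sum>i<M. sc (x i) (gs i)) M" by blast
  qed
  have "(\<Sum>j<K. (cmod (T g x j))\<^sup>2) = (\<Sum>j<K. (cmod (ip (act g z) (gs j)))\<^sup>2)" using T by simp
  also have "\<dots> \<le> Re (ip (act g z) (act g z))" using g z by (intro bessel) auto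
  also have "\<dots> = Re (ip z z)" using g z by (simp add: ip_act)
  also have "\<dots> = (\<Sum>i<M. (cmod (ip z (gs i)))\<^sup>2)" by (rule expands_norm) fact
  also have "\<dots> \<le> (\<Sum>i<M. (cmod (x i))\<^sup>2)" unfolding zgs by (intro sum_mono) auto
  finally show ?thesis using x[of M] by simp
qed

lemma T_ell2:
  assumes "g \<in> carrier G" "x \<in> ell2 I"
  shows "T g x \<in> ell2 I" "(\<Sum>\<^sub>\<infinity>i\<in>I. (cmod (T g x i))\<^sup>2) \<le> (\<Sum>\<^sub>\<infinity>i\<in>I. (cmod (x i))\<^sup>2)"
  using ell2_bdd[of I "T g x", OF T_notin T_contract[OF assms(1) ell2_sum_le[OF assms(2)]]] assms by auto

lemma T_inv:
  assumes "g \<in> carrier G" "x \<in> ell2 I" shows "T (inv g) (T g x) = x" "T g (T (inv g) x) = x"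
  using assms T_mult[of "inv g" g x] T_mult[of g "inv g" x] T_one[of x] by (auto simp: ell2_def)

text \<open>Both \<open>T g\<close> and its inverse \<open>T (inv g)\<close> are
  contractions.\<close>

lemma T_norm:
  assumes "g \<in> carrier G" "x \<in> ell2 I"
  shows "(\<Sum>\<^sub>\<infinity>i\<in>I. (cmod (T g x i))\<^sup>2) = (\<Sum>\<^sub>\<infinity>i\<in>I. (cmod (x i))\<^sup>2)"
  using T_ell2[OF assms] T_ell2(2)[of "inv g" "T g x"] assms by (simp add: T_inv)

lemma T_lincomb: "T g (\<lambda>i. a * x i + b * y i) = (\<lambda>i. a * T g x i + b * T g y i)"
  by (rule ext) (simp add: T_def sum_distrib_left sum.distrib algebra_simps)

lemma unitary_rep_T: "unitary_rep G I T"
  unfolding unitary_rep_def unitary_op_def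
proof (intro conjI ballI allI)
  fix g assume g: "g \<in> carrier G"
  show "bij_betw (T g) (ell2 I) (ell2 I)"
    by (rule bij_betw_byWitness[of _ "T (inv g)"]) (use g in \<open>auto simp: T_inv T_ell2\<close>)
  fix x y assume xy: "x \<in> ell2 I" "y \<in> ell2 I"
  have "(\<Sum>\<^sub>\<infinity>i\<in>I. (cmod (1 * T g x i + b * T g y i))\<^sup>2) = (\<Sum>\<^sub>\<infinity>i\<in>I. (cmod (1 * x i + b * y i))\<^sup>2)" for b
    using T_norm[OF g ell2_lincomb[OF xy, of 1 b]] unfolding T_lincomb .
  then have "4 * ell2_inner I (T g x) (T g y) = 4 * ell2_inner I x y"
    unfolding ell2_polarization[OF xy] ell2_polarization[OF T_ell2(1)[OF g xy(1)] T_ell2(1)[OF g xy(2)]]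
    by (simp only:)
  then show "ell2_inner I (T g x) (T g y) = ell2_inner I x y" by simp
qed (auto simp: T_lincomb T_mult T_one ell2_def)

definition coords :: "'w \<Rightarrow> nat \<Rightarrow> complex" where "coords x j = ip x (gs j)"

lemma coords_ell2: "x \<in> W \<Longrightarrow> coords x \<in> ell2 I"
  by (rule ell2_bdd(1)[OF _ bessel[of x, folded coords_def]]) (auto simp: coords_def ip_gs_notin)

lemma T_coords:
  assumes g: "g \<in> carrier G" and x: "expands x N" shows "T g (coords x) = coords (act g x)"
proof
  fix j
  have W: "x \<in> W" using x expandsD(2) by blast
  \<comment> \<open>Large enough both for the expansion of \<open>x\<close> and for all of row
    \<open>j\<close>.\<close>
  define M where "M = max N (B g j)"
  have "T g (coords x) j = (\<Sum>i<M. u g j i * ip x (gs i))"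
    using g by (subst T_eq[of _ _ M]) (auto simp: M_def coords_def)
  also have "\<dots> = (\<Sum>i<M. ip x (gs i) * ip (gs i) (act (inv g) (gs j)))"
    using g by (simp add: ip_act_gs mult.commute)
  also have "\<dots> = ip x (act (inv g) (gs j))"
    using g by (intro expandsD(1)[OF x, symmetric]) (auto simp: M_def)
  also have "\<dots> = ip (act g x) (gs j)" using W g by (simp add: ip_act_adjoint)
  finally show "T g (coords x) j = coords (act g x) j" by (simp add: coords_def)
qed

lemma span_sum: "(\<Sum>i<N. sc (x i) (gs i)) \<in> lspan"
  by (intro lspan_sum lspan.sc gs_lspan)

lemma coords_span_sum:
  assumes "\<And>i. i \<notin> I \<Longrightarrow> x i = 0"
  shows "coords (\<Sum>i<N. sc (x i) (gs i)) = (\<lambda>j. if j < N then x j else 0)"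
proof
  fix j
  have "coords (\<Sum>i<N. sc (x i) (gs i)) j = (\<Sum>i<N. x i * ip (gs i) (gs j))"
    by (simp add: coords_def ip_sum ip_sc)
  also have "\<dots> = (\<Sum>i<N. if i = j then x j else 0)"
    using assms by (intro sum.cong) (auto simp: gs_orth)
  finally show "coords (\<Sum>i<N. sc (x i) (gs i)) j = (if j < N then x j else 0)" by simp
qed

lemma norm_sum3: "(cmod (a - b + c))\<^sup>2 \<le> 3 * ((cmod a)\<^sup>2 + (cmod b)\<^sup>2 + (cmod c)\<^sup>2)"
proof -
  have "cmod (a - b + c) \<le> cmod a + cmod b + cmod c" by norm
  then have "(cmod (a - b + c))\<^sup>2 \<le> (cmod a + cmod b + cmod c)\<^sup>2" by (rule power_mono) simp
  also have "\<dots> \<le> 3 * ((cmod a)\<^sup>2 + (cmod b)\<^sup>2 + (cmod c)\<^sup>2)"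
    using sum_squares_bound[of "cmod a" "cmod b"] sum_squares_bound[of "cmod a" "cmod c"]
      sum_squares_bound[of "cmod b" "cmod c"] by (simp add: power2_eq_square algebra_simps)
  finally show ?thesis .
qed

text \<open>Truncating the coordinates of an exact primitive \<open>\<beta>\<close> in the completion gives a primitive
  inside the span itself, up to \<open>\<epsilon>\<close>.\<close>

lemma approx_primitive:
  assumes a: "\<And>g h. g \<in> carrier G \<Longrightarrow> h \<in> carrier G \<Longrightarrow> \<exists>n. a g h = w n"
    and \<beta>: "\<And>g. g \<in> carrier G \<Longrightarrow> \<beta> g \<in> ell2 I"
    and d\<beta>: "\<And>g h. g \<in> carrier G \<Longrightarrow> h \<in> carrier G \<Longrightarrow>
      coords (a g h) = (\<lambda>i. T g (\<beta> h) i - \<beta> (g \<otimes> h) i + \<beta> g i)"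
    and "\<epsilon> > 0"
  shows "\<exists>b. (\<forall>g\<in>carrier G. b g \<in> W) \<and> (\<forall>g\<in>carrier G. \<forall>h\<in>carrier G.
    let D = a g h + (sc (-1) (act g (b h)) + (b (g \<otimes> h) + sc (-1) (b g))) in Re (ip D D) \<le> \<epsilon>)"
proof -
  have "\<forall>g. \<exists>N. g \<in> carrier G \<longrightarrow> (\<forall>M. (\<Sum>i<M. (cmod (if i < N then 0 else \<beta> g i))\<^sup>2) \<le> \<epsilon> / 9)"
    using ell2_tail[OF \<beta>, of _ "\<epsilon> / 9"] \<open>\<epsilon> > 0\<close> by simp
  then obtain N where N: "\<And>g M. g \<in> carrier G \<Longrightarrow> (\<Sum>i<M. (cmod (if i < N g then 0 else \<beta> g i))\<^sup>2) \<le> \<epsilon> / 9"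
    by metis
  \<comment> \<open>\<open>t\<close> is the discarded tail. As \<open>coords (b g)\<close> is
    \<open>\<beta> g\<close> minus \<open>t g\<close>, the coordinates of \<open>D\<close> are the
    coboundary of \<open>t\<close>. Each of its three terms has square norm at most
    \<open>\<epsilon> / 9\<close>, and \<open>norm_sum3\<close> costs a factor 3.\<close>
  define t where "t g i = (if i < N g then 0 else \<beta> g i)" for g i
  define b where "b g = (\<Sum>i<N g. sc (\<beta> g i) (gs i))" for g
  have bW: "b g \<in> W" for g by (simp add: b_def)
  have \<beta>0: "\<beta> g i = 0" if "g \<in> carrier G" "i \<notin> I" for g i using \<beta>[OF that(1)] that by (simp add: ell2_def)
  have cb: "coords (b g) = (\<lambda>i. 1 * \<beta> g i + (-1) * t g i)" if "g \<in> carrier G" for g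
    using coords_span_sum[of "\<beta> g" "N g"] \<beta>0[OF that] by (auto simp: b_def t_def)
  have "Re (ip D D) \<le> \<epsilon>" if gh: "g \<in> carrier G" "h \<in> carrier G"
    and D: "D = a g h + (sc (-1) (act g (b h)) + (b (g \<otimes> h) + sc (-1) (b g)))" for g h D
  proof -
    have aW: "a g h \<in> W" using a[OF gh] by auto
    obtain n where "a g h = w n" using a[OF gh] by blast
    then have e1: "expands (a g h) (Suc n)" using expands_w by simp
    obtain n2 where "expands (act g (b h)) n2"
      using act_expands[OF span_sum gh(1)] unfolding b_def by blast
    then have e2: "expands (sc (-1) (act g (b h))) n2" by (rule expands_sc)
    obtain n3 where e3: "expands (b (g \<otimes> h)) n3" using lspan_expands[OF span_sum] unfolding b_def by blast
    obtain n4 where "expands (b g) n4" using lspan_expands[OF span_sum] unfolding b_def by blast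
    then have e4: "expands (sc (-1) (b g)) n4" by (rule expands_sc)
    obtain n5 where e5: "expands (b h) n5" using lspan_expands[OF span_sum] unfolding b_def by blast
    define K where "K = max (max (Suc n) n2) (max n3 n4)"
    \<comment> \<open>A finite expansion of \<open>D\<close> lets its norm be computed from its
      coordinates; Bessel would bound them in the wrong direction.\<close>
    have D_exp: "expands D K" unfolding D
      by (intro expands_add) (auto intro: expands_mono[OF e1] expands_mono[OF e2] expands_mono[OF e3] expands_mono[OF e4] simp: K_def)
    have "ip D (gs j) = T g (t h) j - t (g \<otimes> h) j + t g j" for j
    proof -
      have "ip D (gs j) = coords (a g h) j - coords (act g (b h)) j + coords (b (g \<otimes> h)) j - coords (b g) j"
        using aW bW gh by (simp add: D ip_add ip_sc coords_def)
      also have "coords (act g (b h)) = T g (coords (b h))" by (rule T_coords[OF gh(1) e5, symmetric])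
      also have "\<dots> = (\<lambda>i. 1 * T g (\<beta> h) i + (-1) * T g (t h) i)" by (simp only: cb[OF gh(2)] T_lincomb)
      finally show ?thesis using gh by (simp add: d\<beta> cb)
    qed
    then have "Re (ip D D) = (\<Sum>j<K. (cmod (T g (t h) j - t (g \<otimes> h) j + t g j))\<^sup>2)"
      using expands_norm[OF D_exp] by simp
    also have "\<dots> \<le> (\<Sum>j<K. 3 * ((cmod (T g (t h) j))\<^sup>2 + (cmod (t (g \<otimes> h) j))\<^sup>2 + (cmod (t g j))\<^sup>2))"
      by (intro sum_mono norm_sum3)
    also have "\<dots> = 3 * ((\<Sum>j<K. (cmod (T g (t h) j))\<^sup>2) + (\<Sum>j<K. (cmod (t (g \<otimes> h) j))\<^sup>2) + (\<Sum>j<K. (cmod (t g j))\<^sup>2))"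
      by (simp add: sum_distrib_left sum.distrib)
    also have "\<dots> \<le> 3 * (\<epsilon> / 9 + \<epsilon> / 9 + \<epsilon> / 9)"
      using gh N T_contract[OF gh(1) N[OF gh(2)], of K] unfolding t_def
      by (intro mult_left_mono add_mono) auto
    finally show ?thesis by simp
  qed
  then show ?thesis using bW by (intro exI[of _ b]) (auto simp: Let_def)
qed

end

section \<open>Vanishing second cohomology as a statement about functions of two group
  elements\<close>

lemma tuples_2: "[a, b] \<in> tuples G 2 \<longleftrightarrow> a \<in> carrier G \<and> b \<in> carrier G"
  by (simp add: tuples_def)

lemma coboundary_1: "coboundary G \<pi> 1 c [a, b] = \<pi> a (c [b]) - c [a \<otimes>\<^bsub>G\<^esub> b] + c [a]"
  by (simp add: coboundary_def)

lemma coboundary_2: "coboundary G \<pi> 2 f [a, b, c] =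
    \<pi> a (f [b, c]) - f [a \<otimes>\<^bsub>G\<^esub> b, c] + f [a, b \<otimes>\<^bsub>G\<^esub> c] - f [a, b]"
proof -
  have "{1..2::nat} = {1, 2}" by auto
  then show ?thesis by (simp add: coboundary_def)
qed

text \<open>Vanishing is assumed for representations on \<open>\<ell>\<^sup>2\<close> over subsets of one fixed type; an injection
  of the naturals into that type carries it over to \<open>\<ell>\<^sup>2(I)\<close> with \<open>I\<close> a set of naturals.\<close>

lemma H2_primitive:
  fixes f :: "nat \<Rightarrow> 'i" and I :: "nat set" and G (structure)
  assumes vanish: "\<And>(J :: 'i set) \<pi>. unitary_rep G J \<pi> \<Longrightarrow> cohom_vanishes G (ell2 J) \<pi> 2"
    and f: "inj f" and G: "group G" and rep: "unitary_rep G I \<pi>"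
    and F: "\<And>a b. a \<in> carrier G \<Longrightarrow> b \<in> carrier G \<Longrightarrow> F a b \<in> ell2 I"
    and cocycle: "\<And>a b c i. a \<in> carrier G \<Longrightarrow> b \<in> carrier G \<Longrightarrow> c \<in> carrier G \<Longrightarrow>
      \<pi> a (F b c) i - F (a \<otimes> b) c i + F a (b \<otimes> c) i - F a b i = 0"
  shows "\<exists>\<beta>. (\<forall>g\<in>carrier G. \<beta> g \<in> ell2 I) \<and>
    (\<forall>g\<in>carrier G. \<forall>h\<in>carrier G. F g h = (\<lambda>i. \<pi> g (\<beta> h) i - \<beta> (g \<otimes> h) i + \<beta> g i))"
proof -
  interpret group G by fact
  define J where "J = f ` I"
  \<comment> \<open>Extension by 0 off \<open>J\<close>, as membership in \<open>ell2 J\<close>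
    demands; together with \<open>pull\<close> it identifies \<open>ell2 I\<close> with
    \<open>ell2 J\<close>.\<close>
  define push :: "(nat \<Rightarrow> complex) \<Rightarrow> 'i \<Rightarrow> complex" where "push x = (\<lambda>j. if j \<in> J then x (inv_into UNIV f j) else 0)" for x
  define pull :: "('i \<Rightarrow> complex) \<Rightarrow> nat \<Rightarrow> complex" where "pull y = (\<lambda>i. y (f i))" for y
  have fI: "inj_on f I" using f by (rule inj_on_subset) simp
  have pull_push: "pull (push x) = x" if "x \<in> ell2 I" for x
    using that f by (auto simp: push_def pull_def J_def ell2_def inj_image_mem_iff)
  have push_pull: "push (pull y) = y" if "y \<in> ell2 J" for y
    using that f by (intro ext) (auto simp: push_def pull_def J_def ell2_def)
  have push_ell2: "push x \<in> ell2 J" if "x \<in> ell2 I" for x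
    using that f unfolding ell2_def J_def push_def
    by (auto simp: summable_on_reindex[OF fI] o_def cong: summable_on_cong)
  have pull_ell2: "pull y \<in> ell2 I" if "y \<in> ell2 J" for y
    using that f unfolding ell2_def J_def pull_def
    by (auto simp: summable_on_reindex[OF fI] o_def inj_image_mem_iff)
  have push_inner: "ell2_inner J (push x) (push y) = ell2_inner I x y" for x y
    using f unfolding ell2_inner_def J_def push_def by (simp add: infsum_reindex[OF fI] o_def cong: infsum_cong)
  have pull_inner: "ell2_inner I (pull x) (pull y) = ell2_inner J x y" for x y
    unfolding ell2_inner_def J_def pull_def by (simp add: infsum_reindex[OF fI] o_def)
  have push_lin: "push (\<lambda>i. a * x i + b * y i) = (\<lambda>i. a * push x i + b * push y i)" for a b x y
    by (auto simp: push_def)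
  have pull_lin: "pull (\<lambda>i. a * x i + b * y i) = (\<lambda>i. a * pull x i + b * pull y i)" for a b x y
    by (auto simp: pull_def)
  have op: "unitary_op I (\<pi> g)" if "g \<in> carrier G" for g using rep that by (simp add: unitary_rep_def)
  have \<pi>_ell2: "\<pi> g x \<in> ell2 I" if "g \<in> carrier G" "x \<in> ell2 I" for g x
    using op[OF that(1)] that(2) by (auto simp: unitary_op_def bij_betw_def)
  have \<pi>_lin: "\<pi> g (\<lambda>i. a * x i + b * y i) = (\<lambda>i. a * \<pi> g x i + b * \<pi> g y i)"
    if "g \<in> carrier G" "x \<in> ell2 I" "y \<in> ell2 I" for g a b x y
    using op[OF that(1)] that(2,3) by (auto simp: unitary_op_def)
  have \<pi>_mult: "\<pi> (g \<otimes> h) x = \<pi> g (\<pi> h x)" if "g \<in> carrier G" "h \<in> carrier G" "x \<in> ell2 I" for g h x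
    using rep that by (simp add: unitary_rep_def)
  define \<pi>' where "\<pi>' g y = push (\<pi> g (pull y))" for g y
  have "unitary_rep G J \<pi>'"
    unfolding unitary_rep_def unitary_op_def
  proof (intro conjI ballI allI)
    fix g assume g: "g \<in> carrier G"
    have "bij_betw (\<pi> g) (ell2 I) (ell2 I)" using op[OF g] by (simp add: unitary_op_def)
    moreover have "bij_betw pull (ell2 J) (ell2 I)"
      by (rule bij_betw_byWitness[of _ push]) (auto simp: pull_push push_pull push_ell2 pull_ell2)
    moreover have "bij_betw push (ell2 I) (ell2 J)"
      by (rule bij_betw_byWitness[of _ pull]) (auto simp: pull_push push_pull push_ell2 pull_ell2)
    ultimately have "bij_betw (push \<circ> (\<pi> g \<circ> pull)) (ell2 J) (ell2 J)" by (blast intro: bij_betw_trans)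
    then show "bij_betw (\<pi>' g) (ell2 J) (ell2 J)" by (simp add: o_def \<pi>'_def[abs_def])
    fix x y assume xy: "x \<in> ell2 J" "y \<in> ell2 J"
    show "\<pi>' g (\<lambda>i. a * x i + b * y i) = (\<lambda>i. a * \<pi>' g x i + b * \<pi>' g y i)" for a b
      unfolding \<pi>'_def by (simp only: pull_lin \<pi>_lin[OF g pull_ell2[OF xy(1)] pull_ell2[OF xy(2)]] push_lin)
    show "ell2_inner J (\<pi>' g x) (\<pi>' g y) = ell2_inner J x y"
      using op[OF g] xy by (simp add: \<pi>'_def push_inner unitary_op_def pull_ell2 pull_inner)
  next
    fix g h x assume "g \<in> carrier G" "h \<in> carrier G" "x \<in> ell2 J"
    then show "\<pi>' (g \<otimes> h) x = \<pi>' g (\<pi>' h x)" by (simp add: \<pi>'_def \<pi>_mult pull_ell2 pull_push \<pi>_ell2)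
  next
    fix x assume "x \<in> ell2 J"
    then show "\<pi>' \<one> x = x" using rep by (simp add: \<pi>'_def unitary_rep_def pull_ell2 push_pull)
  qed
  then have van: "cohom_vanishes G (ell2 J) \<pi>' 2" by (rule vanish)
  define \<Phi> where "\<Phi> gs = push (F (gs ! 0) (gs ! 1))" for gs
  have \<Phi>: "\<Phi> [a, b] = push (F a b)" for a b by (simp add: \<Phi>_def)
  have "\<Phi> \<in> cocycles G (ell2 J) \<pi>' 2"
    unfolding cocycles_def cochains_def
  proof (safe)
    fix gs assume "gs \<in> tuples G 2"
    then show "\<Phi> gs \<in> ell2 J" by (auto simp: tuples_def \<Phi>_def intro!: push_ell2 F)
  next
    fix gs assume gs: "gs \<in> tuples G (2 + 1)"
    then obtain a b c where abc: "gs = [a, b, c]" "a \<in> carrier G" "b \<in> carrier G" "c \<in> carrier G"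
      by (auto simp: tuples_def length_Suc_conv numeral_3_eq_3)
    have "\<pi>' a (\<Phi> [b, c]) = push (\<pi> a (F b c))" using abc by (simp add: \<Phi> \<pi>'_def pull_push F)
    then show "coboundary G \<pi>' 2 \<Phi> gs = 0"
      unfolding abc(1) coboundary_2 \<Phi> using cocycle[OF abc(2-4)] by (auto simp: push_def)
  qed
  then obtain c where c: "c \<in> cochains G (ell2 J) 1" "\<forall>gs\<in>tuples G 2. \<Phi> gs = coboundary G \<pi>' 1 c gs"
    using van unfolding cohom_vanishes_def by auto
  define \<beta> where "\<beta> g = pull (c [g])" for g
  have cJ: "c [g] \<in> ell2 J" if "g \<in> carrier G" for g using c(1) that by (simp add: cochains_def tuples_def)
  have "F g h = (\<lambda>i. \<pi> g (\<beta> h) i - \<beta> (g \<otimes> h) i + \<beta> g i)" if gh: "g \<in> carrier G" "h \<in> carrier G" for g h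
  proof -
    have "push (F g h) = \<pi>' g (c [h]) - c [g \<otimes> h] + c [g]"
      using c(2) gh tuples_2[of g h G] by (metis \<Phi> coboundary_1)
    then have "pull (push (F g h)) = pull (\<pi>' g (c [h]) - c [g \<otimes> h] + c [g])" by simp
    also have "\<dots> = (\<lambda>i. pull (\<pi>' g (c [h])) i - \<beta> (g \<otimes> h) i + \<beta> g i)" by (auto simp: pull_def \<beta>_def)
    also have "pull (\<pi>' g (c [h])) = \<pi> g (\<beta> h)" using gh by (simp add: \<pi>'_def \<beta>_def pull_push \<pi>_ell2 pull_ell2 cJ)
    finally show ?thesis using gh by (simp add: pull_push F)
  qed
  moreover have "\<beta> g \<in> ell2 I" if "g \<in> carrier G" for g using that by (simp add: \<beta>_def pull_ell2 cJ)
  ultimately show ?thesis by blast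
qed

section \<open>Asymptotic homomorphisms\<close>

lemma cinner_mult_right: "cinner (A * B) C = cinner A (C * adj B)"
proof -
  have "cinner (A * B) C = cnj (cinner (adj B * adj A) (adj C))"
    using cinner_adj[of "A * B" C] by simp
  also have "\<dots> = cnj (cinner (adj A) (B * adj C))" by (simp add: cinner_mult_left)
  also have "\<dots> = cinner A (C * adj B)" using cinner_adj[of A "C * adj B"] by simp
  finally show ?thesis .
qed

lemma norm_conj_diff:
  assumes p: "p \<in> unitaries k" and q: "q \<in> unitaries k" and A: "corner k A"
  shows "norm (p * A * adj p - q * A * adj q) \<le> 2 * norm (p - q) * norm A"
proof -
  have "p * A * adj p - q * A * adj q = (p - q) * A * adj p + q * (A * adj (p - q))"
    by (simp add: algebra_simps)
  also have "norm \<dots> \<le> norm ((p - q) * A * adj p) + norm (q * (A * adj (p - q)))" by (rule norm_triangle_ineq)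
  also have "norm ((p - q) * A * adj p) = norm ((p - q) * A)"
    using p q A by (intro norm_unitary_mult(2)[of _ k]) (auto simp: unitariesD)
  also have "norm (q * (A * adj (p - q))) = norm (A * adj (p - q))"
    using p q A by (intro norm_unitary_mult(1)[of _ k]) (auto simp: unitariesD)
  also have "norm ((p - q) * A) + norm (A * adj (p - q)) \<le> norm (p - q) * norm A + norm A * norm (p - q)"
    by (intro add_mono) (rule norm_mult_ineq, metis norm_mult_ineq norm_adj)
  finally show ?thesis by (simp add: mult.commute)
qed

lemma norm_conj:
  assumes "s \<in> unitaries k" "corner k A" shows "norm (s * A * adj s) = norm A"
  using assms norm_unitary_mult[of s k A] norm_unitary_mult(2)[of "adj s" k "s * A"] by (simp add: unitariesD)

lemma cinner_conj:
  assumes "s \<in> unitaries k" "corner k A" "corner k B"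
  shows "cinner (s * A * adj s) (s * B * adj s) = cinner A B"
proof -
  have "cinner (s * A * adj s) (s * B * adj s) = cinner (s * A) (s * B * (adj s * s))"
    by (simp add: cinner_mult_right mult.assoc)
  also have "\<dots> = cinner (s * A) (s * B)" using assms by (simp add: unitariesD)
  also have "\<dots> = cinner A B" using assms by (simp add: cinner_mult_left unitariesD)
  finally show ?thesis .
qed

text \<open>Multiplying out \<open>(1 + P1) (1 + P2) (1 + d \<alpha>)\<close>, the first-order terms combine to \<open>d\<close> times the
  coboundary defect and everything else is \<open>O(d\<^sup>2)\<close>.\<close>

lemma corrected_defect:
  assumes s: "s \<in> unitaries k" and t: "t \<in> unitaries k" and r: "r \<in> unitaries k"
    and \<alpha>: "corner k \<alpha>" "s * t * adj r = idm k + d *\<^sub>R \<alpha>" "norm \<alpha> \<le> C"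
    and d: "0 < d" "d \<le> 1"
    and B: "corner k B1" "corner k B2" "corner k B3" "norm B1 \<le> C" "norm B2 \<le> C" "norm B3 \<le> C"
    and u: "u1 \<in> unitaries k" "u2 \<in> unitaries k" "u3 \<in> unitaries k"
    and E1: "norm (u1 - (idm k - d *\<^sub>R B1)) \<le> d\<^sup>2 * C\<^sup>2"
    and E2: "norm (u2 - (idm k - d *\<^sub>R B2)) \<le> d\<^sup>2 * C\<^sup>2"
    and E3: "norm (u3 - (idm k - d *\<^sub>R B3)) \<le> d\<^sup>2 * C\<^sup>2"
  shows "norm (u1 * s * (u2 * t) - u3 * r) \<le>
    d * (norm (\<alpha> - s * B2 * adj s + B3 - B1) + d * (3 * C\<^sup>2 + 3 * (C + C\<^sup>2)\<^sup>2 + (C + C\<^sup>2) ^ 3))"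
proof -
  have C: "0 \<le> C" using B(4) norm_ge_zero order_trans by blast
  \<comment> \<open>\<open>d * L\<close> bounds each of the three perturbations \<open>P1\<close>,
    \<open>P2\<close>, \<open>P3\<close>: the first-order part contributes \<open>C\<close>, and the
    quadratic remainder contributes at most the square of \<open>C\<close> because
    \<open>d \<le> 1\<close>.\<close>
  define L where "L = C + C\<^sup>2"
  have L: "0 \<le> L" "C \<le> L" using C by (auto simp: L_def)
  have cor: "corner k s" "corner k t" "corner k r" "corner k u1" "corner k u2" "corner k u3"
    using s t r u by (auto simp: unitariesD)
  define F1 where "F1 = u1 - (idm k - d *\<^sub>R B1)"
  define F2 where "F2 = u2 - (idm k - d *\<^sub>R B2)"
  define F3 where "F3 = u3 - (idm k - d *\<^sub>R B3)"
  define P1 where "P1 = F1 - d *\<^sub>R B1"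
  define P2 where "P2 = s * F2 * adj s - d *\<^sub>R (s * B2 * adj s)"
  define P3 where "P3 = d *\<^sub>R \<alpha>"
  have c: "corner k P1" "corner k P2" "corner k P3" "corner k F2"
    using cor B \<alpha> by (auto simp: P1_def P2_def P3_def F1_def F2_def)
  have u1: "u1 = idm k + P1" and u3: "u3 = idm k + (F3 - d *\<^sub>R B3)"
    by (simp_all add: P1_def F1_def F3_def)
  have u2: "s * u2 * adj s = idm k + P2"
  proof -
    have "u2 = idm k + (F2 - d *\<^sub>R B2)" by (simp add: F2_def)
    then have "s * u2 * adj s = s * (idm k + (F2 - d *\<^sub>R B2)) * adj s" by simp
    also have "\<dots> = s * idm k * adj s + P2" by (simp add: P2_def algebra_simps)
    finally show ?thesis using s cor by (simp add: unitariesD)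
  qed
  have n1: "norm F1 \<le> d\<^sup>2 * C\<^sup>2" "norm (s * F2 * adj s) \<le> d\<^sup>2 * C\<^sup>2" "norm F3 \<le> d\<^sup>2 * C\<^sup>2"
    using E1 E2 E3 norm_conj[OF s c(4)] by (auto simp: F1_def F2_def F3_def)
  have small: "d\<^sup>2 * C\<^sup>2 + d * C \<le> d * L"
  proof -
    have "d * (d * C\<^sup>2) \<le> d * C\<^sup>2" using d C by (intro mult_left_mono mult_left_le_one_le) auto
    then show ?thesis by (simp add: L_def power2_eq_square algebra_simps)
  qed
  have nP1: "norm P1 \<le> d * L"
  proof -
    have "norm P1 \<le> norm F1 + norm (d *\<^sub>R B1)" unfolding P1_def by (rule norm_triangle_ineq4)
    also have "\<dots> \<le> d\<^sup>2 * C\<^sup>2 + d * C" using n1 B d by (intro add_mono) (auto intro: mult_left_mono)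
    finally show ?thesis using small by simp
  qed
  have nP2: "norm P2 \<le> d * L"
  proof -
    have "norm P2 \<le> norm (s * F2 * adj s) + norm (d *\<^sub>R (s * B2 * adj s))" unfolding P2_def by (rule norm_triangle_ineq4)
    also have "\<dots> \<le> d\<^sup>2 * C\<^sup>2 + d * C" using n1 B d norm_conj[OF s B(2)] by (intro add_mono) (auto intro: mult_left_mono)
    finally show ?thesis using small by simp
  qed
  have nP3: "norm P3 \<le> d * L" using \<alpha>(3) L d by (auto simp: P3_def intro: mult_left_mono)
  have prod: "norm (x * y) \<le> (d * L) * b" if "norm x \<le> d * L" "norm y \<le> b" for x y :: fmat and b
    using that norm_mult_ineq[of x y] by (meson mult_mono norm_ge_zero order_trans)
  have d3: "(d * L) * ((d * L) * (d * L)) \<le> d\<^sup>2 * L ^ 3"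
  proof -
    have "d * (d\<^sup>2 * L ^ 3) \<le> d\<^sup>2 * L ^ 3" using d L by (intro mult_left_le_one_le) auto
    then show ?thesis by (simp add: power2_eq_square power3_eq_cube algebra_simps)
  qed
  \<comment> \<open>Multiplying by \<open>adj r\<close> on the right keeps the norm and turns every
    factor into a perturbation of \<open>idm k\<close>.\<close>
  have "norm (u1 * s * (u2 * t) - u3 * r) = norm ((u1 * s * (u2 * t) - u3 * r) * adj r)"
    using r cor by (intro norm_unitary_mult(2)[of _ k, symmetric]) (auto simp: unitariesD)
  also have "(u1 * s * (u2 * t) - u3 * r) * adj r = u1 * (s * u2 * adj s) * (s * t * adj r) - u3"
    using cor r s by (simp add: left_diff_distrib mult.assoc unitariesD)
  also have "\<dots> = d *\<^sub>R (\<alpha> - s * B2 * adj s + B3 - B1) + (F1 + s * F2 * adj s - F3)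
      + (P1 * P2 + P1 * P3 + P2 * P3 + P1 * (P2 * P3))"
  proof -
    have "u1 * (s * u2 * adj s) * (s * t * adj r) - u3 =
        (idm k + P1) * (idm k + P2) * (idm k + P3) - (idm k + (F3 - d *\<^sub>R B3))"
      using u1 u2 u3 \<alpha>(2) by (simp only: P3_def)
    also have "\<dots> = P1 + P2 + P3 - (F3 - d *\<^sub>R B3) + (P1 * P2 + P1 * P3 + P2 * P3 + P1 * (P2 * P3))"
      using c by (simp add: distrib_left distrib_right mult.assoc algebra_simps)
    finally show ?thesis by (simp add: P1_def P2_def P3_def algebra_simps)
  qed
  also have "norm \<dots> \<le> norm (d *\<^sub>R (\<alpha> - s * B2 * adj s + B3 - B1)) + (norm F1 + norm (s * F2 * adj s) + norm F3)
      + (norm (P1 * P2) + norm (P1 * P3) + norm (P2 * P3) + norm (P1 * (P2 * P3)))"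
    by (meson add_mono norm_triangle_ineq norm_triangle_ineq4 norm_triangle_le norm_triangle_le_diff order_refl)
  also have "\<dots> \<le> d * norm (\<alpha> - s * B2 * adj s + B3 - B1) + (d\<^sup>2 * C\<^sup>2 + d\<^sup>2 * C\<^sup>2 + d\<^sup>2 * C\<^sup>2)
      + ((d * L) * (d * L) + (d * L) * (d * L) + (d * L) * (d * L) + d\<^sup>2 * L ^ 3)"
    using d n1 prod[OF nP1 nP2] prod[OF nP1 nP3] prod[OF nP2 nP3] prod[OF nP1 prod[OF nP2 nP3]] d3
    by (intro add_mono) auto
  finally show ?thesis by (simp add: L_def power2_eq_square algebra_simps)
qed

text \<open>Unitarity of 1 + d \<open>\<alpha>\<close> says that
  \<open>\<alpha> + adj \<alpha>\<close> is -d times \<open>\<alpha> * adj \<alpha>\<close>, so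
  \<open>\<alpha>\<close> is skew-adjoint up to order d. Conjugation by \<open>s\<close> commutes
  with \<open>adj\<close>; hence the new defect is the skew part of the old one plus half of that
  error, and taking skew parts does not increase the norm.\<close>

lemma skew_part_defect:
  assumes s: "s \<in> unitaries k" and d: "0 < d" and C: "norm \<alpha> \<le> C" and \<alpha>: "corner k \<alpha>"
    and un: "idm k + d *\<^sub>R \<alpha> \<in> unitaries k"
  defines "sk \<equiv> \<lambda>b. (1/2) *\<^sub>R (b - adj b)"
  shows "norm (\<alpha> - s * sk B2 * adj s + sk B3 - sk B1) \<le> norm (\<alpha> - s * B2 * adj s + B3 - B1) + d * C\<^sup>2"
proof -
  define D where "D = \<alpha> - s * B2 * adj s + B3 - B1"
  have "(idm k + d *\<^sub>R \<alpha>) * adj (idm k + d *\<^sub>R \<alpha>) = idm k" using un unitariesD(3) by blast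
  then have "d *\<^sub>R (\<alpha> + adj \<alpha> + d *\<^sub>R (\<alpha> * adj \<alpha>)) = 0"
    using \<alpha> by (simp add: algebra_simps)
  then have sum: "\<alpha> + adj \<alpha> = - (d *\<^sub>R (\<alpha> * adj \<alpha>))" using d by (simp add: eq_neg_iff_add_eq_0)
  have half: "\<alpha> = (1/2) *\<^sub>R (\<alpha> - adj \<alpha>) + (1/2) *\<^sub>R (\<alpha> + adj \<alpha>)"
    by (simp add: algebra_simps flip: scaleR_add_left)
  have "\<alpha> - s * sk B2 * adj s + sk B3 - sk B1 = (1/2) *\<^sub>R (\<alpha> - adj \<alpha>) + (1/2) *\<^sub>R (\<alpha> + adj \<alpha>) - s * sk B2 * adj s + sk B3 - sk B1"
    using half by simp
  also have "\<dots> = (1/2) *\<^sub>R (D - adj D) + (1/2) *\<^sub>R (\<alpha> + adj \<alpha>)"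
    by (simp add: sk_def D_def algebra_simps)
  also have "norm \<dots> \<le> (1/2) * (norm D + norm D) + (1/2) * norm (\<alpha> + adj \<alpha>)"
  proof -
    have "norm (D - adj D) \<le> norm D + norm D" using norm_triangle_ineq4[of D "adj D"] by simp
    then show ?thesis by (intro norm_triangle_le add_mono) auto
  qed
  also have "norm (\<alpha> + adj \<alpha>) \<le> d * (C * C)"
  proof -
    have "norm (\<alpha> + adj \<alpha>) = d * norm (\<alpha> * adj \<alpha>)" unfolding sum using d by simp
    also have "norm (\<alpha> * adj \<alpha>) \<le> norm \<alpha> * norm \<alpha>" by (metis norm_mult_ineq norm_adj)
    also have "\<dots> \<le> C * C" using C by (intro mult_mono) (auto intro: order_trans[OF norm_ge_zero])
    finally show ?thesis using d by (simp add: mult_left_mono)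
  qed
  finally have "norm (\<alpha> - s * sk B2 * adj s + sk B3 - sk B1) \<le> (1/2) * (norm D + norm D) + (1/2) * (d * (C * C))"
    by simp
  moreover have "0 \<le> d * (C * C)" using d by simp
  ultimately show ?thesis by (simp add: D_def power2_eq_square)
qed

section \<open>The limit inner product and the limiting 2-cocycle\<close>

lemma ultrafilter_bounded_tendsto:
  fixes f :: "nat \<Rightarrow> complex"
  assumes U: "nonprincipal_ultrafilter U" and f: "\<And>n. cmod (f n) \<le> C"
  shows "\<exists>l. (f \<longlongrightarrow> l) U"
proof -
  have U0: "U \<noteq> bot" using U by (simp add: nonprincipal_ultrafilter_def)
  then have "filtermap f U \<noteq> bot" by (simp add: filtermap_bot_iff)
  moreover have "eventually (\<lambda>x. x \<in> cball 0 C) (filtermap f U)" using f by (simp add: eventually_filtermap)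
  ultimately obtain x where x: "inf (nhds x) (filtermap f U) \<noteq> bot"
    using compact_cball[of 0 C] unfolding compact_filter by blast
  have "(f \<longlongrightarrow> x) U"
  proof (rule topological_tendstoI)
    fix S assume S: "open S" "x \<in> S"
    show "eventually (\<lambda>n. f n \<in> S) U"
    proof (rule ccontr)
      assume "\<not> eventually (\<lambda>n. f n \<in> S) U"
      moreover have "eventually (\<lambda>n. n \<in> {n. f n \<in> S}) U \<or> eventually (\<lambda>n. n \<notin> {n. f n \<in> S}) U"
        using U unfolding nonprincipal_ultrafilter_def by blast
      ultimately have "eventually (\<lambda>y. y \<notin> S) (filtermap f U)" by (simp add: eventually_filtermap)
      moreover have "eventually (\<lambda>y. y \<in> S) (nhds x)" using S eventually_nhds by blast
      ultimately have "eventually (\<lambda>y. False) (inf (nhds x) (filtermap f U))"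
        unfolding eventually_inf by blast
      then show False using x by (simp add: trivial_limit_def)
    qed
  qed
  then show ?thesis ..
qed

text \<open>In \<open>defect\<close> the constant may depend on the two group elements but not on
  \<open>n\<close>; this is exactly boundedness of the rescaled error. Positivity of
  \<open>d n\<close> permits the rescaling.\<close>

locale asymp_hom = group G for G :: "('g, 'b) monoid_scheme" (structure) +
  fixes U :: "nat filter" and k :: "nat \<Rightarrow> nat" and \<sigma> :: "nat \<Rightarrow> 'g \<Rightarrow> fmat" and d :: "nat \<Rightarrow> real"
  assumes U: "nonprincipal_ultrafilter U"
    and countable_G: "countable (carrier G)"
    and d: "\<And>n. 0 < d n" "\<And>n. d n \<le> 1" "(d \<longlongrightarrow> 0) U"
    and \<sigma>: "\<And>n g. g \<in> carrier G \<Longrightarrow> \<sigma> n g \<in> unitaries (k n)"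
    and defect: "\<And>g h. g \<in> carrier G \<Longrightarrow> h \<in> carrier G \<Longrightarrow>
      \<exists>C. \<forall>n. norm (\<sigma> n g * \<sigma> n h - \<sigma> n (g \<otimes> h)) \<le> C * d n"
begin

lemma U_bot: "U \<noteq> bot" using U by (simp add: nonprincipal_ultrafilter_def)

definition W :: "(nat \<Rightarrow> fmat) set" where
  "W = {A. (\<forall>n. corner (k n) (A n)) \<and> (\<exists>C. \<forall>n. norm (A n) \<le> C)}"

lemma WI: "(\<And>n. corner (k n) (A n)) \<Longrightarrow> (\<And>n. norm (A n) \<le> C) \<Longrightarrow> A \<in> W"
  by (auto simp: W_def)

lemma W_corner: "A \<in> W \<Longrightarrow> corner (k n) (A n)"
  by (simp add: W_def)

lemma W_bound: "A \<in> W \<Longrightarrow> \<exists>C. \<forall>n. norm (A n) \<le> C"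
  by (simp add: W_def)

definition ip :: "(nat \<Rightarrow> fmat) \<Rightarrow> (nat \<Rightarrow> fmat) \<Rightarrow> complex" where
  "ip A B = Lim U (\<lambda>n. cinner (A n) (B n))"

lemma ip_tendsto:
  assumes "A \<in> W" "B \<in> W" shows "((\<lambda>n. cinner (A n) (B n)) \<longlongrightarrow> ip A B) U"
proof -
  obtain C D where CD: "\<And>n. norm (A n) \<le> C" "\<And>n. norm (B n) \<le> D" using W_bound[OF assms(1)] W_bound[OF assms(2)] by metis
  have "cmod (cinner (A n) (B n)) \<le> C * D" for n
    using cmod_cinner_le[of "A n" "B n"] CD[of n] by (meson mult_mono norm_ge_zero order_trans)
  then obtain l where l: "((\<lambda>n. cinner (A n) (B n)) \<longlongrightarrow> l) U"
    using ultrafilter_bounded_tendsto[OF U, of "\<lambda>n. cinner (A n) (B n)"] by blast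
  then show ?thesis unfolding ip_def tendsto_Lim[OF U_bot l] .
qed

lemma ip_eqI: "A \<in> W \<Longrightarrow> B \<in> W \<Longrightarrow> ((\<lambda>n. cinner (A n) (B n)) \<longlongrightarrow> l) U \<Longrightarrow> ip A B = l"
  using tendsto_unique[OF U_bot ip_tendsto] by blast

lemma cinner_null:
  assumes "((\<lambda>n. norm (A n)) \<longlongrightarrow> 0) U" "B \<in> W"
  shows "((\<lambda>n. cinner (A n) (B n)) \<longlongrightarrow> 0) U"
proof -
  obtain D where D: "\<And>n. norm (B n) \<le> D" using W_bound[OF assms(2)] by metis
  have "cmod (cinner (A n) (B n)) \<le> norm (A n) * D" for n
    by (rule order_trans[OF cmod_cinner_le mult_left_mono[OF D]]) simp
  then show ?thesis
    by (intro Lim_null_comparison[OF always_eventually tendsto_mult_left_zero[OF assms(1)]] allI)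
qed

text \<open>Differences that tend to 0 in norm along \<open>U\<close> do not affect
  \<open>ip\<close>; by \<open>tendsto_0_d\<close> every error of size O(d n) is of this
  kind.\<close>

lemma ip_cong:
  assumes "((\<lambda>n. norm (A n - B n)) \<longlongrightarrow> 0) U" "A \<in> W" "B \<in> W" "Z \<in> W"
  shows "ip A Z = ip B Z"
proof (rule ip_eqI)
  have "((\<lambda>n. cinner (A n - B n) (Z n) + cinner (B n) (Z n)) \<longlongrightarrow> 0 + ip B Z) U"
    using assms by (intro tendsto_add cinner_null ip_tendsto)
  then show "((\<lambda>n. cinner (A n) (Z n)) \<longlongrightarrow> ip B Z) U" by (simp flip: cinner_add)
qed (use assms in auto)

sublocale semi_inner W "\<lambda>a A n. a \<cdot>\<^sub>C A n" ip
proof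
  show "0 \<in> W" by (rule WI[of _ 0]) auto
  show add: "x + y \<in> W" if "x \<in> W" "y \<in> W" for x y
  proof -
    obtain C where "\<And>n. norm (x n) \<le> C" using W_bound \<open>x \<in> W\<close> by blast
    moreover obtain D where "\<And>n. norm (y n) \<le> D" using W_bound \<open>y \<in> W\<close> by blast
    ultimately show ?thesis using that by (intro WI[of _ "C + D"]) (auto simp: W_corner intro: norm_triangle_mono)
  qed
  show sc: "(\<lambda>n. a \<cdot>\<^sub>C x n) \<in> W" if "x \<in> W" for a x
  proof -
    obtain C where "\<And>n. norm (x n) \<le> C" using W_bound \<open>x \<in> W\<close> by blast
    then show ?thesis using that by (intro WI[of _ "cmod a * C"]) (auto simp: W_corner norm_scaleC intro: mult_left_mono)
  qed
  show "ip (x + y) z = ip x z + ip y z" if "x \<in> W" "y \<in> W" "z \<in> W" for x y z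
    by (rule ip_eqI) (use that in \<open>auto simp: add cinner_add intro!: tendsto_add ip_tendsto\<close>)
  show "ip (\<lambda>n. a \<cdot>\<^sub>C x n) z = a * ip x z" if "x \<in> W" "z \<in> W" for a x z
    by (rule ip_eqI) (use that in \<open>auto simp: sc cinner_scaleC intro!: tendsto_mult_left ip_tendsto\<close>)
  show "ip y x = cnj (ip x y)" if "x \<in> W" "y \<in> W" for x y
  proof (rule ip_eqI)
    have "((\<lambda>n. cnj (cinner (x n) (y n))) \<longlongrightarrow> cnj (ip x y)) U"
      using that by (intro tendsto_cnj ip_tendsto)
    then show "((\<lambda>n. cinner (y n) (x n)) \<longlongrightarrow> cnj (ip x y)) U" by (simp flip: cinner_commute)
  qed (use that in auto)
  show "0 \<le> Re (ip x x)" if "x \<in> W" for x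
    using tendsto_Re[OF ip_tendsto[OF that that]]
    by (rule tendsto_lowerbound) (auto simp: cinner_self_norm U_bot simp flip: of_real_power)
  \<comment> \<open>A null vector has norms tending to 0 along \<open>U\<close>, and Cauchy-Schwarz
    for matrices does the rest.\<close>
  show "ip x z = 0" if "x \<in> W" "z \<in> W" "ip x x = 0" for x z
  proof (rule ip_eqI)
    have "((\<lambda>n. Re (cinner (x n) (x n))) \<longlongrightarrow> Re 0) U"
      using tendsto_Re[OF ip_tendsto[OF that(1) that(1)]] that(3) by simp
    then have "((\<lambda>n. sqrt ((norm (x n))\<^sup>2)) \<longlongrightarrow> sqrt 0) U"
      by (intro tendsto_real_sqrt) (simp add: cinner_self_norm del: of_real_power)
    then show "((\<lambda>n. cinner (x n) (z n)) \<longlongrightarrow> 0) U" using that by (intro cinner_null) auto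
  qed (use that in auto)
qed

definition act :: "'g \<Rightarrow> (nat \<Rightarrow> fmat) \<Rightarrow> nat \<Rightarrow> fmat" where
  "act g A n = \<sigma> n g * A n * adj (\<sigma> n g)"

lemma \<sigma>_corner: "g \<in> carrier G \<Longrightarrow> corner (k n) (\<sigma> n g)"
  using \<sigma> unitariesD(1) by blast

lemma act_W: "g \<in> carrier G \<Longrightarrow> A \<in> W \<Longrightarrow> act g A \<in> W"
  using W_bound[of A] unfolding act_def[abs_def]
  by (auto intro!: WI simp: norm_conj[OF \<sigma> W_corner] \<sigma>_corner W_corner)

lemma d_tendsto: "((\<lambda>n. C * d n) \<longlongrightarrow> 0) U"
  using tendsto_mult_right_zero[OF d(3)] by simp

lemma tendsto_0_d: "(\<And>n. norm (f n) \<le> C * d n) \<Longrightarrow> (f \<longlongrightarrow> (0::real)) U"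
  by (rule Lim_null_comparison[OF _ d_tendsto[of C]]) simp

lemma ip_act_mult:
  assumes gh: "g \<in> carrier G" "h \<in> carrier G" and A: "A \<in> W" "Z \<in> W"
  shows "ip (act (g \<otimes> h) A) Z = ip (act g (act h A)) Z"
proof (rule ip_cong)
  obtain C where C: "\<And>n. norm (\<sigma> n g * \<sigma> n h - \<sigma> n (g \<otimes> h)) \<le> C * d n" using defect[OF gh] by blast
  obtain D where D: "\<And>n. norm (A n) \<le> D" using W_bound[OF A(1)] by metis
  have "norm (norm (act (g \<otimes> h) A n - act g (act h A) n)) \<le> (2 * C * D) * d n" for n
  proof -
    have "norm (act (g \<otimes> h) A n - act g (act h A) n) =
        norm ((\<sigma> n g * \<sigma> n h) * A n * adj (\<sigma> n g * \<sigma> n h) - \<sigma> n (g \<otimes> h) * A n * adj (\<sigma> n (g \<otimes> h)))"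
      by (simp add: act_def mult.assoc norm_minus_commute)
    also have "\<dots> \<le> 2 * norm (\<sigma> n g * \<sigma> n h - \<sigma> n (g \<otimes> h)) * norm (A n)"
      using gh A by (intro norm_conj_diff) (auto intro: unitary_mult \<sigma> W_corner)
    also have "\<dots> \<le> (2 * (C * d n)) * D"
      using C[of n] D[of n] order_trans[OF norm_ge_zero C[of n]] by (intro mult_mono) auto
    finally show ?thesis by (simp add: mult_ac)
  qed
  then show "((\<lambda>n. norm (act (g \<otimes> h) A n - act g (act h A) n)) \<longlongrightarrow> 0) U" by (rule tendsto_0_d)
qed (use assms act_W in auto)

lemma \<sigma>_one: "\<exists>C. \<forall>n. norm (\<sigma> n \<one> - idm (k n)) \<le> C * d n"
proof -
  obtain C where C: "\<And>n. norm (\<sigma> n \<one> * \<sigma> n \<one> - \<sigma> n (\<one> \<otimes> \<one>)) \<le> C * d n" using defect[of \<one> \<one>] by blast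
  have "norm (\<sigma> n \<one> - idm (k n)) = norm (\<sigma> n \<one> * (\<sigma> n \<one> - idm (k n)))" for n
    by (intro norm_unitary_mult(1)[of _ "k n", symmetric] \<sigma>) (auto simp: \<sigma>_corner)
  moreover have "\<sigma> n \<one> * (\<sigma> n \<one> - idm (k n)) = \<sigma> n \<one> * \<sigma> n \<one> - \<sigma> n (\<one> \<otimes> \<one>)" for n
    by (simp add: right_diff_distrib \<sigma>_corner)
  ultimately show ?thesis using C by metis
qed

lemma ip_act_one:
  assumes A: "A \<in> W" "Z \<in> W" shows "ip (act \<one> A) Z = ip A Z"
proof (rule ip_cong)
  obtain C where C: "\<And>n. norm (\<sigma> n \<one> - idm (k n)) \<le> C * d n" using \<sigma>_one by blast
  obtain D where D: "\<And>n. norm (A n) \<le> D" using W_bound[OF A(1)] by metis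
  have "norm (norm (act \<one> A n - A n)) \<le> (2 * C * D) * d n" for n
  proof -
    have "norm (act \<one> A n - A n) = norm (\<sigma> n \<one> * A n * adj (\<sigma> n \<one>) - idm (k n) * A n * adj (idm (k n)))"
      using A by (simp add: act_def W_corner)
    also have "\<dots> \<le> 2 * norm (\<sigma> n \<one> - idm (k n)) * norm (A n)"
      using A by (intro norm_conj_diff) (auto intro: \<sigma> W_corner)
    also have "\<dots> \<le> (2 * (C * d n)) * D"
      using C[of n] D[of n] order_trans[OF norm_ge_zero C[of n]] by (intro mult_mono) auto
    finally show ?thesis by (simp add: mult_ac)
  qed
  then show "((\<lambda>n. norm (act \<one> A n - A n)) \<longlongrightarrow> 0) U" by (rule tendsto_0_d)
qed (use assms act_W in auto)

lemma ip_act: "g \<in> carrier G \<Longrightarrow> A \<in> W \<Longrightarrow> B \<in> W \<Longrightarrow> ip (act g A) (act g B) = ip A B"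
  unfolding ip_def by (simp add: act_def cinner_conj[OF \<sigma> W_corner W_corner])

definition \<alpha> :: "'g \<Rightarrow> 'g \<Rightarrow> nat \<Rightarrow> fmat" where
  "\<alpha> g h n = (1 / d n) *\<^sub>R (\<sigma> n g * \<sigma> n h * adj (\<sigma> n (g \<otimes> h)) - idm (k n))"

lemma \<alpha>_eq: "\<sigma> n g * \<sigma> n h * adj (\<sigma> n (g \<otimes> h)) = idm (k n) + d n *\<^sub>R \<alpha> g h n"
  using d(1)[of n] by (simp add: \<alpha>_def)

lemma \<alpha>_corner: "g \<in> carrier G \<Longrightarrow> h \<in> carrier G \<Longrightarrow> corner (k n) (\<alpha> g h n)"
  by (simp add: \<alpha>_def \<sigma>_corner)

lemma \<alpha>_W:
  assumes "g \<in> carrier G" "h \<in> carrier G" shows "\<alpha> g h \<in> W"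
proof -
  obtain C where C: "\<And>n. norm (\<sigma> n g * \<sigma> n h - \<sigma> n (g \<otimes> h)) \<le> C * d n" using defect[OF assms] by blast
  have "norm (\<alpha> g h n) \<le> C" for n
  proof -
    have "norm (\<sigma> n g * \<sigma> n h * adj (\<sigma> n (g \<otimes> h)) - idm (k n)) =
        norm ((\<sigma> n g * \<sigma> n h - \<sigma> n (g \<otimes> h)) * adj (\<sigma> n (g \<otimes> h)))"
      using assms by (simp add: left_diff_distrib unitariesD(3)[OF \<sigma>])
    also have "\<dots> = norm (\<sigma> n g * \<sigma> n h - \<sigma> n (g \<otimes> h))"
      using assms by (intro norm_unitary_mult(2)[of _ "k n"] unitariesD(4) \<sigma>) (auto simp: \<sigma>_corner)
    finally show ?thesis using C[of n] d(1)[of n] unfolding \<alpha>_def norm_scaleR by (simp add: field_simps)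
  qed
  then show ?thesis using assms by (intro WI) (auto simp: \<alpha>_corner)
qed

text \<open>Associativity gives the exact identity \<open>\<sigma>\<^sub>g u(h,l) \<sigma>\<^sub>g\<^sup>* u(g,hl) = u(g,h) u(gh,l)\<close> for
  \<open>u = 1 + d \<alpha>\<close>; its first-order part is the cocycle identity.\<close>

lemma \<alpha>_cocycle:
  assumes g: "g \<in> carrier G" "h \<in> carrier G" "l \<in> carrier G"
  shows "((\<lambda>n. norm (act g (\<alpha> h l) n - \<alpha> (g \<otimes> h) l n + \<alpha> g (h \<otimes> l) n - \<alpha> g h n)) \<longlongrightarrow> 0) U"
proof -
  obtain C1 where C1: "\<And>n. norm (\<alpha> h l n) \<le> C1" using W_bound[OF \<alpha>_W] g by blast
  obtain C2 where C2: "\<And>n. norm (\<alpha> g (h \<otimes> l) n) \<le> C2" using W_bound[OF \<alpha>_W[of g "h \<otimes> l"]] g by auto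
  obtain C3 where C3: "\<And>n. norm (\<alpha> g h n) \<le> C3" using W_bound[OF \<alpha>_W] g by blast
  obtain C4 where C4: "\<And>n. norm (\<alpha> (g \<otimes> h) l n) \<le> C4" using W_bound[OF \<alpha>_W[of "g \<otimes> h" l]] g by auto
  have "norm (norm (act g (\<alpha> h l) n - \<alpha> (g \<otimes> h) l n + \<alpha> g (h \<otimes> l) n - \<alpha> g h n)) \<le> (C3 * C4 + C1 * C2) * d n" for n
  proof -
    define A B C D where "A = act g (\<alpha> h l) n" and "B = \<alpha> g (h \<otimes> l) n" and "C = \<alpha> g h n" and "D = \<alpha> (g \<otimes> h) l n"
    have cor: "corner (k n) A" "corner (k n) B" "corner (k n) C" "corner (k n) D"
      using g by (auto simp: A_def B_def C_def D_def W_corner \<alpha>_corner act_W \<alpha>_W)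
    note un = unitariesD(5,6)[OF \<sigma>]
    have A: "idm (k n) + d n *\<^sub>R A = \<sigma> n g * (\<sigma> n h * \<sigma> n l * adj (\<sigma> n (h \<otimes> l))) * adj (\<sigma> n g)"
      using g unfolding \<alpha>_eq by (simp add: A_def act_def distrib_left distrib_right \<sigma>_corner unitariesD(3)[OF \<sigma>])
    have "(idm (k n) + d n *\<^sub>R A) * (idm (k n) + d n *\<^sub>R B) = (idm (k n) + d n *\<^sub>R C) * (idm (k n) + d n *\<^sub>R D)"
      using g unfolding A unfolding B_def C_def D_def \<alpha>_eq[symmetric]
      by (simp add: mult.assoc un \<sigma>_corner m_assoc)
    then have "d n *\<^sub>R (A - D + B - C) = d n *\<^sub>R (d n *\<^sub>R (C * D - A * B))"
      using cor by (simp add: algebra_simps)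
    then have "A - D + B - C = d n *\<^sub>R (C * D - A * B)"
      using d(1)[of n] by (metis scaleR_left_imp_eq less_irrefl)
    then have "norm (A - D + B - C) = d n * norm (C * D - A * B)" using d(1)[of n] by simp
    also have "norm (C * D - A * B) \<le> norm C * norm D + norm A * norm B"
      by (meson add_mono norm_mult_ineq norm_triangle_ineq4 order_trans)
    also have "norm A = norm (\<alpha> h l n)" unfolding A_def act_def
      using g by (intro norm_conj[of _ "k n"] \<sigma> \<alpha>_corner)
    also have "norm C * norm D + norm (\<alpha> h l n) * norm B \<le> C3 * C4 + C1 * C2"
      using C1[of n] C2[of n] C3[of n] C4[of n] unfolding B_def C_def D_def
      by (intro add_mono mult_mono) (auto intro: order_trans[OF norm_ge_zero])
    finally show ?thesis using d(1)[of n] by (simp add: A_def B_def C_def D_def mult.commute mult_left_mono)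
  qed
  then show ?thesis by (rule tendsto_0_d)
qed

text \<open>The \<open>\<alpha> h l\<close> are listed besides their translates because
  \<open>act \<one>\<close> fixes them only modulo null vectors, while
  \<open>approx_primitive\<close> wants each \<open>\<alpha> h l\<close> to be literally some
  \<open>w n\<close>. Countability of the group makes this set countable.\<close>

definition family :: "(nat \<Rightarrow> fmat) set" where
  "family = (\<lambda>(h, l). \<alpha> h l) ` (carrier G \<times> carrier G)
    \<union> (\<lambda>(g, h, l). act g (\<alpha> h l)) ` (carrier G \<times> carrier G \<times> carrier G)"

text \<open>Repetitions in the enumeration do no harm: Gram-Schmidt turns them into null vectors,
  whose indices lie outside \<open>I\<close>.\<close>

definition w :: "nat \<Rightarrow> nat \<Rightarrow> fmat" where "w = from_nat_into family"

lemma range_w: "range w = family"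
  unfolding w_def
proof (rule range_from_nat_into)
  show "family \<noteq> {}" by (auto simp: family_def)
  show "countable family" unfolding family_def using countable_G by blast
qed

lemma family_ex: "A \<in> family \<Longrightarrow> \<exists>n. w n = A"
  unfolding range_w[symmetric] by auto

lemma \<alpha>_family: "h \<in> carrier G \<Longrightarrow> l \<in> carrier G \<Longrightarrow> \<alpha> h l \<in> family"
  and act_family: "g \<in> carrier G \<Longrightarrow> h \<in> carrier G \<Longrightarrow> l \<in> carrier G \<Longrightarrow> act g (\<alpha> h l) \<in> family"
  unfolding family_def by (blast, force)

sublocale R: semi_inner_rep W "\<lambda>a A n. a \<cdot>\<^sub>C A n" ip w G act
proof
  have "family \<subseteq> W" by (auto simp: family_def \<alpha>_W act_W)
  then show "w n \<in> W" for n using range_w by blast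
  show "\<exists>m. \<forall>z\<in>W. ip (act g (w n)) z = ip (w m) z" if g: "g \<in> carrier G" for g n
  proof -
    have "w n \<in> family" using range_w by blast
    then consider (1) h l where "w n = \<alpha> h l" "h \<in> carrier G" "l \<in> carrier G"
      | (2) g' h l where "w n = act g' (\<alpha> h l)" "g' \<in> carrier G" "h \<in> carrier G" "l \<in> carrier G"
      by (auto simp: family_def)
    then show ?thesis
    proof cases
      case 1
      then show ?thesis using family_ex[OF act_family[OF g 1(2,3)]] by metis
    next
      case 2
      have "g \<otimes> g' \<in> carrier G" using g 2 by simp
      then obtain m where "w m = act (g \<otimes> g') (\<alpha> h l)" using family_ex[OF act_family] 2 by blast
      then show ?thesis using ip_act_mult[OF g 2(2) \<alpha>_W[OF 2(3,4)]] 2(1) by metis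
    qed
  qed
qed (auto simp: act_W ip_act ip_act_mult ip_act_one)

text \<open>Pairing the asymptotic identity \<open>\<alpha>_cocycle\<close> with each
  \<open>gs i\<close> and passing to the limit makes it exact.\<close>

lemma coords_cocycle:
  assumes g: "g \<in> carrier G" "h \<in> carrier G" "l \<in> carrier G"
  shows "R.T g (R.coords (\<alpha> h l)) i - R.coords (\<alpha> (g \<otimes> h) l) i + R.coords (\<alpha> g (h \<otimes> l)) i - R.coords (\<alpha> g h) i = 0"
proof -
  obtain m where "w m = \<alpha> h l" using family_ex[OF \<alpha>_family[OF g(2,3)]] by blast
  then have e: "R.expands (\<alpha> h l) (Suc m)" using R.expands_w[of m] by simp
  have gsW: "R.gs i \<in> W" by (rule R.gs_W)
  have "((\<lambda>n. cinner (act g (\<alpha> h l) n) (R.gs i n) - cinner (\<alpha> (g \<otimes> h) l n) (R.gs i n)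
      + cinner (\<alpha> g (h \<otimes> l) n) (R.gs i n) - cinner (\<alpha> g h n) (R.gs i n))
    \<longlongrightarrow> R.coords (act g (\<alpha> h l)) i - R.coords (\<alpha> (g \<otimes> h) l) i + R.coords (\<alpha> g (h \<otimes> l)) i - R.coords (\<alpha> g h) i) U"
    unfolding R.coords_def using g gsW by (intro tendsto_add tendsto_diff ip_tendsto act_W \<alpha>_W) auto
  moreover have "((\<lambda>n. cinner (act g (\<alpha> h l) n - \<alpha> (g \<otimes> h) l n + \<alpha> g (h \<otimes> l) n - \<alpha> g h n) (R.gs i n)) \<longlongrightarrow> 0) U"
    by (rule cinner_null[OF \<alpha>_cocycle[OF g] gsW])
  moreover have "cinner (A - B + C - D) Z = cinner A Z - cinner B Z + cinner C Z - cinner D Z" for A B C D Z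
    using cinner_add[of "A - B + C - D" D Z] cinner_add[of "A - B" C Z] cinner_add[of "A - B" B Z] by simp
  ultimately have "R.coords (act g (\<alpha> h l)) i - R.coords (\<alpha> (g \<otimes> h) l) i + R.coords (\<alpha> g (h \<otimes> l)) i - R.coords (\<alpha> g h) i = 0"
    by (simp only:) (rule tendsto_unique[OF U_bot])
  then show ?thesis by (simp add: R.T_coords[OF g(1) e])
qed

lemma asymptotic_primitive:
  fixes f :: "nat \<Rightarrow> 'i"
  assumes vanish: "\<And>(J :: 'i set) \<pi>. unitary_rep G J \<pi> \<Longrightarrow> cohom_vanishes G (ell2 J) \<pi> 2"
    and f: "inj f" and "\<delta> > 0"
  shows "\<exists>b. (\<forall>g\<in>carrier G. b g \<in> W) \<and> (\<forall>g\<in>carrier G. \<forall>h\<in>carrier G.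
    eventually (\<lambda>n. norm (\<alpha> g h n - act g (b h) n + b (g \<otimes> h) n - b g n) \<le> \<delta>) U)"
proof -
  have "\<exists>\<beta>. (\<forall>g\<in>carrier G. \<beta> g \<in> ell2 R.I) \<and> (\<forall>g\<in>carrier G. \<forall>h\<in>carrier G.
      R.coords (\<alpha> g h) = (\<lambda>i. R.T g (\<beta> h) i - \<beta> (g \<otimes> h) i + \<beta> g i))"
    by (rule H2_primitive[OF vanish f is_group R.unitary_rep_T R.coords_ell2[OF \<alpha>_W] coords_cocycle])
  then obtain \<beta> where \<beta>: "\<And>g. g \<in> carrier G \<Longrightarrow> \<beta> g \<in> ell2 R.I"
    "\<And>g h. g \<in> carrier G \<Longrightarrow> h \<in> carrier G \<Longrightarrow>
      R.coords (\<alpha> g h) = (\<lambda>i. R.T g (\<beta> h) i - \<beta> (g \<otimes> h) i + \<beta> g i)"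
    by blast
  \<comment> \<open>Half of \<open>\<delta>\<close>, so that the limit of the squared norms lies
    strictly below the square of \<open>\<delta>\<close> and the bound holds eventually along
    \<open>U\<close>.\<close>
  have \<delta>2: "(\<delta> / 2)\<^sup>2 > 0" using \<open>\<delta> > 0\<close> by simp
  have aw: "\<exists>n. \<alpha> g h = w n" if "g \<in> carrier G" "h \<in> carrier G" for g h
    using family_ex[OF \<alpha>_family[OF that]] by metis
  obtain b where b: "\<And>g. g \<in> carrier G \<Longrightarrow> b g \<in> W"
    and D: "\<And>g h D. g \<in> carrier G \<Longrightarrow> h \<in> carrier G \<Longrightarrow>
      D = \<alpha> g h + ((\<lambda>n. (-1) \<cdot>\<^sub>C act g (b h) n) + (b (g \<otimes> h) + (\<lambda>n. (-1) \<cdot>\<^sub>C b g n))) \<Longrightarrow> Re (ip D D) \<le> (\<delta> / 2)\<^sup>2"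
    using R.approx_primitive[OF aw \<beta> \<delta>2] unfolding Let_def by blast
  have "eventually (\<lambda>n. norm (\<alpha> g h n - act g (b h) n + b (g \<otimes> h) n - b g n) \<le> \<delta>) U"
    if gh: "g \<in> carrier G" "h \<in> carrier G" for g h
  proof -
    define Z where "Z = \<alpha> g h + ((\<lambda>n. (-1) \<cdot>\<^sub>C act g (b h) n) + (b (g \<otimes> h) + (\<lambda>n. (-1) \<cdot>\<^sub>C b g n)))"
    have m1: "(-1) \<cdot>\<^sub>C A = - A" for A by (rule fmat_eqI) simp
    have Z: "Z n = \<alpha> g h n - act g (b h) n + b (g \<otimes> h) n - b g n" for n
      unfolding Z_def by (simp add: m1)
    have ZW: "Z \<in> W" unfolding Z_def using gh by (intro W_add W_sc \<alpha>_W act_W b) auto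
    have "((\<lambda>n. Re (cinner (Z n) (Z n))) \<longlongrightarrow> Re (ip Z Z)) U"
      by (intro tendsto_Re ip_tendsto ZW)
    moreover have "Re (ip Z Z) < \<delta>\<^sup>2"
    proof -
      have "Re (ip Z Z) \<le> (\<delta> / 2)\<^sup>2" by (rule D[OF gh Z_def])
      also have "\<dots> < \<delta>\<^sup>2" using \<open>\<delta> > 0\<close> by (intro power_strict_mono) auto
      finally show ?thesis .
    qed
    ultimately have "eventually (\<lambda>n. Re (cinner (Z n) (Z n)) < \<delta>\<^sup>2) U" by (rule order_tendstoD(2))
    then show ?thesis
    proof (rule eventually_mono)
      fix n assume "Re (cinner (Z n) (Z n)) < \<delta>\<^sup>2"
      then have "(norm (Z n))\<^sup>2 < \<delta>\<^sup>2" by (simp add: cinner_self_norm del: of_real_power)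
      then have "norm (Z n) \<le> \<delta>" using \<open>\<delta> > 0\<close> by (simp add: power_less_imp_less_base less_imp_le)
      then show "norm (\<alpha> g h n - act g (b h) n + b (g \<otimes> h) n - b g n) \<le> \<delta>" by (simp add: Z)
    qed
  qed
  then show ?thesis using b by blast
qed

text \<open>The budget is split evenly: \<open>\<delta> / 2\<close> for the inexact primitive, and
  \<open>\<delta> / 2\<close> for the second-order terms, which carry an extra factor
  \<open>d n\<close> and so are eventually small for each fixed pair of group elements.\<close>

theorem defect_reduction:
  fixes f :: "nat \<Rightarrow> 'i"
  assumes vanish: "\<And>(J :: 'i set) \<pi>. unitary_rep G J \<pi> \<Longrightarrow> cohom_vanishes G (ell2 J) \<pi> 2"
    and f: "inj f" and \<delta>: "\<delta> > 0"
  shows "\<exists>\<psi>. (\<forall>n. \<forall>g\<in>carrier G. \<psi> n g \<in> unitaries (k n))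
    \<and> (\<forall>g\<in>carrier G. \<forall>h\<in>carrier G.
        eventually (\<lambda>n. norm (\<psi> n g * \<psi> n h - \<psi> n (g \<otimes> h)) \<le> \<delta> * d n) U)
    \<and> (\<forall>g\<in>carrier G. \<exists>C. eventually (\<lambda>n. norm (\<psi> n g - \<sigma> n g) \<le> C * d n) U)"
proof -
  obtain b where b: "\<And>g. g \<in> carrier G \<Longrightarrow> b g \<in> W"
    and db: "\<And>g h. g \<in> carrier G \<Longrightarrow> h \<in> carrier G \<Longrightarrow>
      eventually (\<lambda>n. norm (\<alpha> g h n - act g (b h) n + b (g \<otimes> h) n - b g n) \<le> \<delta> / 2) U"
    using asymptotic_primitive[OF vanish f, of "\<delta> / 2"] \<delta> by auto
  define sk where "sk A = (1/2) *\<^sub>R (A - adj A)" for A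
  have sk_norm: "norm (sk A) \<le> norm A" for A using norm_triangle_ineq4[of A "adj A"] by (simp add: sk_def)
  have sk_adj: "adj (sk A) = - sk A" for A by (simp add: sk_def algebra_simps)
  have sk_corner: "corner m A \<Longrightarrow> corner m (sk A)" for A m by (simp add: sk_def)
  have "\<exists>v. v \<in> unitaries (k n) \<and> (d n * norm (b g n) \<le> 1 \<longrightarrow>
      norm (v - (idm (k n) - d n *\<^sub>R sk (b g n))) \<le> (d n)\<^sup>2 * (norm (b g n))\<^sup>2)" if g: "g \<in> carrier G" for n g
  proof (cases "d n * norm (b g n) \<le> 1")
    case True
    \<comment> \<open>Half of \<open>d n\<close> times the skew part, because \<open>cayley\<close>
      yields a unitary near 1 - 2 x. The guard on \<open>d n * norm (b g n)\<close> gives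
      \<open>norm x \<le> 1/2\<close>; when it fails, \<open>idm\<close> is a placeholder, and for
      each \<open>g\<close> the guard holds eventually along \<open>U\<close>.\<close>
    define x where "x = (d n / 2) *\<^sub>R sk (b g n)"
    have nx: "norm x \<le> d n / 2 * norm (b g n)" using sk_norm[of "b g n"] d(1)[of n] by (simp add: x_def)
    have "\<exists>v\<in>unitaries (k n). norm (v - (idm (k n) - 2 *\<^sub>R x)) \<le> 4 * (norm x)\<^sup>2"
      using nx True b[OF g] by (intro cayley) (auto simp: x_def sk_adj sk_corner W_corner)
    moreover have "4 * (norm x)\<^sup>2 \<le> (d n)\<^sup>2 * (norm (b g n))\<^sup>2"
      using power_mono[OF nx, of 2] by (simp add: power_mult_distrib power_divide)
    ultimately show ?thesis by (auto simp: x_def intro: order_trans)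
  next
    case False
    then show ?thesis using idm_unitary by blast
  qed
  then have "\<forall>n g. \<exists>v. g \<in> carrier G \<longrightarrow> v \<in> unitaries (k n) \<and> (d n * norm (b g n) \<le> 1 \<longrightarrow>
      norm (v - (idm (k n) - d n *\<^sub>R sk (b g n))) \<le> (d n)\<^sup>2 * (norm (b g n))\<^sup>2)"
    by blast
  then obtain v where v: "\<And>n g. g \<in> carrier G \<Longrightarrow> v n g \<in> unitaries (k n)"
    and vb: "\<And>n g. g \<in> carrier G \<Longrightarrow> d n * norm (b g n) \<le> 1 \<Longrightarrow>
      norm (v n g - (idm (k n) - d n *\<^sub>R sk (b g n))) \<le> (d n)\<^sup>2 * (norm (b g n))\<^sup>2"
    by metis
  have vb': "norm (v n g - (idm (k n) - d n *\<^sub>R sk (b g n))) \<le> (d n)\<^sup>2 * C\<^sup>2"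
    if "g \<in> carrier G" "norm (b g n) \<le> C" "C * d n < 1" for n g C
  proof -
    have "d n * norm (b g n) \<le> d n * C" using that d(1)[of n] by (intro mult_left_mono) auto
    then have "d n * norm (b g n) \<le> 1" using that(3) by (simp add: mult.commute)
    then have "norm (v n g - (idm (k n) - d n *\<^sub>R sk (b g n))) \<le> (d n)\<^sup>2 * (norm (b g n))\<^sup>2" by (rule vb[OF that(1)])
    also have "\<dots> \<le> (d n)\<^sup>2 * C\<^sup>2" using that by (intro mult_left_mono power_mono) auto
    finally show ?thesis .
  qed
  define \<psi> where "\<psi> n g = v n g * \<sigma> n g" for n g
  have \<psi>: "\<psi> n g \<in> unitaries (k n)" if "g \<in> carrier G" for n g
    using that by (simp add: \<psi>_def unitary_mult v \<sigma>)
  have small: "eventually (\<lambda>n. C * d n < e) U" if "e > 0" for C e :: real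
    using d_tendsto that by (rule order_tendstoD(2))
  have "eventually (\<lambda>n. norm (\<psi> n g * \<psi> n h - \<psi> n (g \<otimes> h)) \<le> \<delta> * d n) U"
    if gh: "g \<in> carrier G" "h \<in> carrier G" for g h
  proof -
    have ghc: "g \<otimes> h \<in> carrier G" using gh by simp
    obtain C1 C2 C3 C4 where C: "\<And>n. norm (b g n) \<le> C1" "\<And>n. norm (b h n) \<le> C2"
        "\<And>n. norm (b (g \<otimes> h) n) \<le> C3" "\<And>n. norm (\<alpha> g h n) \<le> C4"
      using W_bound[OF b[OF gh(1)]] W_bound[OF b[OF gh(2)]] W_bound[OF b[OF ghc]] W_bound[OF \<alpha>_W[OF gh]] by metis
    define C where "C = max (max C1 C2) (max C3 C4)"
    have CC: "norm (b g n) \<le> C" "norm (b h n) \<le> C" "norm (b (g \<otimes> h) n) \<le> C" "norm (\<alpha> g h n) \<le> C" for n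
      using C[of n] by (auto simp: C_def)
    \<comment> \<open>The second-order constant of \<open>corrected_defect\<close>; passing to skew
      parts adds the square of \<open>C\<close>, and both carry the factor
      \<open>d n\<close>.\<close>
    define K where "K = 3 * C\<^sup>2 + 3 * (C + C\<^sup>2)\<^sup>2 + (C + C\<^sup>2) ^ 3"
    have "eventually (\<lambda>n. C * d n < 1) U" "eventually (\<lambda>n. (C\<^sup>2 + K) * d n < \<delta> / 2) U"
      using \<delta> by (intro small; simp)+
    with db[OF gh] show ?thesis
    proof eventually_elim
      case (elim n)
      have "norm (v n g * \<sigma> n g * (v n h * \<sigma> n h) - v n (g \<otimes> h) * \<sigma> n (g \<otimes> h)) \<le>
          d n * (norm (\<alpha> g h n - \<sigma> n g * sk (b h n) * adj (\<sigma> n g) + sk (b (g \<otimes> h) n) - sk (b g n)) + d n * K)"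
        unfolding K_def using gh ghc elim CC[of n] d
        by (intro corrected_defect[where k = "k n"] \<sigma> \<alpha>_corner \<alpha>_eq v vb' sk_corner W_corner b order_trans[OF sk_norm]) auto
      also have "norm (\<alpha> g h n - \<sigma> n g * sk (b h n) * adj (\<sigma> n g) + sk (b (g \<otimes> h) n) - sk (b g n))
          \<le> norm (\<alpha> g h n - \<sigma> n g * b h n * adj (\<sigma> n g) + b (g \<otimes> h) n - b g n) + d n * C\<^sup>2"
        unfolding sk_def
      proof (rule skew_part_defect)
        show "idm (k n) + d n *\<^sub>R \<alpha> g h n \<in> unitaries (k n)"
          unfolding \<alpha>_eq[symmetric] using gh ghc by (intro unitary_mult unitariesD(4) \<sigma>)
      qed (use gh d CC in \<open>auto simp: \<sigma> \<alpha>_corner\<close>)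
      also have "norm (\<alpha> g h n - \<sigma> n g * b h n * adj (\<sigma> n g) + b (g \<otimes> h) n - b g n) \<le> \<delta> / 2"
        using elim by (simp add: act_def)
      also have "d n * (\<delta> / 2 + d n * C\<^sup>2 + d n * K) \<le> d n * \<delta>"
        using elim d(1)[of n] by (intro mult_left_mono) (auto simp: algebra_simps)
      finally show ?case using d(1)[of n] by (simp add: \<psi>_def mult.commute)
    qed
  qed
  moreover have "\<exists>C. eventually (\<lambda>n. norm (\<psi> n g - \<sigma> n g) \<le> C * d n) U" if g: "g \<in> carrier G" for g
  proof -
    obtain C where C: "\<And>n. norm (b g n) \<le> C" using W_bound[OF b[OF g]] by blast
    have C0: "0 \<le> C" using order_trans[OF norm_ge_zero C] .
    have "eventually (\<lambda>n. C * d n < 1) U" by (intro small) simp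
    then have "eventually (\<lambda>n. norm (\<psi> n g - \<sigma> n g) \<le> (C + C\<^sup>2) * d n) U"
    proof eventually_elim
      case (elim n)
      have "norm (\<psi> n g - \<sigma> n g) = norm ((v n g - idm (k n)) * \<sigma> n g)"
        using g by (simp add: \<psi>_def left_diff_distrib \<sigma>_corner)
      also have "\<dots> = norm (v n g - idm (k n))"
        using g by (intro norm_unitary_mult(2)[of _ "k n"] \<sigma>) (auto simp: unitariesD(1)[OF v])
      also have "\<dots> = norm ((v n g - (idm (k n) - d n *\<^sub>R sk (b g n))) - d n *\<^sub>R sk (b g n))" by simp
      also have "\<dots> \<le> norm (v n g - (idm (k n) - d n *\<^sub>R sk (b g n))) + norm (d n *\<^sub>R sk (b g n))"
        by (rule norm_triangle_ineq4)
      also have "\<dots> \<le> (d n)\<^sup>2 * C\<^sup>2 + d n * C"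
        using vb'[OF g C elim] order_trans[OF sk_norm C] d(1)[of n] by (intro add_mono) auto
      also have "(d n)\<^sup>2 * C\<^sup>2 \<le> d n * C\<^sup>2"
        using d(1,2)[of n] by (intro mult_right_mono) (auto simp: power2_eq_square mult_left_le_one_le)
      finally show ?case by (simp add: algebra_simps)
    qed
    then show ?thesis ..
  qed
  ultimately show ?thesis using \<psi> by blast
qed

end

section \<open>Presented groups\<close>

fun letter :: "('s \<Rightarrow> fmat) \<Rightarrow> 's \<times> bool \<Rightarrow> fmat" where
  "letter \<phi> (s, b) = (if b then \<phi> s else adj (\<phi> s))"

definition ev :: "nat \<Rightarrow> ('s \<Rightarrow> fmat) \<Rightarrow> ('s \<times> bool) list \<Rightarrow> fmat" where
  "ev k \<phi> w = foldr (\<lambda>x M. letter \<phi> x * M) w (idm k)"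

lemma ev_simps [simp]: "ev k \<phi> [] = idm k" "ev k \<phi> (x # w) = letter \<phi> x * ev k \<phi> w"
  by (simp_all add: ev_def)

definition wdefect :: "('s \<times> bool) list set \<Rightarrow> nat \<Rightarrow> ('s \<Rightarrow> fmat) \<Rightarrow> real" where
  "wdefect R k \<phi> = Max (insert 0 ((\<lambda>r. norm (ev k \<phi> r - idm k)) ` R))"

lemma wdefect_le_iff: "finite R \<Longrightarrow> wdefect R k \<phi> \<le> c \<longleftrightarrow> 0 \<le> c \<and> (\<forall>r\<in>R. norm (ev k \<phi> r - idm k) \<le> c)"
  by (simp add: wdefect_def)

lemma wdefect_nonneg: "finite R \<Longrightarrow> 0 \<le> wdefect R k \<phi>"
  and wdefect_ge: "finite R \<Longrightarrow> r \<in> R \<Longrightarrow> norm (ev k \<phi> r - idm k) \<le> wdefect R k \<phi>"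
  using wdefect_le_iff[of R k \<phi> "wdefect R k \<phi>"] by auto

lemma word_on_simps [simp]:
  "word_on S []" "word_on S (x # w) \<longleftrightarrow> fst x \<in> S \<and> word_on S w"
  "word_on S (u @ v) \<longleftrightarrow> word_on S u \<and> word_on S v"
  by (auto simp: word_on_def mem_Times_iff)

lemma letter_unitary:
  "\<forall>s\<in>S. \<phi> s \<in> unitaries k \<Longrightarrow> fst x \<in> S \<Longrightarrow> letter \<phi> x \<in> unitaries k"
  by (cases x) (auto intro: unitariesD)

lemma ev_unitary: "\<forall>s\<in>S. \<phi> s \<in> unitaries k \<Longrightarrow> word_on S w \<Longrightarrow> ev k \<phi> w \<in> unitaries k"
  by (induction w) (auto intro: unitary_mult letter_unitary)

lemma ev_append:
  "\<forall>s\<in>S. \<phi> s \<in> unitaries k \<Longrightarrow> word_on S v \<Longrightarrow> ev k \<phi> (u @ v) = ev k \<phi> u * ev k \<phi> v"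
  by (induction u) (auto simp: mult.assoc unitariesD(1)[OF ev_unitary])

lemma letter_cancel:
  "\<phi> s \<in> unitaries k \<Longrightarrow> letter \<phi> (s, b) * letter \<phi> (s, \<not> b) = idm k"
  by (auto simp: unitariesD)

context
  fixes S :: "'s set" and R :: "('s \<times> bool) list set"
  assumes S: "finite S" and R: "finite R" "\<forall>r\<in>R. word_on S r"
begin

lemma pres_eq_word_on: "pres_eq S R u v \<Longrightarrow> word_on S u \<and> word_on S v"
  by (induction rule: pres_eq.induct) (use R in auto)

text \<open>\<open>C\<close> counts the relator steps of a derivation: a cancellation is free for
  unitaries, and a relator step costs one defect by unitary invariance. Hence \<open>C\<close> is
  independent of the dimension and of \<open>\<phi>\<close>. For defect 0 this says that
  \<open>\<phi>\<close> factors through the group.\<close>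

lemma ev_pres_eq: "pres_eq S R u v \<Longrightarrow>
  \<exists>C. \<forall>k \<phi>. (\<forall>s\<in>S. \<phi> s \<in> unitaries k) \<longrightarrow> norm (ev k \<phi> u - ev k \<phi> v) \<le> C * wdefect R k \<phi>"
proof (induction rule: pres_eq.induct)
  case (refl w)
  show ?case by (rule exI[of _ 0]) simp
next
  case (sym u v)
  then show ?case by (simp add: norm_minus_commute)
next
  case (trans u v w)
  then obtain C D where C: "\<And>k \<phi>. \<forall>s\<in>S. \<phi> s \<in> unitaries k \<Longrightarrow> norm (ev k \<phi> u - ev k \<phi> v) \<le> C * wdefect R k \<phi>"
    and D: "\<And>k \<phi>. \<forall>s\<in>S. \<phi> s \<in> unitaries k \<Longrightarrow> norm (ev k \<phi> v - ev k \<phi> w) \<le> D * wdefect R k \<phi>"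
    by blast
  have "norm (ev k \<phi> u - ev k \<phi> w) \<le> (C + D) * wdefect R k \<phi>" if "\<forall>s\<in>S. \<phi> s \<in> unitaries k" for k \<phi>
    using norm_diff_triangle_le[OF C[OF that] D[OF that]] by (simp add: distrib_right)
  then show ?case by blast
next
  case (cancel u v s b)
  have "ev k \<phi> (u @ [(s, b), (s, \<not> b)] @ v) = ev k \<phi> (u @ v)" if \<phi>: "\<forall>s\<in>S. \<phi> s \<in> unitaries k" for k \<phi>
  proof -
    have "ev k \<phi> (u @ [(s, b), (s, \<not> b)] @ v) = ev k \<phi> u * (letter \<phi> (s, b) * letter \<phi> (s, \<not> b) * ev k \<phi> v)"
      using cancel \<phi> by (subst ev_append[of S]) (simp_all add: mult.assoc del: letter.simps)
    also have "\<dots> = ev k \<phi> u * ev k \<phi> v"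
      using letter_cancel[of \<phi> s k b] cancel \<phi> by (simp add: unitariesD(1)[OF ev_unitary[OF \<phi>]])
    finally show ?thesis using cancel \<phi> by (simp add: ev_append[of S])
  qed
  then show ?case by (intro exI[of _ 0]) simp
next
  case (relator u v r)
  have "norm (ev k \<phi> (u @ r @ v) - ev k \<phi> (u @ v)) \<le> 1 * wdefect R k \<phi>"
    if \<phi>: "\<forall>s\<in>S. \<phi> s \<in> unitaries k" for k \<phi>
  proof -
    have r: "word_on S r" using relator R by blast
    have un: "ev k \<phi> u \<in> unitaries k" "ev k \<phi> v \<in> unitaries k" "ev k \<phi> r \<in> unitaries k"
      using relator r ev_unitary[OF \<phi>] by auto
    have "ev k \<phi> (u @ r @ v) - ev k \<phi> (u @ v) = ev k \<phi> u * ((ev k \<phi> r - idm k) * ev k \<phi> v)"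
      using relator r \<phi> un by (simp add: ev_append[of S] algebra_simps unitariesD(1))
    then have "norm (ev k \<phi> (u @ r @ v) - ev k \<phi> (u @ v)) = norm (ev k \<phi> r - idm k)"
      using un by (simp add: norm_unitary_mult[of _ k] unitariesD(1))
    then show ?thesis using wdefect_ge[OF R(1) relator(3)] by simp
  qed
  then show ?case by blast
qed

lemma pres_eq_prepend: "pres_eq S R u v \<Longrightarrow> word_on S w \<Longrightarrow> pres_eq S R (w @ u) (w @ v)"
proof (induction rule: pres_eq.induct)
  case (cancel u v s b)
  then show ?case using pres_eq.cancel[of S "w @ u" v s R b] by simp
next
  case (relator u v r)
  then show ?case using pres_eq.relator[of S "w @ u" v r R] by simp
qed (auto intro: pres_eq.refl pres_eq.sym pres_eq.trans)

lemma pres_eq_append: "pres_eq S R u v \<Longrightarrow> word_on S w \<Longrightarrow> pres_eq S R (u @ w) (v @ w)"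
proof (induction rule: pres_eq.induct)
  case (cancel u v s b)
  then show ?case using pres_eq.cancel[of S u "v @ w" s R b] by simp
next
  case (relator u v r)
  then show ?case using pres_eq.relator[of S u "v @ w" r R] by simp
qed (auto intro: pres_eq.refl pres_eq.sym pres_eq.trans)

lemma pclass_eq_iff: "word_on S u \<Longrightarrow> pclass S R u = pclass S R v \<longleftrightarrow> pres_eq S R u v"
  unfolding pclass_def using pres_eq.refl pres_eq.sym pres_eq.trans by (metis (no_types, lifting) Collect_cong mem_Collect_eq)

lemma carrier_pgroup: "carrier (pgroup S R) = pclass S R ` {w. word_on S w}"
  and one_pgroup: "one (pgroup S R) = pclass S R []"
  by (simp_all add: pgroup_def)

lemma mult_pgroup:
  assumes "word_on S u" "word_on S v"
  shows "pclass S R u \<otimes>\<^bsub>pgroup S R\<^esub> pclass S R v = pclass S R (u @ v)"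
proof -
  have "pclass S R (a @ b) = pclass S R (u @ v)" if "pres_eq S R u a" "pres_eq S R v b" for a b
  proof -
    have "word_on S a" "word_on S b" using that pres_eq_word_on by auto
    then have "pres_eq S R (u @ v) (a @ b)"
      using pres_eq.trans[OF pres_eq_append[OF that(1) assms(2)] pres_eq_prepend[OF that(2)]] by blast
    then show ?thesis using pclass_eq_iff[of "u @ v" "a @ b"] assms by simp
  qed
  moreover have "u \<in> pclass S R u" "v \<in> pclass S R v" using assms by (simp_all add: pclass_def pres_eq.refl)
  moreover have "pclass S R u \<otimes>\<^bsub>pgroup S R\<^esub> pclass S R v =
      (\<Union>a\<in>pclass S R u. \<Union>b\<in>pclass S R v. pclass S R (a @ b))" by (simp add: pgroup_def)
  moreover have "a \<in> pclass S R w \<longleftrightarrow> pres_eq S R w a" for a w by (simp add: pclass_def)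
  ultimately show ?thesis by blast
qed

lemma inverse_word: "word_on S w \<Longrightarrow> \<exists>v. word_on S v \<and> pres_eq S R (v @ w) []"
proof (induction w)
  case Nil
  show ?case by (rule exI[of _ "[]"]) (simp add: pres_eq.refl)
next
  case (Cons x w)
  then obtain v where v: "word_on S v" "pres_eq S R (v @ w) []" by auto
  obtain s b where x: "x = (s, b)" by (cases x)
  have "pres_eq S R (v @ [(s, \<not> b), (s, \<not> \<not> b)] @ w) (v @ w)"
    using Cons.prems v x by (intro pres_eq.cancel) auto
  then have "pres_eq S R ((v @ [(s, \<not> b)]) @ x # w) []" using v(2) x pres_eq.trans by fastforce
  then show ?case using v x Cons.prems by (intro exI[of _ "v @ [(s, \<not> b)]"]) auto
qed

lemma group_pgroup: "group (pgroup S R)"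
proof (rule groupI)
  fix x assume "x \<in> carrier (pgroup S R)"
  then obtain w where w: "x = pclass S R w" "word_on S w" by (auto simp: carrier_pgroup)
  obtain v where v: "word_on S v" "pres_eq S R (v @ w) []" using inverse_word w by blast
  then have "pclass S R v \<otimes>\<^bsub>pgroup S R\<^esub> x = one (pgroup S R)"
    using w by (simp add: mult_pgroup one_pgroup pclass_eq_iff)
  then show "\<exists>y\<in>carrier (pgroup S R). y \<otimes>\<^bsub>pgroup S R\<^esub> x = one (pgroup S R)"
    using v by (auto simp: carrier_pgroup)
qed (auto simp: carrier_pgroup one_pgroup mult_pgroup)

lemma countable_pgroup: "countable (carrier (pgroup S R))"
proof -
  have "countable (S \<times> (UNIV :: bool set))" using S by (intro countable_finite finite_SigmaI) auto
  then have "countable (lists (S \<times> (UNIV :: bool set)))" by (rule countable_lists)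
  moreover have "{w. word_on S w} = lists (S \<times> UNIV)" by (auto simp: word_on_def lists_eq_set)
  ultimately show ?thesis by (simp add: carrier_pgroup)
qed

definition rep :: "('s \<times> bool) list set \<Rightarrow> ('s \<times> bool) list" where
  "rep A = (SOME w. word_on S w \<and> pclass S R w = A)"

lemma rep: "A \<in> carrier (pgroup S R) \<Longrightarrow> word_on S (rep A) \<and> pclass S R (rep A) = A"
  unfolding rep_def by (rule someI_ex) (auto simp: carrier_pgroup)

text \<open>Each letter costs 3: at most 2 to replace it by \<open>\<psi>\<close> of its class and 1
  to multiply it on; the empty word costs 1. Only inverse letters need the 2: multiplying
  \<open>adj p - q\<close> by \<open>p\<close> leaves the defect of the pair plus the error at the
  identity.\<close>

lemma word_estimate:
  fixes \<psi> :: "nat \<Rightarrow> ('s \<times> bool) list set \<Rightarrow> fmat" and d :: "nat \<Rightarrow> real"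
  assumes \<psi>: "\<And>n g. g \<in> carrier (pgroup S R) \<Longrightarrow> \<psi> n g \<in> unitaries (k n)"
    and E: "\<And>g h. g \<in> carrier (pgroup S R) \<Longrightarrow> h \<in> carrier (pgroup S R) \<Longrightarrow>
      eventually (\<lambda>n. norm (\<psi> n g * \<psi> n h - \<psi> n (g \<otimes>\<^bsub>pgroup S R\<^esub> h)) \<le> d n) U"
  defines "\<xi> \<equiv> \<lambda>n s. \<psi> n (pclass S R [(s, True)])"
  shows "word_on S w \<Longrightarrow> eventually (\<lambda>n. norm (ev (k n) (\<xi> n) w - \<psi> n (pclass S R w)) \<le> (3 * length w + 1) * d n) U"
    and "eventually (\<lambda>n. norm (\<psi> n (pclass S R []) - idm (k n)) \<le> d n) U"
proof -
  interpret group "pgroup S R" by (rule group_pgroup)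
  have car: "word_on S u \<Longrightarrow> pclass S R u \<in> carrier (pgroup S R)" for u by (simp add: pgroup_def)
  have cor: "g \<in> carrier (pgroup S R) \<Longrightarrow> corner (k n) (\<psi> n g)" for n g using \<psi> unitariesD(1) by blast
  show one: "eventually (\<lambda>n. norm (\<psi> n (pclass S R []) - idm (k n)) \<le> d n) U"
    using E[OF car[of "[]"] car[of "[]"]]
  proof (rule eventually_mono)
    fix n
    have "norm (\<psi> n (pclass S R []) - idm (k n)) = norm (\<psi> n (pclass S R []) * (\<psi> n (pclass S R []) - idm (k n)))"
      by (intro norm_unitary_mult(1)[of _ "k n", symmetric] \<psi> car) (auto simp: cor car)
    moreover assume "norm (\<psi> n (pclass S R []) * \<psi> n (pclass S R []) - \<psi> n (pclass S R [] \<otimes>\<^bsub>pgroup S R\<^esub> pclass S R [])) \<le> d n"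
    ultimately show "norm (\<psi> n (pclass S R []) - idm (k n)) \<le> d n"
      by (simp add: mult_pgroup right_diff_distrib cor car)
  qed simp_all
  have \<xi>: "\<forall>s\<in>S. \<xi> n s \<in> unitaries (k n)" for n by (auto simp: \<xi>_def intro!: \<psi> car)
  have letter: "eventually (\<lambda>n. norm (letter (\<xi> n) x - \<psi> n (pclass S R [x])) \<le> 2 * d n) U" if "fst x \<in> S" for x
  proof -
    obtain s b where x: "x = (s, b)" by (cases x)
    then have s: "s \<in> S" using that by simp
    have ws: "word_on S [(s, c)]" for c using s by simp
    show ?thesis
    proof (cases b)
      case True
      \<comment> \<open>For a positive letter the difference is 0; \<open>one\<close> serves only to
        show that \<open>d n\<close> is eventually nonnegative.\<close>
      show ?thesis using one
      proof (rule eventually_mono)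
        fix n assume "norm (\<psi> n (pclass S R []) - idm (k n)) \<le> d n"
        then have "0 \<le> d n" using norm_ge_zero order_trans by blast
        then show "norm (letter (\<xi> n) x - \<psi> n (pclass S R [x])) \<le> 2 * d n" using True x by (simp add: \<xi>_def)
      qed
    next
      case False
      have "pclass S R [(s, True)] \<otimes>\<^bsub>pgroup S R\<^esub> pclass S R [(s, False)] = pclass S R []"
        using s pres_eq.cancel[of S "[]" "[]" s R True] by (simp add: mult_pgroup pclass_eq_iff)
      then have "eventually (\<lambda>n. norm (\<psi> n (pclass S R [(s, True)]) * \<psi> n (pclass S R [(s, False)]) - \<psi> n (pclass S R [])) \<le> d n) U"
        using E[OF car[OF ws[of True]] car[OF ws[of False]]] by simp
      with one show ?thesis
      proof eventually_elim
        case (elim n)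
        define p q where "p = \<psi> n (pclass S R [(s, True)])" and "q = \<psi> n (pclass S R [(s, False)])"
        have p: "p \<in> unitaries (k n)" and q: "q \<in> unitaries (k n)" unfolding p_def q_def by (intro \<psi> car ws)+
        have "norm (adj p - q) = norm (p * (adj p - q))"
          using p q by (intro norm_unitary_mult(1)[of _ "k n", symmetric]) (auto simp: unitariesD(1))
        also have "p * (adj p - q) = (idm (k n) - \<psi> n (pclass S R [])) - (p * q - \<psi> n (pclass S R []))"
          using p by (simp add: right_diff_distrib unitariesD)
        also have "norm \<dots> \<le> d n + d n"
          unfolding p_def q_def
          by (rule order_trans[OF norm_triangle_ineq4 add_mono[OF _ elim(2)]])
            (use elim(1) in \<open>simp add: norm_minus_commute\<close>)
        finally show ?case using False x by (simp add: \<xi>_def p_def q_def)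
      qed
    qed
  qed
  show "word_on S w \<Longrightarrow> eventually (\<lambda>n. norm (ev (k n) (\<xi> n) w - \<psi> n (pclass S R w)) \<le> (3 * length w + 1) * d n) U"
  proof (induction w)
    case Nil
    show ?case using one by (simp add: norm_minus_commute)
  next
    case (Cons x w)
    then have x: "fst x \<in> S" and w: "word_on S w" by auto
    have "eventually (\<lambda>n. norm (\<psi> n (pclass S R [x]) * \<psi> n (pclass S R w) - \<psi> n (pclass S R (x # w))) \<le> d n) U"
      using E[of "pclass S R [x]" "pclass S R w"] x w by (simp add: car mult_pgroup)
    with letter[OF x] Cons.IH[OF w] show ?case
    proof eventually_elim
      case (elim n)
      define l e p q where "l = letter (\<xi> n) x" and "e = ev (k n) (\<xi> n) w"
        and "p = \<psi> n (pclass S R [x])" and "q = \<psi> n (pclass S R w)"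
      have un: "l \<in> unitaries (k n)" "e \<in> unitaries (k n)" "p \<in> unitaries (k n)" "q \<in> unitaries (k n)"
        using x w unfolding l_def e_def p_def q_def
        by (auto intro!: letter_unitary[OF \<xi>] ev_unitary[OF \<xi>] \<psi> car)
      have "l * e - \<psi> n (pclass S R (x # w)) = (l - p) * e + p * (e - q) + (p * q - \<psi> n (pclass S R (x # w)))"
        by (simp add: algebra_simps)
      also have "norm \<dots> \<le> norm ((l - p) * e) + norm (p * (e - q)) + norm (p * q - \<psi> n (pclass S R (x # w)))"
        by (meson add_mono norm_triangle_ineq norm_triangle_le order_refl)
      also have "norm ((l - p) * e) = norm (l - p)"
        using un by (intro norm_unitary_mult(2)[of _ "k n"]) (auto simp: unitariesD(1))
      also have "norm (p * (e - q)) = norm (e - q)"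
        using un by (intro norm_unitary_mult(1)[of _ "k n"]) (auto simp: unitariesD(1))
      also have "norm (l - p) + norm (e - q) + norm (p * q - \<psi> n (pclass S R (x # w)))
          \<le> 2 * d n + (3 * length w + 1) * d n + d n"
        using elim unfolding l_def e_def p_def q_def by (intro add_mono)
      finally show ?case by (simp add: l_def e_def algebra_simps)
    qed
  qed
qed

end

section \<open>Uniform halving of the defect\<close>

lemma nonprincipal_le_sequentially:
  assumes "nonprincipal_ultrafilter U" shows "U \<le> sequentially"
proof -
  have "eventually (\<lambda>n. N \<le> n) U" for N
  proof (induction N)
    case (Suc N)
    moreover have "eventually (\<lambda>n. n \<noteq> N) U" using assms by (simp add: nonprincipal_ultrafilter_def)
    ultimately show ?case by eventually_elim simp
  qed simp
  then show ?thesis unfolding le_filter_def eventually_sequentially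
    by (metis (mono_tags, lifting) eventually_mono)
qed

text \<open>If no uniform constant \<open>N\<close> worked, the counterexamples for \<open>N = 0, 1, 2, \<dots>\<close> would form an
  asymptotic homomorphism to which the reduction along the ultrafilter applies.\<close>

lemma uniform_improvement:
  fixes S :: "'s set" and R :: "('s \<times> bool) list set" and f :: "nat \<Rightarrow> 'i"
  assumes S: "finite S" and R: "finite R" "\<forall>r\<in>R. word_on S r"
    and U: "nonprincipal_ultrafilter U" and f: "inj f"
    and vanish: "\<And>(J :: 'i set) \<pi>. unitary_rep (pgroup S R) J \<pi> \<Longrightarrow> cohom_vanishes (pgroup S R) (ell2 J) \<pi> 2"
  shows "\<exists>N::nat. \<forall>k \<phi>. (\<forall>s\<in>S. \<phi> s \<in> unitaries k) \<and> wdefect R k \<phi> < 1 / Suc N \<longrightarrow>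
    (\<exists>\<psi>. (\<forall>s\<in>S. \<psi> s \<in> unitaries k) \<and> wdefect R k \<psi> \<le> wdefect R k \<phi> / 2 \<and>
      (\<forall>s\<in>S. norm (\<psi> s - \<phi> s) \<le> N * wdefect R k \<phi>))"
proof (rule ccontr)
  note SR = S R(1) R(2)
  assume "\<not> ?thesis"
  then obtain k :: "nat \<Rightarrow> nat" and \<phi> where \<phi>: "\<And>n. \<forall>s\<in>S. \<phi> n s \<in> unitaries (k n)"
    and small: "\<And>n. wdefect R (k n) (\<phi> n) < 1 / Suc n"
    and no: "\<And>n \<psi>. \<forall>s\<in>S. \<psi> s \<in> unitaries (k n) \<Longrightarrow> wdefect R (k n) \<psi> \<le> wdefect R (k n) (\<phi> n) / 2 \<Longrightarrow>
      \<forall>s\<in>S. norm (\<psi> s - \<phi> n s) \<le> n * wdefect R (k n) (\<phi> n) \<Longrightarrow> False"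
    by metis
  define d where "d n = wdefect R (k n) (\<phi> n)" for n
  \<comment> \<open>At defect 0 the map \<open>\<phi> n\<close> would be its own improvement at
    distance 0, contradicting \<open>no\<close>.\<close>
  have d0: "0 < d n" for n
  proof (rule ccontr)
    assume "\<not> 0 < d n"
    then have "d n = 0" using wdefect_nonneg[OF R(1), of "k n" "\<phi> n"] by (simp add: d_def)
    then show False using no[OF \<phi>[of n]] by (simp add: d_def)
  qed
  have d1: "d n \<le> 1" for n using less_le_trans[OF small[of n], of 1] by (simp add: d_def)
  have "d \<longlonglongrightarrow> 0"
    using small d0 by (intro real_tendsto_sandwich[OF _ _ tendsto_const LIMSEQ_inverse_real_of_nat])
      (auto intro!: always_eventually less_imp_le simp: d_def inverse_eq_divide)
  then have dU: "(d \<longlongrightarrow> 0) U" using nonprincipal_le_sequentially[OF U] by (rule tendsto_mono[rotated])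
  interpret G: group "pgroup S R" by (rule group_pgroup[OF SR])
  define \<sigma> where "\<sigma> n g = ev (k n) (\<phi> n) (rep S R g)" for n g
  note rep = rep[OF SR]
  have ev_eq: "\<exists>C. \<forall>n. norm (ev (k n) (\<phi> n) u - ev (k n) (\<phi> n) v) \<le> C * d n" if "pres_eq S R u v" for u v
    using ev_pres_eq[OF SR that] \<phi> unfolding d_def by blast
  interpret asymp_hom "pgroup S R" U k \<sigma> d
  proof
    show "\<sigma> n g \<in> unitaries (k n)" if "g \<in> carrier (pgroup S R)" for n g
      unfolding \<sigma>_def using rep[OF that] by (intro ev_unitary[OF \<phi>]) auto
    show "\<exists>C. \<forall>n. norm (\<sigma> n g * \<sigma> n h - \<sigma> n (g \<otimes>\<^bsub>pgroup S R\<^esub> h)) \<le> C * d n"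
      if gh: "g \<in> carrier (pgroup S R)" "h \<in> carrier (pgroup S R)" for g h
    proof -
      have w: "word_on S (rep S R g)" "word_on S (rep S R h)" using rep gh by auto
      have "pclass S R (rep S R g @ rep S R h) = g \<otimes>\<^bsub>pgroup S R\<^esub> h"
        using mult_pgroup[OF SR w] rep gh by simp
      also have "\<dots> = pclass S R (rep S R (g \<otimes>\<^bsub>pgroup S R\<^esub> h))" using rep[of "g \<otimes>\<^bsub>pgroup S R\<^esub> h"] gh by simp
      finally have "pres_eq S R (rep S R g @ rep S R h) (rep S R (g \<otimes>\<^bsub>pgroup S R\<^esub> h))"
        using w by (simp add: pclass_eq_iff[OF SR])
      from ev_eq[OF this] show ?thesis using w by (simp add: \<sigma>_def ev_append[OF \<phi>])
    qed
  qed (use U d0 d1 dU countable_pgroup[OF SR] in auto)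
  define L where "L = Max (insert 0 (length ` R))"
  have L: "length r \<le> L" if "r \<in> R" for r using R(1) that by (auto simp: L_def)
  \<comment> \<open>By \<open>word_estimate\<close>, a relator costs
    \<open>3 * length r + 1\<close>, and comparing the class of the empty word with
    \<open>idm\<close> costs 1 more; with this \<open>\<delta>\<close> the total factor 3 L + 2
    becomes 1/2.\<close>
  define \<delta> where "\<delta> = 1 / (2 * (3 * real L + 2))"
  have \<delta>: "\<delta> > 0" by (auto simp: \<delta>_def intro: divide_pos_pos)
  obtain \<psi> where \<psi>: "\<And>n g. g \<in> carrier (pgroup S R) \<Longrightarrow> \<psi> n g \<in> unitaries (k n)"
    and E: "\<And>g h. g \<in> carrier (pgroup S R) \<Longrightarrow> h \<in> carrier (pgroup S R) \<Longrightarrow>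
      eventually (\<lambda>n. norm (\<psi> n g * \<psi> n h - \<psi> n (g \<otimes>\<^bsub>pgroup S R\<^esub> h)) \<le> \<delta> * d n) U"
    and near: "\<And>g. g \<in> carrier (pgroup S R) \<Longrightarrow> \<exists>C. eventually (\<lambda>n. norm (\<psi> n g - \<sigma> n g) \<le> C * d n) U"
    using defect_reduction[OF vanish f \<delta>] by blast
  define \<xi> where "\<xi> = (\<lambda>n s. \<psi> n (pclass S R [(s, True)]))"
  have car: "word_on S u \<Longrightarrow> pclass S R u \<in> carrier (pgroup S R)" for u by (simp add: pgroup_def)
  have "eventually (\<lambda>n. \<forall>r\<in>R. norm (ev (k n) (\<xi> n) r - idm (k n)) \<le> d n / 2) U"
    using R(1)
  proof (rule eventually_ball_finite, safe)
    fix r assume r: "r \<in> R"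
    then have wr: "word_on S r" using R by blast
    have "pres_eq S R r []" using pres_eq.relator[of S "[]" "[]" r R] r by simp
    then have r1: "pclass S R r = pclass S R []" using wr by (simp add: pclass_eq_iff[OF SR])
    have "eventually (\<lambda>n. norm (ev (k n) (\<xi> n) r - \<psi> n (pclass S R r)) \<le> real (3 * length r + 1) * (\<delta> * d n)) U"
      unfolding \<xi>_def by (rule word_estimate(1)[OF SR \<psi> E wr])
    moreover have "eventually (\<lambda>n. norm (\<psi> n (pclass S R []) - idm (k n)) \<le> \<delta> * d n) U"
      by (rule word_estimate(2)[OF SR \<psi> E])
    ultimately show "eventually (\<lambda>n. norm (ev (k n) (\<xi> n) r - idm (k n)) \<le> d n / 2) U"
      unfolding r1
    proof eventually_elim
      case (elim n)
      have "norm (ev (k n) (\<xi> n) r - idm (k n)) \<le> real (3 * length r + 1) * (\<delta> * d n) + \<delta> * d n"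
        using norm_diff_triangle_le[OF elim] .
      also have "\<dots> = (3 * real (length r) + 2) * (\<delta> * d n)" by (simp add: algebra_simps)
      also have "\<dots> \<le> (3 * real L + 2) * (\<delta> * d n)"
        using L[OF r] \<delta> d0[of n] by (intro mult_right_mono) auto
      also have "\<dots> = ((3 * real L + 2) * \<delta>) * d n" by simp
      also have "(3 * real L + 2) * \<delta> = 1 / 2"
      proof -
        have "3 * real L + 2 \<noteq> 0" by linarith
        then show ?thesis by (simp only: \<delta>_def times_divide_eq_right mult_1_right divide_divide_eq_left[symmetric] divide_self_if)
            (simp add: divide_simps)
      qed
      finally show ?case by simp
    qed
  qed
  moreover have "eventually (\<lambda>n. \<forall>s\<in>S. norm (\<xi> n s - \<phi> n s) \<le> n * d n) U"
    using S
  proof (rule eventually_ball_finite, safe)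
    fix s assume s: "s \<in> S"
    then have w: "word_on S [(s, True)]" by simp
    obtain C1 where C1: "eventually (\<lambda>n. norm (\<xi> n s - \<sigma> n (pclass S R [(s, True)])) \<le> C1 * d n) U"
      using near[OF car[OF w]] unfolding \<xi>_def by blast
    have "pres_eq S R (rep S R (pclass S R [(s, True)])) [(s, True)]"
      using rep[OF car[OF w]] by (simp flip: pclass_eq_iff[OF SR])
    from ev_eq[OF this] obtain C2 where C2: "\<And>n. norm (\<sigma> n (pclass S R [(s, True)]) - \<phi> n s) \<le> C2 * d n"
      using \<phi> s by (auto simp: \<sigma>_def unitariesD(1))
    \<comment> \<open>The constants of closeness are fixed while the counterexamples allow distance
      \<open>n * d n\<close>; so from \<open>n = M\<close> on the distance condition in
      \<open>no\<close> is met.\<close>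
    obtain M :: nat where M: "C1 + C2 \<le> M" using real_arch_simple by blast
    have "eventually (\<lambda>n. M \<le> n) U"
      using nonprincipal_le_sequentially[OF U] eventually_ge_at_top filter_leD by blast
    with C1 show "eventually (\<lambda>n. norm (\<xi> n s - \<phi> n s) \<le> n * d n) U"
    proof eventually_elim
      case (elim n)
      have "norm (\<xi> n s - \<phi> n s) \<le> C1 * d n + C2 * d n" by (rule norm_diff_triangle_le[OF elim(1) C2])
      also have "\<dots> = (C1 + C2) * d n" by (simp add: distrib_right)
      also have "\<dots> \<le> n * d n" using M elim(2) d0[of n] by (intro mult_right_mono) auto
      finally show ?case .
    qed
  qed
  ultimately have "eventually (\<lambda>n. False) U"
  proof eventually_elim
    case (elim n)
    have "\<forall>s\<in>S. \<xi> n s \<in> unitaries (k n)" by (auto simp: \<xi>_def intro!: \<psi> car)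
    moreover have "wdefect R (k n) (\<xi> n) \<le> d n / 2"
      using elim(1) d0[of n] by (subst wdefect_le_iff[OF R(1)]) simp
    ultimately show False using elim(2) by (intro no[of "\<xi> n" n]) (auto simp: d_def)
  qed
  then show False using U_bot by (simp add: trivial_limit_def)
qed

section \<open>Stability\<close>

lemma tendsto_ev:
  assumes "\<And>s. s \<in> S \<Longrightarrow> (\<lambda>j. X j s) \<longlonglongrightarrow> L s"
  shows "word_on S w \<Longrightarrow> (\<lambda>j. ev k (X j) w) \<longlonglongrightarrow> ev k L w"
proof (induction w)
  case (Cons x w)
  obtain s b where x: "x = (s, b)" by (cases x)
  have "(\<lambda>j. letter (X j) x) \<longlonglongrightarrow> letter L x"
    using Cons.prems assms x by (cases b) (auto intro: tendsto_adj)
  then show ?case using Cons by (auto intro: tendsto_mult)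
qed simp

lemma geometric_limit:
  fixes X :: "nat \<Rightarrow> fmat"
  assumes X: "\<And>j. X j \<in> unitaries k" and step: "\<And>j. norm (X (Suc j) - X j) \<le> c / 2 ^ j"
  shows "\<exists>L\<in>unitaries k. X \<longlonglongrightarrow> L \<and> norm (X 0 - L) \<le> 2 * c"
proof -
  have c: "0 \<le> c" using order_trans[OF norm_ge_zero step[of 0]] by simp
  \<comment> \<open>Keeping the subtracted geometric remainder is what lets the induction on
    \<open>m\<close> close.\<close>
  have bound: "norm (X (j + m) - X j) \<le> 2 * c / 2 ^ j - 2 * c / 2 ^ (j + m)" for j m
  proof (induction m)
    case (Suc m)
    have "norm (X (j + Suc m) - X j) \<le> c / 2 ^ (j + m) + (2 * c / 2 ^ j - 2 * c / 2 ^ (j + m))"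
      using norm_diff_triangle_le[OF step[of "j + m"] Suc] by simp
    then show ?case by (simp add: field_simps)
  qed simp
  have bound': "norm (X i - X j) \<le> 2 * c / 2 ^ j" if "j \<le> i" for i j
  proof -
    have "0 \<le> 2 * c / 2 ^ i" using c by simp
    then show ?thesis using bound[of j "i - j"] that by simp
  qed
  have "(\<lambda>j. 2 * c * (1 / 2) ^ j) \<longlonglongrightarrow> 2 * c * 0" by (intro tendsto_mult tendsto_const LIMSEQ_power_zero) simp
  then have lim: "(\<lambda>j. 2 * c / 2 ^ j) \<longlonglongrightarrow> 0" by (simp add: power_one_over)
  have "Cauchy X"
  proof (rule CauchyI')
    fix e :: real assume "0 < e"
    then obtain M where M: "\<And>j. j \<ge> M \<Longrightarrow> 2 * c / 2 ^ j < e"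
      using order_tendstoD(2)[OF lim] unfolding eventually_sequentially by blast
    have "norm (X m - X n) < e" if "M \<le> m" "m < n" for m n
      using bound'[of m n] M[of m] that by (simp add: norm_minus_commute)
    then show "\<exists>M. \<forall>m\<ge>M. \<forall>n>m. dist (X m) (X n) < e" unfolding dist_norm by blast
  qed
  then obtain L where L: "X \<longlonglongrightarrow> L"
    using complete_corner[of k] X unfolding complete_def by (metis (no_types, lifting) mem_Collect_eq unitariesD(1))
  have "(\<lambda>j. norm (X j - X 0)) \<longlonglongrightarrow> norm (L - X 0)" by (intro tendsto_norm tendsto_diff L tendsto_const)
  then have "norm (L - X 0) \<le> 2 * c"
    by (rule LIMSEQ_le_const2) (use bound'[of 0] in auto)
  then show ?thesis using L closed_unitaries[OF X L] by (auto simp: norm_minus_commute)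
qed

text \<open>The defect decreases along the iteration, so the threshold \<open>e\<close> is never
  left. The steps are dominated by a geometric series of ratio 1/2, whose sum gives the factor
  \<open>2 * N\<close>, and continuity of word evaluation makes the defect of the limit 0.\<close>

lemma exact_representation:
  fixes S :: "'s set"
  assumes R: "finite R" "\<forall>r\<in>R. word_on S r"
    and improve: "\<And>\<phi>. \<forall>s\<in>S. \<phi> s \<in> unitaries k \<Longrightarrow> wdefect R k \<phi> < e \<Longrightarrow>
      \<exists>\<psi>. (\<forall>s\<in>S. \<psi> s \<in> unitaries k) \<and> wdefect R k \<psi> \<le> wdefect R k \<phi> / 2 \<and>
        (\<forall>s\<in>S. norm (\<psi> s - \<phi> s) \<le> N * wdefect R k \<phi>)"
    and N: "0 \<le> N" and \<phi>: "\<forall>s\<in>S. \<phi> s \<in> unitaries k" "wdefect R k \<phi> < e"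
  shows "\<exists>\<rho>. (\<forall>s\<in>S. \<rho> s \<in> unitaries k) \<and> wdefect R k \<rho> = 0 \<and>
    (\<forall>s\<in>S. norm (\<phi> s - \<rho> s) \<le> 2 * N * wdefect R k \<phi>)"
proof -
  have "\<forall>\<phi>. \<exists>\<psi>. (\<forall>s\<in>S. \<phi> s \<in> unitaries k) \<and> wdefect R k \<phi> < e \<longrightarrow>
      (\<forall>s\<in>S. \<psi> s \<in> unitaries k) \<and> wdefect R k \<psi> \<le> wdefect R k \<phi> / 2 \<and>
        (\<forall>s\<in>S. norm (\<psi> s - \<phi> s) \<le> N * wdefect R k \<phi>)"
    using improve by blast
  then obtain F where F: "\<And>\<phi>. \<forall>s\<in>S. \<phi> s \<in> unitaries k \<Longrightarrow> wdefect R k \<phi> < e \<Longrightarrow>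
      (\<forall>s\<in>S. F \<phi> s \<in> unitaries k) \<and> wdefect R k (F \<phi>) \<le> wdefect R k \<phi> / 2 \<and>
        (\<forall>s\<in>S. norm (F \<phi> s - \<phi> s) \<le> N * wdefect R k \<phi>)"
    by metis
  define X where "X j = (F ^^ j) \<phi>" for j
  define D where "D = wdefect R k \<phi>"
  have D: "0 \<le> D" "D < e" using wdefect_nonneg[OF R(1)] \<phi> by (auto simp: D_def)
  have X: "(\<forall>s\<in>S. X j s \<in> unitaries k) \<and> wdefect R k (X j) \<le> D / 2 ^ j" for j
  proof (induction j)
    case 0
    then show ?case using \<phi> by (simp add: X_def D_def)
  next
    case (Suc j)
    have "D / 2 ^ j \<le> D" using D by (simp add: divide_le_eq mult_le_cancel_left1)
    then have "wdefect R k (X j) < e" using Suc D by linarith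
    then have "(\<forall>s\<in>S. F (X j) s \<in> unitaries k) \<and> wdefect R k (F (X j)) \<le> wdefect R k (X j) / 2"
      using F[of "X j"] Suc by blast
    then show ?case using Suc by (auto simp: X_def)
  qed
  have step: "norm (X (Suc j) s - X j s) \<le> N * D / 2 ^ j" if "s \<in> S" for j s
  proof -
    have "D / 2 ^ j \<le> D" using D by (simp add: divide_le_eq mult_le_cancel_left1)
    then have "wdefect R k (X j) < e" using X[of j] D by linarith
    then have "norm (F (X j) s - X j s) \<le> N * wdefect R k (X j)" using F[of "X j"] X[of j] that by blast
    also have "\<dots> \<le> N * (D / 2 ^ j)" using X[of j] N by (intro mult_left_mono) auto
    finally show ?thesis by (simp add: X_def)
  qed
  have "\<forall>s. \<exists>L. s \<in> S \<longrightarrow> L \<in> unitaries k \<and> (\<lambda>j. X j s) \<longlonglongrightarrow> L \<and> norm (X 0 s - L) \<le> 2 * (N * D)"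
  proof
    fix s
    show "\<exists>L. s \<in> S \<longrightarrow> L \<in> unitaries k \<and> (\<lambda>j. X j s) \<longlonglongrightarrow> L \<and> norm (X 0 s - L) \<le> 2 * (N * D)"
      using geometric_limit[of "\<lambda>j. X j s" k "N * D"] X step by (cases "s \<in> S") auto
  qed
  then obtain L where L: "\<And>s. s \<in> S \<Longrightarrow> L s \<in> unitaries k" "\<And>s. s \<in> S \<Longrightarrow> (\<lambda>j. X j s) \<longlonglongrightarrow> L s"
    "\<And>s. s \<in> S \<Longrightarrow> norm (X 0 s - L s) \<le> 2 * (N * D)"
    by metis
  have "norm (ev k L r - idm k) \<le> 0" if r: "r \<in> R" for r
  proof (rule LIMSEQ_le)
    show "(\<lambda>j. norm (ev k (X j) r - idm k)) \<longlonglongrightarrow> norm (ev k L r - idm k)"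
      using R r L(2) by (intro tendsto_norm tendsto_diff tendsto_const tendsto_ev[of S]) auto
    have "(\<lambda>j. D * (1 / 2) ^ j) \<longlonglongrightarrow> D * 0" by (intro tendsto_mult tendsto_const LIMSEQ_power_zero) simp
    then show "(\<lambda>j. D / 2 ^ j) \<longlonglongrightarrow> 0" by (simp add: power_one_over)
    show "\<exists>N. \<forall>j\<ge>N. norm (ev k (X j) r - idm k) \<le> D / 2 ^ j"
      using X wdefect_ge[OF R(1) r] order_trans by blast
  qed
  then have "wdefect R k L \<le> 0" by (simp add: wdefect_le_iff[OF R(1)])
  then have "wdefect R k L = 0" using wdefect_nonneg[OF R(1), of k L] by simp
  then show ?thesis using L by (intro exI[of _ L]) (auto simp: X_def D_def mult.assoc)
qed

section \<open>Passing between \<open>fmat\<close> and the matrices of the statement\<close>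

lemma entry_Mat:
  assumes "unitary_mat k A" shows "entry (Mat A) = A"
proof (rule Mat_inverse)
  have "\<forall>i j. A i j \<noteq> 0 \<longrightarrow> i < k \<and> j < k" using assms unfolding unitary_mat_def by blast
  then show "A \<in> {A. \<exists>k. \<forall>i j. A i j \<noteq> 0 \<longrightarrow> i < k \<and> j < k}" by blast
qed

lemma entry_mult_mmult:
  assumes "corner k A" "corner k B" shows "entry (A * B) = mmult k (entry A) (entry B)"
  using corner_zero[OF corner_mult[OF assms]] by (intro ext) (auto simp: mmult_def entry_mult[OF assms(1)])

lemma unitary_mat_entry: "unitary_mat k (entry u) \<longleftrightarrow> u \<in> unitaries k"
proof -
  have "(\<forall>i j. \<not> (i < k \<and> j < k) \<longrightarrow> entry u i j = 0) \<longleftrightarrow> corner k u" unfolding corner_def by blast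
  moreover have "mmult k (madj (entry u)) (entry u) = mid k \<longleftrightarrow> adj u * u = idm k"
    "mmult k (entry u) (madj (entry u)) = mid k \<longleftrightarrow> u * adj u = idm k" if "corner k u"
    using that by (simp_all add: entry_mult_mmult[of k] adj.rep_eq idm.rep_eq flip: entry_inject)
  ultimately show ?thesis unfolding unitary_mat_def unitaries_def by blast
qed

lemma Mat_unitary: "unitary_mat k A \<Longrightarrow> Mat A \<in> unitaries k"
  by (simp add: entry_Mat flip: unitary_mat_entry)

lemma eval_word_ev:
  assumes "\<forall>s\<in>S. unitary_mat k (\<phi> s)"
  shows "word_on S w \<Longrightarrow> eval_word k \<phi> w = entry (ev k (\<lambda>s. Mat (\<phi> s)) w)"
proof (induction w)
  case Nil
  show ?case by (simp add: eval_word_def idm.rep_eq)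
next
  case (Cons x w)
  obtain s b where x: "x = (s, b)" by (cases x)
  have s: "unitary_mat k (\<phi> s)" and w: "word_on S w" using Cons.prems assms x by auto
  have M: "\<forall>s\<in>S. Mat (\<phi> s) \<in> unitaries k" using assms Mat_unitary by blast
  have "corner k (ev k (\<lambda>s. Mat (\<phi> s)) w)" using ev_unitary[OF M w] by (rule unitariesD(1))
  moreover have "corner k (Mat (\<phi> s))" using Mat_unitary[OF s] by (rule unitariesD(1))
  moreover have "eval_word k \<phi> (x # w) = mmult k (if b then \<phi> s else madj (\<phi> s)) (eval_word k \<phi> w)"
    by (simp add: eval_word_def x)
  ultimately show ?case using Cons.IH[OF w] s
    by (simp add: x entry_mult_mmult[of k] adj.rep_eq entry_Mat)
qed

lemma frob_norm: "corner k A \<Longrightarrow> corner k B \<Longrightarrow> frob k (\<lambda>i j. entry A i j - entry B i j) = norm (A - B)"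
  by (simp add: frob_def norm_corner[of k])

lemma pdef_wdefect:
  assumes "\<forall>r\<in>R. word_on S r" "\<forall>s\<in>S. unitary_mat k (\<phi> s)"
  shows "pdef R k \<phi> = wdefect R k (\<lambda>s. Mat (\<phi> s))"
proof -
  have M: "\<forall>s\<in>S. Mat (\<phi> s) \<in> unitaries k" using assms Mat_unitary by blast
  have "frob k (\<lambda>i j. eval_word k \<phi> r i j - mid k i j) = norm (ev k (\<lambda>s. Mat (\<phi> s)) r - idm k)" if "r \<in> R" for r
  proof -
    have r: "word_on S r" using assms that by blast
    show ?thesis unfolding eval_word_ev[OF assms(2) r] idm.rep_eq[symmetric]
      using ev_unitary[OF M r] by (intro frob_norm) (auto simp: unitariesD(1))
  qed
  then show ?thesis by (simp add: pdef_def wdefect_def cong: image_cong)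
qed

text \<open>With defect 0, evaluation is constant on classes, so evaluating at representatives
  defines a homomorphism \<open>h\<close>. It bounds the infimum from above, and it also shows that
  the set is non-empty, which the lower bound 0 for \<open>Inf\<close> requires.\<close>

lemma homdist_le:
  fixes S :: "'s set"
  assumes S: "finite S" and R: "finite R" "\<forall>r\<in>R. word_on S r"
    and \<phi>: "\<forall>s\<in>S. unitary_mat k (\<phi> s)" and \<rho>: "\<forall>s\<in>S. \<rho> s \<in> unitaries k" "wdefect R k \<rho> = 0"
    and c: "0 \<le> c" "\<forall>s\<in>S. norm (Mat (\<phi> s) - \<rho> s) \<le> c"
  shows "0 \<le> homdist S R k \<phi> \<and> homdist S R k \<phi> \<le> c"
proof -
  note SR = S R
  note rep = rep[OF SR]
  have ev_eq: "ev k \<rho> u = ev k \<rho> v" if eq: "pres_eq S R u v" for u v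
  proof -
    obtain C where "norm (ev k \<rho> u - ev k \<rho> v) \<le> C * wdefect R k \<rho>" using ev_pres_eq[OF SR eq] \<rho>(1) by blast
    then show ?thesis using \<rho>(2) by simp
  qed
  define h where "h A = entry (ev k \<rho> (rep S R A))" for A
  have h: "h (pclass S R w) = entry (ev k \<rho> w)" if w: "word_on S w" for w
  proof -
    have "pclass S R w \<in> carrier (pgroup S R)" using w by (simp add: pgroup_def)
    then have "pres_eq S R (rep S R (pclass S R w)) w" using rep pclass_eq_iff[OF SR] by blast
    then show ?thesis by (simp add: h_def ev_eq)
  qed
  have "h \<in> hom (pgroup S R) (Ugroup k)"
  proof (rule homI)
    fix A B assume "A \<in> carrier (pgroup S R)" "B \<in> carrier (pgroup S R)"
    then obtain u v where uv: "word_on S u" "A = pclass S R u" "word_on S v" "B = pclass S R v"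
      using rep by metis
    show "h A \<in> carrier (Ugroup k)"
      using ev_unitary[OF \<rho>(1) uv(1)] uv by (simp add: h Ugroup_def unitary_mat_entry)
    show "h (A \<otimes>\<^bsub>pgroup S R\<^esub> B) = h A \<otimes>\<^bsub>Ugroup k\<^esub> h B"
      using uv ev_unitary[OF \<rho>(1)]
      by (simp add: mult_pgroup[OF SR] h ev_append[OF \<rho>(1)] Ugroup_def entry_mult_mmult unitariesD(1))
  qed
  define dst where "dst h = Max (insert 0 ((\<lambda>s. frob k (\<lambda>i j. \<phi> s i j - h (pclass S R [(s, True)]) i j)) ` S))"
    for h :: "('s \<times> bool) list set \<Rightarrow> cmat"
  have dst0: "0 \<le> dst h" for h using S by (simp add: dst_def)
  have homdist: "homdist S R k \<phi> = Inf (dst ` hom (pgroup S R) (Ugroup k))"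
    by (simp add: homdist_def dst_def)
  have "frob k (\<lambda>i j. \<phi> s i j - h (pclass S R [(s, True)]) i j) \<le> c" if s: "s \<in> S" for s
  proof -
    have \<rho>s: "corner k (\<rho> s)" using \<rho> s unitariesD(1) by blast
    have "corner k (Mat (\<phi> s))" using \<phi> s Mat_unitary unitariesD(1) by blast
    moreover have "entry (Mat (\<phi> s)) = \<phi> s" using \<phi> s entry_Mat by blast
    ultimately have "frob k (\<lambda>i j. \<phi> s i j - entry (\<rho> s) i j) = norm (Mat (\<phi> s) - \<rho> s)"
      using frob_norm[OF _ \<rho>s] by metis
    then show ?thesis using s c \<rho>s by (simp add: h)
  qed
  then have "dst h \<le> c" using S c by (simp add: dst_def)
  moreover have "Inf (dst ` hom (pgroup S R) (Ugroup k)) \<le> dst h"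
    using dst0 \<open>h \<in> hom _ _\<close> by (intro cInf_lower bdd_belowI[of _ 0]) auto
  moreover have "0 \<le> Inf (dst ` hom (pgroup S R) (Ugroup k))"
    using dst0 \<open>h \<in> hom _ _\<close> by (intro cInf_greatest) auto
  ultimately show ?thesis by (simp add: homdist)
qed

theorem theorem1p2:
  fixes S :: "'s set" and R :: "('s \<times> bool) list set" and \<U> :: "nat filter"
    and emb :: "real \<Rightarrow> 'i"
  assumes "finite S" and "finite R" and "\<forall>r \<in> R. word_on S r"
    and "nonprincipal_ultrafilter \<U>"
    and "inj emb"
    and "\<forall>(I :: 'i set) \<pi>. unitary_rep (pgroup S R) I \<pi> \<longrightarrow>
           cohom_vanishes (pgroup S R) (ell2 I) \<pi> 2"
  shows "\<forall>(k :: nat \<Rightarrow> nat) (\<phi> :: nat \<Rightarrow> 's \<Rightarrow> cmat).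
           (\<forall>n. \<forall>s \<in> S. unitary_mat (k n) (\<phi> n s))
           \<and> ((\<lambda>n. pdef R (k n) (\<phi> n)) \<longlongrightarrow> 0) \<U>
           \<longrightarrow> ((\<lambda>n. homdist S R (k n) (\<phi> n)) \<longlongrightarrow> 0) \<U>"
proof (intro allI impI, elim conjE)
  fix k :: "nat \<Rightarrow> nat" and \<phi> :: "nat \<Rightarrow> 's \<Rightarrow> cmat"
  assume \<phi>: "\<forall>n. \<forall>s\<in>S. unitary_mat (k n) (\<phi> n s)" and lim: "((\<lambda>n. pdef R (k n) (\<phi> n)) \<longlongrightarrow> 0) \<U>"
  \<comment> \<open>The Hilbert spaces constructed above are \<open>ell2\<close> over sets of
    naturals; this injection carries them into the type \<open>'i\<close> of the hypothesis.\<close>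
  have "inj (emb \<circ> real)" using \<open>inj emb\<close> by (intro inj_compose) (auto intro: inj_of_nat)
  then obtain N :: nat where N: "\<And>k \<phi>. \<forall>s\<in>S. \<phi> s \<in> unitaries k \<Longrightarrow> wdefect R k \<phi> < 1 / Suc N \<Longrightarrow>
      \<exists>\<psi>. (\<forall>s\<in>S. \<psi> s \<in> unitaries k) \<and> wdefect R k \<psi> \<le> wdefect R k \<phi> / 2 \<and>
        (\<forall>s\<in>S. norm (\<psi> s - \<phi> s) \<le> N * wdefect R k \<phi>)"
    using uniform_improvement[OF assms(1-4), of "emb \<circ> real"] assms(6) by blast
  have bound: "0 \<le> homdist S R (k n) (\<phi> n) \<and> homdist S R (k n) (\<phi> n) \<le> 2 * N * pdef R (k n) (\<phi> n)"
    if small: "pdef R (k n) (\<phi> n) < 1 / Suc N" for n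
  proof -
    have pd: "pdef R (k n) (\<phi> n) = wdefect R (k n) (\<lambda>s. Mat (\<phi> n s))"
      using pdef_wdefect[of R S] assms(3) \<phi> by blast
    have "\<forall>s\<in>S. Mat (\<phi> n s) \<in> unitaries (k n)" using \<phi> Mat_unitary by blast
    then obtain \<rho> where \<rho>: "\<forall>s\<in>S. \<rho> s \<in> unitaries (k n)" "wdefect R (k n) \<rho> = 0"
      "\<forall>s\<in>S. norm (Mat (\<phi> n s) - \<rho> s) \<le> 2 * real N * wdefect R (k n) (\<lambda>s. Mat (\<phi> n s))"
      using exact_representation[where k = "k n" and e = "1 / Suc N" and N = N and \<phi> = "\<lambda>s. Mat (\<phi> n s)", OF assms(2,3) N] small unfolding pd by auto
    then show ?thesis unfolding pd using \<phi> wdefect_nonneg[OF assms(2)]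
      by (intro homdist_le[OF assms(1-3), of _ _ \<rho>]) auto
  qed
  have ev: "eventually (\<lambda>n. pdef R (k n) (\<phi> n) < 1 / Suc N) \<U>" by (rule order_tendstoD(2)[OF lim]) simp
  have "eventually (\<lambda>n. 0 \<le> homdist S R (k n) (\<phi> n)) \<U>"
    "eventually (\<lambda>n. homdist S R (k n) (\<phi> n) \<le> 2 * N * pdef R (k n) (\<phi> n)) \<U>"
    by (rule eventually_mono[OF ev], use bound in blast)+
  then show "((\<lambda>n. homdist S R (k n) (\<phi> n)) \<longlongrightarrow> 0) \<U>"
    by (rule real_tendsto_sandwich[OF _ _ tendsto_const tendsto_mult_right_zero[OF lim]])
qed

end
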